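(* Suppose that the temporal polynomial degree $p_t$ is the same for all $I_n\times K$, that the temporal test space $T_K(I_n)$ does not depend on the spatial element $K$ (no local refinement in time), and that the material parameters $\varepsilon,\mu$ are element-wise constant. Let $(E_h,H_h)\in V_h\times V_h$ satisfy $C_h((E_h,H_h),(v,w))=L((v,w))$ for all $(v,w)\in W_h\times W_h$. Then $$\mathcal E(t_{n+1})-\mathcal E(t_n)=(J,\pi E_h)-\langle n\times g,\pi H_h\rangle_{\mathcal F_b}.$$
   Context: Setting: the discretization, on one time slab, of Maxwell's equations $\varepsilon E_t-\operatorname{curl}H=J$, $\mu H_t+\operatorname{curl}E=0$ in $\Omega\subset\mathbb R^3$, with boundary condition $n\times E=n\times g$ on $\partial\Omega$. Here $\varepsilon(x),\mu(x):\Omega\to\mathbb R$ are the (positive, time-independent) permittivity and permeability, and $J,g$ are given data regular enough for the integrals below to exist. Mesh: $I_n=(t_n,t_{n+1}]$, $\Delta t=t_{n+1}-t_n$. $\Omega$ is partitioned into finitely many non-overlapping hexahedral elements $K=F_K(\hat K)$, $\hat K=[0,1]^3$, where $F_K$ is a smooth invertible map with Jacobian matrix $DF_K$. For each $K$, $I_n$ is partitioned into subintervals $I_1^K,\dots,I_{N_K}^K$. The space-time elements $I_k^K\times K$ carry a temporal degree $p_t\ge 1$ and spatial degrees $p_x,p_y,p_z$; the spatial degrees may depend on $K$ but not on $k$. Spaces: $P_p(I)$ denotes polynomials of degree at most $p$ on $I$, and $Q_{p_x,p_y,p_z}(\hat K)$ tensor product polynomials of degrees $p_x,p_y,p_z$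 in the three coordinates. Put $S_K(I_n)=\{u\in H^1(I_n):u|_{I_k^K}\in P_{p_t}(I_k^K)\ \forall k\}$ and $T_K(I_n)=\{u\in L_2(I_n):u|_{I_k^K}\in P_{p_t-1}(I_k^K)\ \forall k\}$. $V_h$ is the space of $v\in H^1(I_n;L_2(\Omega)^3)$ such that for each $K$, $DF_K^T\,(v|_K\circ F_K)\in S_K(I_n)\otimes[Q_{p_x,p_y,p_z}(\hat K)]^3$ (composition in the spatial variable). $W_h$ is the space of $v\in L_2(I_n;L_2(\Omega)^3)$ such that for each $K$, $DF_K^T\,(v|_K\circ F_K)\in T_K(I_n)\otimes[Q_{p_x,p_y,p_z}(\hat K)]^3$. Functions in both spaces may be discontinuous across spatial element interfaces. $\pi$ is the $L_2(I_n;L_2(\Omega)^3)$-orthogonal projection onto $W_h$. Faces and traces: $\mathcal F_0$ is the set of interior faces $f=\partial K^1\cap\partial K^2$, $\mathcal F_b$ the set of boundary faces $f=\partial K\cap\partial\Omega$. On an interior face, $\{v\}=(v^1+v^2)/2$ and $[v]_T=n^1\times v^1+n^2\times v^2$, where $v^i$ is the trace from $K^i$ and $n^i$ the outward unit normal of $K^i$. On a boundary face, $\{v\}=v$ and $[v]_T=n\times v$. Forms: $(a,b)=\int_{I_n}\int_\Omega a\cdot b\,dx\,dt$; $\langle a,b\rangle_{\mathcal G}=\int_{I_n}\sum_{f\in\mathcal G}\int_f a\cdot b\,dS\,dt$ for a set $\mathcal G$ of faces; $\operatorname{curl}_h$ is the element-wise curl in space. Then $$C_h((E_h,H_h),(v,w))=(\varepsilon\partial_tE_h,v)+(\mu\partial_tH_h,w)-(H_h,\operatorname{curl}_hv)+(\operatorname{curl}_hE_h,w)+\langle\{H_h\},[v]_T\rangle_{\mathcal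 F_0\cup\mathcal F_b}-\langle[E_h]_T,\{w\}\rangle_{\mathcal F_0\cup\mathcal F_b},$$ $$L((v,w))=(J,v)-\langle n\times g,w\rangle_{\mathcal F_b}.$$ Energy: $\mathcal E(t)=\frac12\int_\Omega(\varepsilon E_h\cdot E_h+\mu H_h\cdot H_h)\,dx$ at time $t$ (value at $t_n$ understood as the limit from within the slab). *)

theory Defs
  imports "HOL-Analysis.Analysis" "HOL-Computational_Algebra.Polynomial"
begin

type_synonym vfield = "real \<Rightarrow> real^3 \<Rightarrow> real^3"

definition pderiv_dir :: "3 \<Rightarrow> (real^3 \<Rightarrow> real^3) \<Rightarrow> real^3 \<Rightarrow> real^3" where
  "pderiv_dir i f x = frechet_derivative f (at x) (axis i 1)"

definition curl :: "(real^3 \<Rightarrow> real^3) \<Rightarrow> real^3 \<Rightarrow> real^3" where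
  "curl f x = vector
     [pderiv_dir 2 f x $ 3 - pderiv_dir 3 f x $ 2,
      pderiv_dir 3 f x $ 1 - pderiv_dir 1 f x $ 3,
      pderiv_dir 1 f x $ 2 - pderiv_dir 2 f x $ 1]"

definition dt :: "vfield \<Rightarrow> vfield" where
  "dt v t x = vector_derivative (\<lambda>s. v s x) (at t)"

primrec Ck_on :: "nat \<Rightarrow> (real^3) set \<Rightarrow> (real^3 \<Rightarrow> real^3) \<Rightarrow> bool" where
  "Ck_on 0 U f \<longleftrightarrow> continuous_on U f"
| "Ck_on (Suc k) U f \<longleftrightarrow>
     (\<forall>x\<in>U. f differentiable (at x)) \<and> (\<forall>i. Ck_on k U (pderiv_dir i f))"

text \<open>Smoothness up to the boundary of a closed set is understood as smoothness on an open
  neighbourhood.\<close>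

definition smooth_on_nbhd :: "(real^3) set \<Rightarrow> (real^3 \<Rightarrow> real^3) \<Rightarrow> bool" where
  "smooth_on_nbhd S f \<longleftrightarrow> (\<exists>U. open U \<and> S \<subseteq> U \<and> (\<forall>k. Ck_on k U f))"

definition L2_on :: "'a::euclidean_space set \<Rightarrow> ('a \<Rightarrow> 'b::euclidean_space) \<Rightarrow> bool" where
  "L2_on A u \<longleftrightarrow> u \<in> borel_measurable (lebesgue_on A) \<and>
                integrable (lebesgue_on A) (\<lambda>x. (norm (u x))\<^sup>2)"

definition C1_test :: "real \<Rightarrow> real \<Rightarrow> (real \<Rightarrow> real) \<Rightarrow> bool" where
  "C1_test a b \<phi> \<longleftrightarrow>
     (\<forall>t. \<phi> differentiable (at t)) \<and> continuous_on UNIV (deriv \<phi>) \<and>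
     (\<exists>c d. a < c \<and> c < d \<and> d < b \<and> (\<forall>t. t \<notin> {c..d} \<longrightarrow> \<phi> t = 0))"

text \<open>Weak derivatives on (a,b) are tested against compactly supported C^1 functions.\<close>

definition H1_on :: "real \<Rightarrow> real \<Rightarrow> (real \<Rightarrow> real) \<Rightarrow> bool" where
  "H1_on a b u \<longleftrightarrow> L2_on {a<..b} u \<and>
     (\<exists>g. L2_on {a<..b} g \<and>
        (\<forall>\<phi>. C1_test a b \<phi> \<longrightarrow>
           (LINT t:{a<..b}|lebesgue. u t * deriv \<phi> t)
             = - (LINT t:{a<..b}|lebesgue. g t * \<phi> t)))"

text \<open>L2((a,b]; L2(A)^3) is identified with L2((a,b] x A)^3; a weak time derivative is again a
  function in this space.\<close>

definition L2L2 :: "real \<Rightarrow> real \<Rightarrow> (real^3) set \<Rightarrow> vfield \<Rightarrow> bool" where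
  "L2L2 a b A v \<longleftrightarrow> L2_on ({a<..b} \<times> A) (\<lambda>(t, x). v t x)"

definition H1L2 :: "real \<Rightarrow> real \<Rightarrow> (real^3) set \<Rightarrow> vfield \<Rightarrow> bool" where
  "H1L2 a b A v \<longleftrightarrow> L2L2 a b A v \<and>
     (\<exists>g. L2L2 a b A g \<and>
        (\<forall>\<phi>. C1_test a b \<phi> \<longrightarrow>
           (AE x in lebesgue_on A.
              (LINT t:{a<..b}|lebesgue. deriv \<phi> t *\<^sub>R v t x)
                = - (LINT t:{a<..b}|lebesgue. \<phi> t *\<^sub>R g t x))))"

text \<open>Elements are numbered by \<open>K < nelem M\<close>. The subintervals of the slab
  \<open>(tstart M, tend M]\<close> belonging to \<open>K\<close> are numbered by \<open>k < nsub M K\<close>, and the k-th one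
  is \<open>(tpt M K k, tpt M K (k+1)]\<close>.\<close>

record slab =
  Dom :: "(real^3) set"
  nelem :: nat
  emap :: "nat \<Rightarrow> real^3 \<Rightarrow> real^3"
  tstart :: real
  tend :: real
  nsub :: "nat \<Rightarrow> nat"
  tpt :: "nat \<Rightarrow> nat \<Rightarrow> real"
  ptdeg :: "nat \<Rightarrow> nat \<Rightarrow> nat"
  pxdeg :: "nat \<Rightarrow> nat"
  pydeg :: "nat \<Rightarrow> nat"
  pzdeg :: "nat \<Rightarrow> nat"

abbreviation ref_cube :: "(real^3) set" where
  "ref_cube \<equiv> cbox 0 1"

definition slab_int :: "slab \<Rightarrow> real set" where
  "slab_int M = {tstart M <.. tend M}"

definition sub_int :: "slab \<Rightarrow> nat \<Rightarrow> nat \<Rightarrow> real set" where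
  "sub_int M K k = {tpt M K k <.. tpt M K (Suc k)}"

definition elem :: "slab \<Rightarrow> nat \<Rightarrow> (real^3) set" where
  "elem M K = emap M K ` ref_cube"

definition DF :: "slab \<Rightarrow> nat \<Rightarrow> real^3 \<Rightarrow> real^3^3" where
  "DF M K \<xi> = jacobian (emap M K) (at \<xi>)"

text \<open>The inclusions below give that the closure of the open set \<open>Dom M\<close> is the union of the
  closed elements and that \<open>Dom M\<close> is, up to a null set, the disjoint union of their
  interiors.\<close>

definition hex_slab :: "slab \<Rightarrow> bool" where
  "hex_slab M \<longleftrightarrow>
     open (Dom M) \<and> tstart M < tend M \<and>
     (\<forall>K<nelem M.
        smooth_on_nbhd ref_cube (emap M K) \<and> inj_on (emap M K) ref_cube \<and>
        (\<forall>\<xi>\<in>ref_cube. invertible (DF M K \<xi>))) \<and>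
     Dom M \<subseteq> (\<Union>K<nelem M. elem M K) \<and>
     (\<forall>K<nelem M. interior (elem M K) \<subseteq> Dom M) \<and>
     (\<forall>K<nelem M. \<forall>K'<nelem M. K \<noteq> K' \<longrightarrow>
        interior (elem M K) \<inter> interior (elem M K') = {}) \<and>
     (\<forall>K<nelem M.
        tpt M K 0 = tstart M \<and> tpt M K (nsub M K) = tend M \<and>
        (\<forall>k<nsub M K. tpt M K k < tpt M K (Suc k) \<and> 1 \<le> ptdeg M K k))"

definition P_space :: "nat \<Rightarrow> real set \<Rightarrow> (real \<Rightarrow> real) set" where
  "P_space p I = {u. \<exists>q::real poly. degree q \<le> p \<and> (\<forall>t\<in>I. u t = poly q t)}"

definition Q_space :: "nat \<Rightarrow> nat \<Rightarrow> nat \<Rightarrow> (real^3 \<Rightarrow> real) set" where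
  "Q_space px py pz =
     {q. \<exists>c :: nat \<Rightarrow> nat \<Rightarrow> nat \<Rightarrow> real. \<forall>\<xi>.
        q \<xi> = (\<Sum>i\<le>px. \<Sum>j\<le>py. \<Sum>l\<le>pz. c i j l * (\<xi> $ 1) ^ i * (\<xi> $ 2) ^ j * (\<xi> $ 3) ^ l)}"

definition Q3_space :: "slab \<Rightarrow> nat \<Rightarrow> (real^3 \<Rightarrow> real^3) set" where
  "Q3_space M K = {q. \<forall>i. (\<lambda>\<xi>. q \<xi> $ i) \<in> Q_space (pxdeg M K) (pydeg M K) (pzdeg M K)}"

definition S_space :: "slab \<Rightarrow> nat \<Rightarrow> (real \<Rightarrow> real) set" where
  "S_space M K = {u. H1_on (tstart M) (tend M) u \<and>
     (\<forall>k<nsub M K. u \<in> P_space (ptdeg M K k) (sub_int M K k))}"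

definition T_space :: "slab \<Rightarrow> nat \<Rightarrow> (real \<Rightarrow> real) set" where
  "T_space M K = {u. L2_on (slab_int M) u \<and>
     (\<forall>k<nsub M K. u \<in> P_space (ptdeg M K k - 1) (sub_int M K k))}"

definition tensor_space ::
  "(real \<Rightarrow> real) set \<Rightarrow> (real^3 \<Rightarrow> real^3) set \<Rightarrow> vfield set" where
  "tensor_space T Q =
     {u. \<exists>(m::nat) s q. (\<forall>j<m. s j \<in> T \<and> q j \<in> Q) \<and> u = (\<lambda>t \<xi>. \<Sum>j<m. s j t *\<^sub>R q j \<xi>)}"

text \<open>Discrete functions are represented by functions that have the prescribed form pointwise on
  the slab times each open element; their values on element boundaries (a null set) are
  arbitrary, and only traces are used there.\<close>

definition pulls_back_to :: "slab \<Rightarrow> nat \<Rightarrow> vfield \<Rightarrow> vfield set \<Rightarrow> bool" where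
  "pulls_back_to M K v X \<longleftrightarrow>
     (\<exists>u\<in>X. \<forall>t\<in>slab_int M. \<forall>\<xi>\<in>interior ref_cube.
        transpose (DF M K \<xi>) *v v t (emap M K \<xi>) = u t \<xi>)"

definition V_h :: "slab \<Rightarrow> vfield set" where
  "V_h M = {v. H1L2 (tstart M) (tend M) (Dom M) v \<and>
     (\<forall>K<nelem M. pulls_back_to M K v (tensor_space (S_space M K) (Q3_space M K)))}"

definition W_h :: "slab \<Rightarrow> vfield set" where
  "W_h M = {v. L2L2 (tstart M) (tend M) (Dom M) v \<and>
     (\<forall>K<nelem M. pulls_back_to M K v (tensor_space (T_space M K) (Q3_space M K)))}"

definition iprod :: "slab \<Rightarrow> vfield \<Rightarrow> vfield \<Rightarrow> real" where
  "iprod M a b = (LINT t:slab_int M|lebesgue. LINT x:Dom M|lebesgue. a t x \<bullet> b t x)"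

definition L2_proj_onto_W :: "slab \<Rightarrow> vfield \<Rightarrow> vfield" where
  "L2_proj_onto_W M v =
     (SOME w. w \<in> W_h M \<and> (\<forall>z\<in>W_h M. iprod M (\<lambda>t x. v t x - w t x) z = 0))"

text \<open>\<open>IFace K1 K2\<close> stands for the interior face between \<open>K1 < K2\<close>. Pairs whose
  boundaries meet in a set of dimension less than two (or not at all) carry no surface
  measure and do not contribute; the same holds for \<open>BFace K\<close>.\<close>

datatype face = IFace nat nat | BFace nat

definition F_0 :: "slab \<Rightarrow> face set" where
  "F_0 M = {IFace K1 K2 | K1 K2. K1 < K2 \<and> K2 < nelem M}"

definition F_b :: "slab \<Rightarrow> face set" where
  "F_b M = {BFace K | K. K < nelem M}"

fun face_set :: "slab \<Rightarrow> face \<Rightarrow> (real^3) set" where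
  "face_set M (IFace K1 K2) = frontier (elem M K1) \<inter> frontier (elem M K2)"
| "face_set M (BFace K) = frontier (elem M K) \<inter> frontier (Dom M)"

text \<open>The element whose map parametrizes the face in surface integrals.\<close>

fun face_elem :: "face \<Rightarrow> nat" where
  "face_elem (IFace K1 K2) = K1"
| "face_elem (BFace K) = K"

text \<open>Parametrization of the side \<open>\<xi> $ i = s\<close> of the reference cube, \<open>s = 0, 1\<close>, by the unit
  square; index arithmetic in type \<open>3\<close> is cyclic.\<close>

definition ref_side :: "3 \<Rightarrow> real \<Rightarrow> real^2 \<Rightarrow> real^3" where
  "ref_side i s \<eta> = (\<chi> l. if l = i then s else if l = i + 1 then \<eta> $ 1 else \<eta> $ 2)"

text \<open>Integrand, in the parameter \<open>\<eta>\<close>, of the surface integral of \<open>\<phi>\<close> over the part of \<open>A\<close> lying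
  on the image of one side; the last factor is the surface element.\<close>

definition surf_integrand ::
  "slab \<Rightarrow> nat \<Rightarrow> (real^3) set \<Rightarrow> (real^3 \<Rightarrow> real) \<Rightarrow> 3 \<Rightarrow> real \<Rightarrow> real^2 \<Rightarrow> real" where
  "surf_integrand M K A \<phi> i s \<eta> =
     (let \<xi> = ref_side i s \<eta>; x = emap M K \<xi> in
        indicator A x * \<phi> x *
        norm (cross3 (pderiv_dir (i + 1) (emap M K) \<xi>) (pderiv_dir (i + 2) (emap M K) \<xi>)))"

definition surf_integral ::
  "slab \<Rightarrow> nat \<Rightarrow> (real^3) set \<Rightarrow> (real^3 \<Rightarrow> real) \<Rightarrow> real" where
  "surf_integral M K A \<phi> =
     (\<Sum>i\<in>UNIV. \<Sum>s\<in>{0, 1}. LINT \<eta>:cbox 0 1|lebesgue. surf_integrand M K A \<phi> i s \<eta>)"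

text \<open>On the image of the side \<open>\<xi> $ i = s\<close>, the outward normal is the transformed normal
  \<open>DF\<^sup>-\<^sup>T (\<plusminus> e\<^sub>i)\<close>, normalized. On the edges of the element, a null set for
  the surface measure, one of the adjacent sides is picked.\<close>

definition out_normal :: "slab \<Rightarrow> nat \<Rightarrow> real^3 \<Rightarrow> real^3" where
  "out_normal M K x =
     (let \<xi> = inv_into ref_cube (emap M K) x;
          (i, s) = (SOME (i, s). s \<in> {0, 1} \<and> \<xi> $ i = s)
      in sgn (matrix_inv (transpose (DF M K \<xi>)) *v axis i (2 * s - 1)))"

definition trace_from :: "slab \<Rightarrow> nat \<Rightarrow> vfield \<Rightarrow> vfield" where
  "trace_from M K v t x = Lim (at x within interior (elem M K)) (v t)"

fun avg :: "slab \<Rightarrow> vfield \<Rightarrow> face \<Rightarrow> vfield" where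
  "avg M v (IFace K1 K2) t x = (1/2) *\<^sub>R (trace_from M K1 v t x + trace_from M K2 v t x)"
| "avg M v (BFace K) t x = trace_from M K v t x"

fun jump_T :: "slab \<Rightarrow> vfield \<Rightarrow> face \<Rightarrow> vfield" where
  "jump_T M v (IFace K1 K2) t x =
     cross3 (out_normal M K1 x) (trace_from M K1 v t x) +
     cross3 (out_normal M K2 x) (trace_from M K2 v t x)"
| "jump_T M v (BFace K) t x = cross3 (out_normal M K x) (trace_from M K v t x)"

definition n_cross :: "slab \<Rightarrow> vfield \<Rightarrow> face \<Rightarrow> vfield" where
  "n_cross M g f t x = cross3 (out_normal M (face_elem f) x) (g t x)"

definition face_iprod ::
  "slab \<Rightarrow> face set \<Rightarrow> (face \<Rightarrow> vfield) \<Rightarrow> (face \<Rightarrow> vfield) \<Rightarrow> real" where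
  "face_iprod M G a b =
     (LINT t:slab_int M|lebesgue.
        \<Sum>f\<in>G. surf_integral M (face_elem f) (face_set M f) (\<lambda>x. a f t x \<bullet> b f t x))"

definition curl_h :: "slab \<Rightarrow> vfield \<Rightarrow> vfield" where
  "curl_h M v t x = (if \<exists>K<nelem M. x \<in> interior (elem M K) then curl (v t) x else 0)"

definition C_h ::
  "slab \<Rightarrow> (real^3 \<Rightarrow> real) \<Rightarrow> (real^3 \<Rightarrow> real) \<Rightarrow> vfield \<times> vfield \<Rightarrow> vfield \<times> vfield \<Rightarrow> real" where
  "C_h M \<epsilon> \<mu> = (\<lambda>(E, H) (v, w).
     iprod M (\<lambda>t x. \<epsilon> x *\<^sub>R dt E t x) v + iprod M (\<lambda>t x. \<mu> x *\<^sub>R dt H t x) w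
     - iprod M H (curl_h M v) + iprod M (curl_h M E) w
     + face_iprod M (F_0 M \<union> F_b M) (avg M H) (jump_T M v)
     - face_iprod M (F_0 M \<union> F_b M) (jump_T M E) (avg M w))"

definition L_h :: "slab \<Rightarrow> vfield \<Rightarrow> vfield \<Rightarrow> vfield \<times> vfield \<Rightarrow> real" where
  "L_h M J g = (\<lambda>(v, w). iprod M J v - face_iprod M (F_b M) (n_cross M g) (avg M w))"

text \<open>The only regularity required of the data is that the integrals in the linear form exist
  for every test function.\<close>

definition admissible_data :: "slab \<Rightarrow> vfield \<Rightarrow> vfield \<Rightarrow> bool" where
  "admissible_data M J g \<longleftrightarrow>
     (\<forall>v\<in>W_h M. set_integrable lebesgue (slab_int M \<times> Dom M) (\<lambda>(t, x). J t x \<bullet> v t x)) \<and>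
     (\<forall>w\<in>W_h M. \<forall>f\<in>F_b M. \<forall>i. \<forall>s\<in>{0, 1}.
        set_integrable lebesgue (slab_int M \<times> cbox 0 1)
          (\<lambda>(t, \<eta>). surf_integrand M (face_elem f) (face_set M f)
             (\<lambda>x. n_cross M g f t x \<bullet> avg M w f t x) i s \<eta>))"

definition elementwise_constant :: "slab \<Rightarrow> (real^3 \<Rightarrow> real) \<Rightarrow> bool" where
  "elementwise_constant M c \<longleftrightarrow>
     (\<forall>K<nelem M. \<exists>c0. \<forall>x\<in>interior (elem M K). c x = c0)"

definition inst_energy ::
  "slab \<Rightarrow> (real^3 \<Rightarrow> real) \<Rightarrow> (real^3 \<Rightarrow> real) \<Rightarrow> vfield \<Rightarrow> vfield \<Rightarrow> real \<Rightarrow> real" where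
  "inst_energy M \<epsilon> \<mu> E H t =
     1/2 * (LINT x:Dom M|lebesgue. \<epsilon> x * (E t x \<bullet> E t x) + \<mu> x * (H t x \<bullet> H t x))"

definition energy ::
  "slab \<Rightarrow> (real^3 \<Rightarrow> real) \<Rightarrow> (real^3 \<Rightarrow> real) \<Rightarrow> vfield \<Rightarrow> vfield \<Rightarrow> real \<Rightarrow> real" where
  "energy M \<epsilon> \<mu> E H t =
     (if t = tstart M then Lim (at_right (tstart M)) (inst_energy M \<epsilon> \<mu> E H)
      else inst_energy M \<epsilon> \<mu> E H t)"

end

theory Submission
  imports Defs
begin

text \<open>The projection \<open>\<pi>\<close> onto the test space acts in time only: if \<open>u = \<Sum>i. s\<^sub>i(t) a\<^sub>i(x)\<close> on the
  open elements, then \<open>\<pi> u = \<Sum>i. r\<^sub>i(t) a\<^sub>i(x)\<close> for almost every \<open>t\<close>, where \<open>r\<^sub>i\<close> is the scalar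
  \<open>L\<^sub>2\<close>-projection of \<open>s\<^sub>i\<close> onto the time test space, which is the same for all elements. Each
  form in the scheme is a time integral of a fixed bilinear form in the spatial parts, so in every
  spatial term tested with \<open>\<pi> E\<close> or \<open>\<pi> H\<close> the other argument may be projected as well (or the
  projection moved to the other side). The curl terms and the face terms then cancel in pairs by
  symmetry, without integration by parts in space. In the time derivative terms \<open>s'\<^sub>i\<close> is itself a
  test coefficient, so \<open>r\<^sub>j\<close> may be replaced by \<open>s\<^sub>j\<close>, and the product rule gives the energy
  difference.\<close>

section \<open>Element charts\<close>

text \<open>Curls and traces are pointwise notions in space, whereas the projection comes from a
  choice operator and is pinned down only for almost every time and inside the open elements.
  Expansions are therefore demanded at every interior point but only off a null set of times;
  continuity in space makes this attainable. Two further obstacles shape the development. The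
  integral of a non-integrable function is zero by convention, so each rearrangement of sums and
  integrals needs integrability of its terms, including face terms whose normals are again defined
  by choice. Bounded Borel functions on bounded sets supply it uniformly. Moreover, the time
  coefficients are weakly differentiable and prescribed piecewise on half-open subintervals: that
  they have no jumps, and hence extend continuously to the closed slab, must be derived from the
  weak derivative before any product rule applies.\<close>

definition C1_on :: "'a::euclidean_space set \<Rightarrow> ('a \<Rightarrow> real) \<Rightarrow> bool" where
  "C1_on U f \<longleftrightarrow> (\<exists>D. continuous_on U D \<and> (\<forall>x\<in>U. (f has_derivative (\<lambda>h. D x \<bullet> h)) (at x)))"

lemma C1_onI:
  assumes "continuous_on U D" "\<And>x. x \<in> U \<Longrightarrow> (f has_derivative (\<lambda>h. D x \<bullet> h)) (at x)"
  shows "C1_on U f"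
  using assms unfolding C1_on_def by blast

lemma C1_on_continuous: "C1_on U f \<Longrightarrow> continuous_on U f"
  unfolding C1_on_def by (meson continuous_at_imp_continuous_on has_derivative_continuous)

lemma C1_on_subset: "C1_on U f \<Longrightarrow> V \<subseteq> U \<Longrightarrow> C1_on V f"
  unfolding C1_on_def by (meson continuous_on_subset subsetD)

lemma C1_on_const: "C1_on U (\<lambda>x. c)"
  by (rule C1_onI[where D="\<lambda>_. 0"]) auto

lemma C1_on_inner: "C1_on U (\<lambda>x. x \<bullet> c)"
  by (rule C1_onI[where D="\<lambda>_. c"]) (auto intro!: derivative_eq_intros simp: inner_commute)

lemma C1_on_coord: "C1_on U (\<lambda>x::real^'n. x $ i)"
  using C1_on_inner[of U "axis i 1 :: real^'n"] by (simp add: inner_axis)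

lemma C1_on_add:
  assumes "C1_on U f" "C1_on U g"
  shows "C1_on U (\<lambda>x. f x + g x)"
proof -
  obtain Df Dg where *: "continuous_on U Df" "continuous_on U Dg"
    "\<And>x. x \<in> U \<Longrightarrow> (f has_derivative (\<lambda>h. Df x \<bullet> h)) (at x)"
    "\<And>x. x \<in> U \<Longrightarrow> (g has_derivative (\<lambda>h. Dg x \<bullet> h)) (at x)"
    using assms unfolding C1_on_def by blast
  show ?thesis
    by (rule C1_onI[where D="\<lambda>x. Df x + Dg x"])
      (use * in \<open>auto intro!: continuous_intros derivative_eq_intros simp: inner_left_distrib\<close>)
qed

lemma C1_on_mult:
  assumes "C1_on U f" "C1_on U g"
  shows "C1_on U (\<lambda>x. f x * g x)"
proof -
  obtain Df Dg where *: "continuous_on U Df" "continuous_on U Dg"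
    "\<And>x. x \<in> U \<Longrightarrow> (f has_derivative (\<lambda>h. Df x \<bullet> h)) (at x)"
    "\<And>x. x \<in> U \<Longrightarrow> (g has_derivative (\<lambda>h. Dg x \<bullet> h)) (at x)"
    using assms unfolding C1_on_def by blast
  show ?thesis
    by (rule C1_onI[where D="\<lambda>x. f x *\<^sub>R Dg x + g x *\<^sub>R Df x"])
      (use * C1_on_continuous[OF assms(1)] C1_on_continuous[OF assms(2)] in
        \<open>auto intro!: continuous_intros derivative_eq_intros simp: inner_left_distrib\<close>)
qed

lemma C1_on_inverse:
  assumes "C1_on U f" "\<And>x. x \<in> U \<Longrightarrow> f x \<noteq> 0"
  shows "C1_on U (\<lambda>x. inverse (f x))"
proof -
  obtain Df where *: "continuous_on U Df"
    "\<And>x. x \<in> U \<Longrightarrow> (f has_derivative (\<lambda>h. Df x \<bullet> h)) (at x)"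
    using assms unfolding C1_on_def by blast
  show ?thesis
    by (rule C1_onI[where D="\<lambda>x. - (inverse (f x) * inverse (f x)) *\<^sub>R Df x"])
      (use * C1_on_continuous[OF assms(1)] assms(2) in
        \<open>auto intro!: continuous_intros derivative_eq_intros simp: inner_left_distrib\<close>)
qed

lemma C1_on_divide:
  "C1_on U f \<Longrightarrow> C1_on U g \<Longrightarrow> (\<And>x. x \<in> U \<Longrightarrow> g x \<noteq> 0) \<Longrightarrow> C1_on U (\<lambda>x. f x / g x)"
  by (simp add: divide_inverse C1_on_mult C1_on_inverse)

lemma C1_on_diff: "C1_on U f \<Longrightarrow> C1_on U g \<Longrightarrow> C1_on U (\<lambda>x. f x - g x)"
  using C1_on_add[of U f "\<lambda>x. (-1) * g x"] C1_on_mult[OF C1_on_const, of U g "-1"] by simp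

lemma C1_on_power: "C1_on U f \<Longrightarrow> C1_on U (\<lambda>x. f x ^ n)"
  by (induction n) (auto intro: C1_on_const C1_on_mult)

lemma C1_on_sum: "(\<And>i. i \<in> I \<Longrightarrow> C1_on U (f i)) \<Longrightarrow> C1_on U (\<lambda>x. \<Sum>i\<in>I. f i x)"
  by (induction I rule: infinite_finite_induct) (auto intro: C1_on_const C1_on_add)

lemma C1_on_det:
  fixes A :: "'a::euclidean_space \<Rightarrow> real^3^3"
  assumes "\<And>i j. C1_on U (\<lambda>x. A x $ i $ j)"
  shows "C1_on U (\<lambda>x. det (A x))"
  unfolding det_3 by (intro C1_on_add C1_on_diff C1_on_mult assms)

lemma matrix_inv_mult_vec:
  fixes A :: "real^'n^'n"
  assumes "invertible A"
  shows "A *v (matrix_inv A *v b) = b" "matrix_inv A *v (A *v b) = b"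
proof -
  have "A ** matrix_inv A = mat 1 \<and> matrix_inv A ** A = mat 1"
    using assms unfolding invertible_def matrix_inv_def by (rule someI_ex)
  then show "A *v (matrix_inv A *v b) = b" "matrix_inv A *v (A *v b) = b"
    by (simp_all add: matrix_vector_mul_assoc)
qed

text \<open>By Cramer's rule each component is a quotient of two determinants in the entries of
  \<open>A\<close> and \<open>b\<close>, hence C^1 without differentiating the inverse. Openness of
  \<open>U\<close> carries the derivative over from that quotient, whose agreement with the
  component is known only on \<open>U\<close>.\<close>

lemma C1_on_matrix_inv_mult:
  fixes A :: "'a::euclidean_space \<Rightarrow> real^3^3"
  assumes A: "\<And>i j. C1_on U (\<lambda>x. A x $ i $ j)" and b: "\<And>i. C1_on U (\<lambda>x. b x $ i)"
    and inv: "\<And>x. x \<in> U \<Longrightarrow> invertible (A x)" and "open U"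
  shows "C1_on U (\<lambda>x. (matrix_inv (A x) *v b x) $ k)"
proof -
  define d where "d x = det (\<chi> i j. if j = k then b x $ i else A x $ i $ j) / det (A x)" for x
  have eq: "(matrix_inv (A x) *v b x) $ k = d x" if "x \<in> U" for x
    using cramer[of "A x" "matrix_inv (A x) *v b x" "b x"] inv[OF that]
      matrix_inv_mult_vec(1)[OF inv[OF that]]
    unfolding d_def by (simp add: invertible_det_nz vec_eq_iff)
  have "C1_on U d"
    unfolding d_def
  proof (intro C1_on_divide C1_on_det A)
    show "C1_on U (\<lambda>x. (\<chi> i j. if j = k then b x $ i else A x $ i $ j) $ i $ j)" for i j
      using A b by (cases "j = k") simp_all
  qed (use inv invertible_det_nz in auto)
  then obtain D where D: "continuous_on U D"
    "\<And>x. x \<in> U \<Longrightarrow> (d has_derivative (\<lambda>h. D x \<bullet> h)) (at x)"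
    unfolding C1_on_def by blast
  have "((\<lambda>x. (matrix_inv (A x) *v b x) $ k) has_derivative (\<lambda>h. D x \<bullet> h)) (at x)"
    if "x \<in> U" for x
    by (rule has_derivative_transform_within_open[OF D(2) \<open>open U\<close>]) (use that eq in auto)
  then show ?thesis
    using D(1) by (auto intro: C1_onI)
qed

section \<open>One element: its map, the inverse map and the covariant transform\<close>

locale chart =
  fixes F :: "real^3 \<Rightarrow> real^3"
  assumes smooth: "smooth_on_nbhd ref_cube F" and inj: "inj_on F ref_cube"
    and inv_jac: "\<And>\<xi>. \<xi> \<in> ref_cube \<Longrightarrow> invertible (jacobian F (at \<xi>))"
begin

abbreviation "J \<xi> \<equiv> jacobian F (at \<xi>)"
abbreviation "G \<equiv> inv_into ref_cube F"
abbreviation "E \<equiv> F ` ref_cube"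

lemma jac_entry: "J \<xi> $ i $ j = pderiv_dir j F \<xi> $ i"
  by (simp add: jacobian_def matrix_def pderiv_dir_def)

text \<open>Invertibility is given only on the closed cube. Since the determinant is continuous on
  the neighbourhood of smoothness, the set where it does not vanish is a smaller open neighbourhood,
  so later formulas are C^1 up to the boundary of the cube.\<close>

lemma nbhd:
  obtains U where "open U" "ref_cube \<subseteq> U" "\<And>x. x \<in> U \<Longrightarrow> F differentiable (at x)"
    "\<And>i j. C1_on U (\<lambda>\<xi>. J \<xi> $ i $ j)" "\<And>x. x \<in> U \<Longrightarrow> invertible (J x)"
proof -
  obtain V where V: "open V" "ref_cube \<subseteq> V" "\<And>k. Ck_on k V F"
    using smooth unfolding smooth_on_nbhd_def by blast
  have C1: "C1_on V (\<lambda>\<xi>. J \<xi> $ i $ j)" for i j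
  proof (rule C1_onI)
    \<comment> \<open>Smoothness of order two for the map leaves order one for each column of its
      Jacobian.\<close>
    have c: "Ck_on (Suc 0) V (pderiv_dir j F)"
      using V(3)[of "Suc (Suc 0)"] by auto
    show "continuous_on V (\<lambda>\<xi>. \<chi> l. pderiv_dir l (pderiv_dir j F) \<xi> $ i)"
      using c by (intro continuous_intros) auto
    fix x assume "x \<in> V"
    then have "(pderiv_dir j F has_derivative frechet_derivative (pderiv_dir j F) (at x)) (at x)"
      using c by (simp add: frechet_derivative_works)
    then have d: "((\<lambda>\<xi>. pderiv_dir j F \<xi> $ i) has_derivative
        (\<lambda>h. frechet_derivative (pderiv_dir j F) (at x) h $ i)) (at x)"
      by (rule bounded_linear.has_derivative[OF bounded_linear_vec_nth])
    interpret l: bounded_linear "\<lambda>h. frechet_derivative (pderiv_dir j F) (at x) h $ i"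
      using d by (rule has_derivative_bounded_linear)
    have "frechet_derivative (pderiv_dir j F) (at x) h $ i =
        (\<chi> l. pderiv_dir l (pderiv_dir j F) x $ i) \<bullet> h" for h
    proof -
      have "h = (\<Sum>l\<in>UNIV. h $ l *\<^sub>R axis l 1)"
        using basis_expansion[of h] by (simp add: scalar_mult_eq_scaleR)
      then have "frechet_derivative (pderiv_dir j F) (at x) h $ i =
          frechet_derivative (pderiv_dir j F) (at x) (\<Sum>l\<in>UNIV. h $ l *\<^sub>R axis l 1) $ i"
        by simp
      also have "\<dots> = (\<Sum>l\<in>UNIV. h $ l * frechet_derivative (pderiv_dir j F) (at x) (axis l 1) $ i)"
        by (simp add: l.sum l.scaleR)
      finally show ?thesis
        by (simp add: inner_vec_def pderiv_dir_def mult.commute)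
    qed
    then show "((\<lambda>\<xi>. J \<xi> $ i $ j) has_derivative
        (\<lambda>h. (\<chi> l. pderiv_dir l (pderiv_dir j F) x $ i) \<bullet> h)) (at x)"
      using d by (simp add: jac_entry)
  qed
  define U where "U = {x\<in>V. det (J x) \<noteq> 0}"
  have "open U"
    unfolding U_def using V(1) C1_on_continuous[OF C1_on_det[OF C1]]
    using continuous_open_preimage[of V "\<lambda>x. det (J x)" "- {0}"]
    by (auto simp: vimage_def Int_def)
  show thesis
  proof (rule that[OF \<open>open U\<close>])
    show "ref_cube \<subseteq> U"
      using V(2) inv_jac unfolding U_def by (auto simp: invertible_det_nz)
    show "F differentiable (at x)" if "x \<in> U" for x
      using that V(3)[of "Suc 0"] by (auto simp: U_def)
    show "C1_on U (\<lambda>\<xi>. J \<xi> $ i $ j)" for i j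
      by (rule C1_on_subset[OF C1]) (auto simp: U_def)
    show "invertible (J x)" if "x \<in> U" for x
      using that by (simp add: U_def invertible_det_nz)
  qed
qed

lemma cont_F: "continuous_on ref_cube F"
  by (rule nbhd) (meson continuous_at_imp_continuous_on differentiable_imp_continuous_within subsetD)

lemma compact_E: "compact E"
  by (rule compact_continuous_image[OF cont_F compact_cbox])

lemma cont_G: "continuous_on E G"
  using continuous_on_inv_into[OF cont_F compact_cbox inj]
  by (metis (no_types, lifting) continuous_on_cong f_inv_into_f inj inv_into_into the_inv_into_f_f)

lemma G_F: "\<xi> \<in> ref_cube \<Longrightarrow> G (F \<xi>) = \<xi>"
  using inj by simp

text \<open>Invariance of domain, applied to the map on the cube and to its continuous inverse on
  the element.\<close>

lemma interior_E: "interior E = F ` interior ref_cube"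
proof
  show "F ` interior ref_cube \<subseteq> interior E"
    using continuous_image_subset_interior[OF cont_F inj] by auto
  have "inj_on G E"
    by (rule inj_on_inv_into) simp
  then have "G \<in> interior E \<rightarrow> interior (G ` E)"
    by (intro continuous_image_subset_interior cont_G) auto
  moreover have "G ` E = ref_cube"
    using inj by (simp add: image_image)
  ultimately show "interior E \<subseteq> F ` interior ref_cube"
    by (smt (verit, best) Pi_iff f_inv_into_f image_eqI interior_subset subset_eq)
qed

lemma G_interior: "x \<in> interior E \<Longrightarrow> G x \<in> interior ref_cube"
  unfolding interior_E using G_F interior_subset by fastforce

text \<open>The cube is the closure of its interior, and the continuous map transports this. It
  makes every boundary point of an element a limit of interior points, as one-sided traces
  require.\<close>

lemma E_subset_closure: "E \<subseteq> closure (interior E)"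
proof -
  have eq: "closure (interior (ref_cube :: (real^3) set)) = ref_cube"
    by (simp add: interior_cbox box_ne_empty Basis_vec_def inner_axis)
  have "F ` closure (interior ref_cube) \<subseteq> closure (F ` interior ref_cube)"
    by (rule image_closure_subset) (auto simp only: eq cont_F intro!: closure_subset)
  then have "E \<subseteq> closure (F ` interior ref_cube)"
    unfolding eq .
  then show ?thesis
    by (simp add: interior_E)
qed

text \<open>A differentiable map between spaces of equal dimension sends the null boundary of the
  cube to a null set. Values on element boundaries therefore never affect volume integrals.\<close>

lemma negligible_boundary: "negligible (E - interior E)"
proof -
  have "negligible (F ` (ref_cube - interior ref_cube))"
  proof (rule negligible_differentiable_image_negligible)
    show "negligible (ref_cube - interior (ref_cube :: (real^3) set))"
      using negligible_frontier_interval[of "0::real^3" 1] by (simp add: interior_cbox)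
    show "F differentiable_on (ref_cube - interior ref_cube)"
      by (rule nbhd) (meson DiffD1 differentiable_at_imp_differentiable_on subsetD)
  qed simp
  then show ?thesis
    by (rule negligible_subset) (auto simp: interior_E)
qed

lemma trans_inv: "\<xi> \<in> ref_cube \<Longrightarrow> invertible (transpose (J \<xi>))"
  by (simp add: inv_jac transpose_invertible)

text \<open>The inverse function theorem at an interior point; the inverse itself is already given
  globally by injectivity, so only its derivative is at stake.\<close>

lemma has_derivative_G:
  assumes "x \<in> interior E"
  shows "(G has_derivative (\<lambda>h. matrix_inv (J (G x)) *v h)) (at x)"
proof (rule has_derivative_inverse_strong_x)
  show "open (interior (ref_cube :: (real^3) set))" by (rule open_interior)
  show "G x \<in> interior ref_cube" by (rule G_interior[OF assms])
  then have G: "G x \<in> ref_cube" using interior_subset by blast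
  show "continuous_on (interior ref_cube) F"
    by (rule continuous_on_subset[OF cont_F interior_subset])
  show "G (F y) = y" if "y \<in> interior ref_cube" for y
    using that G_F interior_subset by blast
  show "(F has_derivative (\<lambda>h. J (G x) *v h)) (at (G x))"
    by (rule nbhd) (use G jacobian_works in blast)
  show "(*v) (J (G x)) \<circ> (*v) (matrix_inv (J (G x))) = id"
    using matrix_inv_mult_vec(1)[OF inv_jac[OF G]] by auto
  show "F (G x) = x"
    using assms interior_subset by (blast intro: f_inv_into_f)
qed

text \<open>The covariant Piola transform, inverse to the pullback in \<open>pulls_back_to\<close>.
  As the Jacobian is invertible on the whole closed cube, it is meaningful on the closed element and
  so supplies boundary values.\<close>

definition piola :: "(real^3 \<Rightarrow> real^3) \<Rightarrow> real^3 \<Rightarrow> real^3" where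
  "piola q x = matrix_inv (transpose (J (G x))) *v q (G x)"

text \<open>The transform is the composition of \<open>B\<close> with \<open>G\<close>, where
  \<open>B\<close> is C^1 on a neighbourhood of the cube. The chain rule is applied only inside the
  element, where \<open>G\<close> is differentiable, but the formula it yields is continuous on the
  closed element. The third part records this because it bounds the curl up to the boundary.\<close>

lemma piola_C1:
  assumes q: "\<And>i. C1_on UNIV (\<lambda>\<xi>. q \<xi> $ i)"
  shows "continuous_on E (piola q)"
    and "x \<in> interior E \<Longrightarrow> piola q differentiable (at x)"
    and "\<exists>P. \<forall>l. continuous_on E (P l) \<and> (\<forall>x\<in>interior E. pderiv_dir l (piola q) x = P l x)"
proof -
  obtain U where U: "open U" "ref_cube \<subseteq> U" "\<And>i j. C1_on U (\<lambda>\<xi>. J \<xi> $ i $ j)"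
    "\<And>x. x \<in> U \<Longrightarrow> invertible (J x)"
    by (rule nbhd) blast
  define B where "B \<xi> = matrix_inv (transpose (J \<xi>)) *v q \<xi>" for \<xi>
  have "C1_on U (\<lambda>\<xi>. B \<xi> $ k)" for k
    unfolding B_def
  proof (rule C1_on_matrix_inv_mult)
    show "C1_on U (\<lambda>\<xi>. transpose (J \<xi>) $ i $ j)" for i j
      using U(3) by (simp add: transpose_def)
    show "C1_on U (\<lambda>\<xi>. q \<xi> $ i)" for i
      by (rule C1_on_subset[OF q]) simp
    show "invertible (transpose (J \<xi>))" if "\<xi> \<in> U" for \<xi>
      by (rule transpose_invertible[OF U(4)[OF that]])
  qed (rule U(1))
  then have "\<exists>D. \<forall>k. continuous_on U (D k) \<and>
      (\<forall>\<xi>\<in>U. ((\<lambda>\<xi>. B \<xi> $ k) has_derivative (\<lambda>h. D k \<xi> \<bullet> h)) (at \<xi>))"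
    unfolding C1_on_def by metis
  then obtain D where D: "\<And>k. continuous_on U (D k)"
    "\<And>k \<xi>. \<xi> \<in> U \<Longrightarrow> ((\<lambda>\<xi>. B \<xi> $ k) has_derivative (\<lambda>h. D k \<xi> \<bullet> h)) (at \<xi>)"
    by blast
  have GE: "G ` E \<subseteq> U"
    using U(2) G_F by auto
  have B: "(B has_derivative (\<lambda>h. \<chi> k. D k \<xi> \<bullet> h)) (at \<xi>)" if "\<xi> \<in> U" for \<xi>
    by (subst has_derivative_componentwise_within)
      (auto simp: Basis_vec_def inner_axis intro: D(2)[OF that])
  have "continuous_on U B"
    using B by (meson continuous_at_imp_continuous_on has_derivative_continuous)
  then show "continuous_on E (piola q)"
    unfolding piola_def B_def[symmetric]
    by (rule continuous_on_compose2[OF _ cont_G GE])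
  have der: "(piola q has_derivative (\<lambda>h. \<chi> k. D k (G x) \<bullet> (matrix_inv (J (G x)) *v h))) (at x)"
    if "x \<in> interior E" for x
  proof -
    have "G x \<in> U"
      using that GE interior_subset by blast
    from has_derivative_compose[OF has_derivative_G[OF that] B[OF this]]
    show ?thesis
      unfolding piola_def[abs_def] B_def .
  qed
  then show "x \<in> interior E \<Longrightarrow> piola q differentiable (at x)"
    unfolding differentiable_def by blast
  define P where "P l x = (\<chi> k. D k (G x) \<bullet> (matrix_inv (J (G x)) *v axis l 1))" for l :: 3 and x
  have "C1_on U (\<lambda>\<xi>. (matrix_inv (J \<xi>) *v axis l 1) $ k)" for k l
    by (rule C1_on_matrix_inv_mult) (use U C1_on_const in auto)
  then have "continuous_on U (\<lambda>\<xi>. matrix_inv (J \<xi>) *v axis l 1)" for l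
    using C1_on_continuous continuous_on_componentwise[of U "\<lambda>\<xi>. matrix_inv (J \<xi>) *v axis l 1"]
    by (auto simp: Basis_vec_def inner_axis)
  then have "continuous_on E (P l)" for l
    unfolding P_def
    by (intro continuous_intros continuous_on_compose2[OF D(1) cont_G GE]
        continuous_on_compose2[OF _ cont_G GE])
  moreover have "pderiv_dir l (piola q) x = P l x" if "x \<in> interior E" for l x
    unfolding pderiv_dir_def frechet_derivative_at[OF der[OF that], symmetric] P_def ..
  ultimately show "\<exists>P. \<forall>l. continuous_on E (P l) \<and> (\<forall>x\<in>interior E. pderiv_dir l (piola q) x = P l x)"
    by blast
qed

lemma piola_curl:
  assumes q: "\<And>i. C1_on UNIV (\<lambda>\<xi>. q \<xi> $ i)"
  shows "\<exists>c. continuous_on E c \<and> (\<forall>x\<in>interior E. curl (piola q) x = c x)"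
proof -
  obtain P where P: "\<And>l. continuous_on E (P l)"
    "\<And>l x. x \<in> interior E \<Longrightarrow> pderiv_dir l (piola q) x = P l x"
    using piola_C1(3)[OF q] by blast
  define c where "c x = (vector [P 2 x $ 3 - P 3 x $ 2, P 3 x $ 1 - P 1 x $ 3,
     P 1 x $ 2 - P 2 x $ 1] :: real^3)" for x
  have "continuous_on E (\<lambda>x. c x $ k)" for k
    using exhaust_3[of k] P(1) unfolding c_def
    by (elim disjE) (auto intro!: continuous_intros simp: vector_3)
  then have "continuous_on E c"
    by (subst continuous_on_componentwise) (auto simp: Basis_vec_def inner_axis)
  moreover have "curl (piola q) x = c x" if "x \<in> interior E" for x
    using P(2)[OF that] by (simp add: curl_def c_def)
  ultimately show ?thesis by blast
qed

lemma piola_pullback: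
  "\<xi> \<in> ref_cube \<Longrightarrow> transpose (J \<xi>) *v piola q (F \<xi>) = q \<xi>"
  by (simp only: piola_def G_F matrix_inv_mult_vec(1)[OF trans_inv])

lemma pullback_piola:
  assumes "\<xi> \<in> ref_cube" "transpose (J \<xi>) *v w = q \<xi>"
  shows "w = piola q (F \<xi>)"
  by (simp only: piola_def G_F[OF assms(1)] assms(2)[symmetric]
      matrix_inv_mult_vec(2)[OF trans_inv[OF assms(1)]])

lemma piola_sum:
  "piola (\<lambda>\<xi>. \<Sum>i\<in>I. s i *\<^sub>R q i \<xi>) x = (\<Sum>i\<in>I. s i *\<^sub>R piola (q i) x)"
  unfolding piola_def linear_sum[OF matrix_vector_mul_linear] matrix_vector_mult_scaleR ..

end

section \<open>Bounded Borel functions and jumps of weakly differentiable functions\<close>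

text \<open>On bounded Borel sets such functions are integrable, and the class is stable under sums
  and bilinear products. Borel rather than Lebesgue measurability is demanded because surface
  integrals compose with continuous parametrizations, which need not preserve Lebesgue
  measurability.\<close>

definition bounded_borel :: "'a::euclidean_space set \<Rightarrow> ('a \<Rightarrow> 'b::euclidean_space) \<Rightarrow> bool" where
  "bounded_borel A f \<longleftrightarrow> (\<lambda>x. indicator A x *\<^sub>R f x) \<in> borel_measurable borel \<and> (\<exists>C. \<forall>x\<in>A. norm (f x) \<le> C)"

lemma bounded_borel_cong: "(\<And>x. x \<in> A \<Longrightarrow> f x = g x) \<Longrightarrow> bounded_borel A f \<longleftrightarrow> bounded_borel A g"
proof -
  assume *: "\<And>x. x \<in> A \<Longrightarrow> f x = g x"
  then have "(\<lambda>x. indicator A x *\<^sub>R f x) = (\<lambda>x. indicator A x *\<^sub>R g x)"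
    by (intro ext) (simp split: split_indicator)
  with * show ?thesis unfolding bounded_borel_def by simp
qed

lemma bounded_borel_bilinear:
  assumes "bounded_bilinear h" "bounded_borel A f" "bounded_borel A g"
  shows "bounded_borel A (\<lambda>x. h (f x) (g x))"
proof -
  interpret bounded_bilinear h by fact
  obtain K where K: "K > 0" "\<And>a b. norm (h a b) \<le> norm a * norm b * K"
    using pos_bounded by blast
  obtain C D where CD: "\<And>x. x \<in> A \<Longrightarrow> norm (f x) \<le> C" "\<And>x. x \<in> A \<Longrightarrow> norm (g x) \<le> D"
    using assms unfolding bounded_borel_def by blast
  have "norm (h (f x) (g x)) \<le> C * D * K" if "x \<in> A" for x
  proof -
    have "norm (f x) * norm (g x) \<le> C * D"
      by (intro mult_mono CD that order_trans[OF norm_ge_zero CD(1)[OF that]]) simp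
    then show ?thesis
      using K(1) K(2)[of "f x" "g x"] by (meson less_eq_real_def mult_right_mono order_trans)
  qed
  moreover have "(\<lambda>x. indicator A x *\<^sub>R h (f x) (g x)) =
      (\<lambda>x. h (indicator A x *\<^sub>R f x) (indicator A x *\<^sub>R g x))"
    by (auto simp: indicator_def zero_left)
  moreover have "(\<lambda>x. h (indicator A x *\<^sub>R f x) (indicator A x *\<^sub>R g x)) \<in> borel_measurable borel"
    using assms(2,3) unfolding bounded_borel_def
    by (intro borel_measurable_continuous_on[where f="\<lambda>p. h (fst p) (snd p)" and
          g="\<lambda>x. (indicator A x *\<^sub>R f x, indicator A x *\<^sub>R g x)", simplified])
      (auto intro!: continuous_intros bounded_bilinear.continuous_on[OF assms(1)] borel_measurable_Pair)
  ultimately show ?thesis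
    unfolding bounded_borel_def by auto
qed

lemmas bounded_borel_mult = bounded_borel_bilinear[OF bounded_bilinear_mult]
lemmas bounded_borel_scaleR = bounded_borel_bilinear[OF bounded_bilinear_scaleR]
lemmas bounded_borel_inner = bounded_borel_bilinear[OF bounded_bilinear_inner]

lemma bounded_borel_add:
  assumes "bounded_borel A f" "bounded_borel A g"
  shows "bounded_borel A (\<lambda>x. f x + g x)"
proof -
  obtain C D where CD: "\<And>x. x \<in> A \<Longrightarrow> norm (f x) \<le> C" "\<And>x. x \<in> A \<Longrightarrow> norm (g x) \<le> D"
    using assms unfolding bounded_borel_def by blast
  have "norm (f x + g x) \<le> C + D" if "x \<in> A" for x
    using CD[OF that] norm_triangle_ineq[of "f x" "g x"] by linarith
  moreover have "(\<lambda>x. indicator A x *\<^sub>R (f x + g x)) =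
      (\<lambda>x. indicator A x *\<^sub>R f x + indicator A x *\<^sub>R g x)"
    by (auto simp: scaleR_right_distrib)
  ultimately show ?thesis
    using assms unfolding bounded_borel_def by auto
qed

lemma bounded_borel_const: "A \<in> sets borel \<Longrightarrow> bounded_borel A (\<lambda>_. c)"
  unfolding bounded_borel_def by auto

lemma bounded_borel_sum: "A \<in> sets borel \<Longrightarrow> (\<And>i. i \<in> I \<Longrightarrow> bounded_borel A (f i)) \<Longrightarrow> bounded_borel A (\<lambda>x. \<Sum>i\<in>I. f i x)"
  by (induction I rule: infinite_finite_induct) (auto intro: bounded_borel_const bounded_borel_add)

lemma bounded_borel_continuous:
  assumes "compact A" "continuous_on A f" "B \<subseteq> A" "B \<in> sets borel"
  shows "bounded_borel B f"
proof -
  have "bounded (f ` A)"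
    by (intro compact_imp_bounded compact_continuous_image assms)
  then obtain C where "\<And>x. x \<in> A \<Longrightarrow> norm (f x) \<le> C"
    unfolding bounded_iff by blast
  moreover have "(\<lambda>x. indicator B x *\<^sub>R f x) \<in> borel_measurable borel"
    by (rule borel_measurable_continuous_on_indicator[OF assms(4) continuous_on_subset[OF assms(2,3)]])
  ultimately show ?thesis
    using assms(3) unfolding bounded_borel_def by blast
qed

lemma bounded_borel_measurable: "bounded_borel A f \<Longrightarrow> A \<in> sets borel \<Longrightarrow> f \<in> borel_measurable (lebesgue_on A)"
proof -
  assume "bounded_borel A f" "A \<in> sets borel"
  then have "(\<lambda>x. indicator A x *\<^sub>R f x) \<in> borel_measurable lebesgue"
    unfolding bounded_borel_def by (simp add: measurable_completion)
  then show ?thesis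
    using \<open>A \<in> sets borel\<close> by (subst borel_measurable_restrict_space_iff) auto
qed

lemma bounded_borel_integrable:
  assumes "bounded_borel A f" "A \<in> sets borel" "bounded A"
  shows "set_integrable lebesgue A f"
proof -
  have A: "A \<in> lmeasurable"
    using assms by (intro bounded_set_imp_lmeasurable) auto
  then interpret finite_measure "lebesgue_on A"
    by (rule finite_measure_lebesgue_on)
  obtain C where "\<And>x. x \<in> A \<Longrightarrow> norm (f x) \<le> C"
    using assms unfolding bounded_borel_def by blast
  then have "integrable (lebesgue_on A) f"
    by (intro integrable_const_bound[where B=C] bounded_borel_measurable[OF assms(1,2)])
      (auto simp: AE_restrict_space_iff)
  then show ?thesis
    using A by (simp add: set_integrable_restrict_space[where S=UNIV] set_integrable_def
        integrable_restrict_space)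
qed

lemma bounded_borel_L2_on:
  assumes "bounded_borel A f" "A \<in> sets borel" "bounded A"
  shows "L2_on A f"
proof -
  have "set_integrable lebesgue A (\<lambda>x. f x \<bullet> f x)"
    by (intro bounded_borel_integrable bounded_borel_inner assms)
  then show ?thesis
    using assms(2) unfolding L2_on_def power2_norm_eq_inner
    by (simp add: bounded_borel_measurable[OF assms(1,2)] set_integrable_def integrable_restrict_space)
qed

section \<open>C^1 bump functions and the absence of jumps\<close>

lemma pos_part_square_deriv:
  "((\<lambda>x::real. (max 0 x)\<^sup>2) has_real_derivative 2 * max 0 x) (at x)"
proof (cases x "0::real" rule: linorder_cases)
  case less
  show ?thesis
    by (rule DERIV_cong[OF has_field_derivative_transform_within_open[of "\<lambda>_. 0" 0 x "{..<0}"]])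
      (use less in auto)
next
  case greater
  show ?thesis
    by (rule DERIV_cong[OF has_field_derivative_transform_within_open[of "\<lambda>x. x\<^sup>2" "2 * x" x "{0<..}"]])
      (use greater in \<open>auto intro!: derivative_eq_intros\<close>)
next
  case equal
  have "((\<lambda>h. (max 0 h)\<^sup>2 / h) \<longlongrightarrow> 0) (at (0::real))"
  proof (rule Lim_null_comparison)
    show "\<forall>\<^sub>F h in at (0::real). norm ((max 0 h)\<^sup>2 / h) \<le> \<bar>h\<bar>"
      by (auto simp: eventually_at_filter power2_eq_square max_def)
  qed (auto intro!: tendsto_eq_intros)
  then show ?thesis
    using equal by (simp add: DERIV_def)
qed

text \<open>Squaring the positive part of a parabola removes its kinks at distance \<open>d\<close>
  from \<open>c\<close>, which is enough for a C^1 test function with support in [c - d, c + d] and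
  value 1 at \<open>c\<close>.\<close>

definition bump :: "real \<Rightarrow> real \<Rightarrow> real \<Rightarrow> real" where
  "bump c d t = (max 0 (1 - ((t - c) / d)\<^sup>2))\<^sup>2"

definition bump' :: "real \<Rightarrow> real \<Rightarrow> real \<Rightarrow> real" where
  "bump' c d t = 2 * max 0 (1 - ((t - c) / d)\<^sup>2) * (- 2 * ((t - c) / d) / d)"

lemma bump_deriv:
  assumes "d > 0"
  shows "(bump c d has_real_derivative bump' c d t) (at t)"
proof -
  have "((\<lambda>t. 1 - ((t - c) / d)\<^sup>2) has_real_derivative (- 2 * ((t - c) / d) / d)) (at t)"
    using assms by (auto intro!: derivative_eq_intros simp: power2_eq_square field_simps)
  from DERIV_chain2[OF pos_part_square_deriv this]
  show ?thesis unfolding bump_def[abs_def] bump'_def .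
qed

lemma bump_support:
  assumes "d > 0" "\<bar>t - c\<bar> \<ge> d"
  shows "bump c d t = 0" "bump' c d t = 0"
proof -
  have "1 \<le> (\<bar>t - c\<bar> / d)\<^sup>2"
    using assms by (intro one_le_power) auto
  then have "max 0 (1 - ((t - c) / d)\<^sup>2) = 0"
    by (simp add: power_divide)
  then show "bump c d t = 0" "bump' c d t = 0"
    by (simp_all only: bump_def bump'_def) auto
qed

lemma bump_bounds: "0 \<le> bump c d t" "bump c d t \<le> 1"
  unfolding bump_def by (auto intro!: power_le_one)

lemma bump_cont: "d > 0 \<Longrightarrow> continuous_on A (bump c d)" "d > 0 \<Longrightarrow> continuous_on A (bump' c d)"
  unfolding bump_def[abs_def] bump'_def[abs_def] by (auto intro!: continuous_intros)

lemma bump_C1_test: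
  assumes "d > 0" "a < c - d" "c + d < b"
  shows "C1_test a b (bump c d)"
proof -
  have "deriv (bump c d) = bump' c d"
    using bump_deriv[OF assms(1)] by (auto intro!: DERIV_imp_deriv)
  moreover have "bump c d t = 0" if "t \<notin> {c - d..c + d}" for t
    using that by (intro bump_support assms(1)) auto
  ultimately show ?thesis
    unfolding C1_test_def real_differentiable_def
    using bump_deriv[OF assms(1)] bump_cont[OF assms(1)] assms
    by (intro conjI allI exI[of _ "c - d"] exI[of _ "c + d"] exI[of _ "bump' c d _"]) auto
qed

lemma lebesgue_set_integral_eq:
  fixes f :: "real \<Rightarrow> real"
  assumes "set_integrable lebesgue {a<..b} f"
  shows "(LINT t:{a<..b}|lebesgue. f t) = integral {a..b} f" "f integrable_on {a..b}"
proof -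
  have n: "negligible {x \<in> {a<..b} - {a..b}. f x \<noteq> 0}" "negligible {x \<in> {a..b} - {a<..b}. f x \<noteq> 0}"
    by (auto intro: negligible_subset[of "{a}"])
  show "(LINT t:{a<..b}|lebesgue. f t) = integral {a..b} f"
    using set_lebesgue_integral_eq_integral(2)[OF assms] integral_spike_set[OF n] by simp
  show "f integrable_on {a..b}"
    using set_lebesgue_integral_eq_integral(1)[OF assms] integrable_spike_set[OF _ n] by blast
qed

text \<open>Bumps of height one at \<open>c\<close> with shrinking support isolate the jump: all other terms of the
  weak derivative identity tend to zero.\<close>

lemma H1_no_jump:
  fixes p q :: "real poly"
  assumes H1: "H1_on a b u" and u: "bounded_borel {a<..b} u"
    and h: "h > 0" "a \<le> c - h" "c + h \<le> b"
    and p: "\<And>t. t \<in> {c - h<..c} \<Longrightarrow> u t = poly p t"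
    and q: "\<And>t. t \<in> {c<..c + h} \<Longrightarrow> u t = poly q t"
  shows "poly p c = poly q c"
proof -
  obtain g where g: "L2_on {a<..b} g"
    "\<And>\<phi>. C1_test a b \<phi> \<Longrightarrow> (LINT t:{a<..b}|lebesgue. u t * deriv \<phi> t)
             = - (LINT t:{a<..b}|lebesgue. g t * \<phi> t)"
    using H1 unfolding H1_on_def by blast
  \<comment> \<open>The classical derivative of the two pieces, continued over the whole interval.
    It need not match \<open>u\<close> far from \<open>c\<close>, but there the bump
    vanishes.\<close>
  define W where "W t = (if t \<le> c then poly (pderiv p) t else poly (pderiv q) t)" for t
  \<comment> \<open>The summand 2 keeps the support strictly inside (c - h, c + h), hence compactly
    inside (a, b), already for \<open>n = 0\<close>.\<close>
  define d where "d n = h / (2 + real n)" for n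
  have d: "d n > 0" "d n < h" for n
    using h by (auto simp: d_def field_simps add_pos_nonneg)
  define I where "I = {a<..b}"
  have I: "I \<in> sets borel" "bounded I" "I \<subseteq> {a..b}"
    by (auto simp: I_def)
  have "bounded_borel I (\<lambda>t. poly (pderiv p) t)" "bounded_borel I (\<lambda>t. poly (pderiv q) t)"
    by (intro bounded_borel_continuous[of "{a..b}"] continuous_intros I compact_Icc)+
  moreover have "bounded_borel I (\<lambda>t. indicator {..c} t :: real)" "bounded_borel I (\<lambda>t. indicator {c<..} t :: real)"
    using I unfolding bounded_borel_def by (auto intro!: exI[of _ 1] simp: indicator_def)
  ultimately have "bounded_borel I (\<lambda>t. indicator {..c} t * poly (pderiv p) t + indicator {c<..} t * poly (pderiv q) t)"
    by (intro bounded_borel_add bounded_borel_mult)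
  also have "(\<lambda>t. indicator {..c} t * poly (pderiv p) t + indicator {c<..} t * poly (pderiv q) t) = W"
    by (auto simp: W_def indicator_def)
  finally have W: "bounded_borel I W" .
  have bb: "bounded_borel I (bump c (d n))" "bounded_borel I (bump' c (d n))" for n
    by (intro bounded_borel_continuous[of "{a..b}"] bump_cont I compact_Icc d)+
  have gm: "g \<in> borel_measurable (lebesgue_on I)" and g2: "integrable (lebesgue_on I) (\<lambda>t. (g t)\<^sup>2)"
    using g(1) unfolding L2_on_def I_def by auto
  have Il: "I \<in> lmeasurable"
    using I by (intro bounded_set_imp_lmeasurable) auto
  interpret finite_measure "lebesgue_on I"
    using Il by (rule finite_measure_lebesgue_on)
  \<comment> \<open>On a finite measure space L2 is contained in L1, through |x| \<le> x^2 +
    1.\<close>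
  have g1: "integrable (lebesgue_on I) g"
  proof (rule Bochner_Integration.integrable_bound[OF Bochner_Integration.integrable_add[OF g2, of "\<lambda>_. 1"] gm])
    have "\<bar>x\<bar> \<le> x\<^sup>2 + 1" for x :: real
    proof -
      have "0 \<le> (\<bar>x\<bar> - 1)\<^sup>2 + \<bar>x\<bar>" by simp
      then show ?thesis by (simp add: power2_eq_square algebra_simps)
    qed
    then show "AE x in lebesgue_on I. norm (g x) \<le> norm ((g x)\<^sup>2 + 1)"
      by (auto intro: order_trans[OF _ abs_ge_self])
  qed simp
  \<comment> \<open>Integrating the derivative of piece times bump over each side of
    \<open>c\<close> leaves only the value at \<open>c\<close>, where the bump is 1:
    \<open>poly p c\<close> from the left and \<open>- poly q c\<close> from the right. The weak
    identity then trades the integral of \<open>u\<close> against the derivative of the bump for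
    minus that of \<open>g\<close> against the bump.\<close>
  have key: "(LINT t|lebesgue_on I. (W t - g t) * bump c (d n) t) = poly p c - poly q c" for n
  proof -
    let ?\<phi> = "bump c (d n)" and ?\<phi>' = "bump' c (d n)"
    have D: "((\<lambda>t. poly r t * ?\<phi> t) has_real_derivative poly r t * ?\<phi>' t + poly (pderiv r) t * ?\<phi> t)
        (at t within A)" for r t A
      by (rule DERIV_cong[OF DERIV_mult[OF poly_DERIV bump_deriv[OF d(1)], THEN DERIV_subset]]) auto
    have 1: "((\<lambda>t. poly r t * ?\<phi>' t + poly (pderiv r) t * ?\<phi> t) has_integral
        poly r y * ?\<phi> y - poly r x * ?\<phi> x) {x..y}" if "x \<le> y" for r x y
      using that D by (intro fundamental_theorem_of_calculus)
        (auto simp: has_real_derivative_iff_has_vector_derivative[symmetric])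
    have ends: "?\<phi> a = 0" "?\<phi> b = 0" "?\<phi> c = 1"
    proof -
      show "?\<phi> a = 0" "?\<phi> b = 0"
        using h d[of n] by (intro bump_support d(1); linarith)+
    qed (simp add: bump_def)
    have ac: "a \<le> c" "c \<le> b" using h by auto
    have "((\<lambda>t. u t * ?\<phi>' t + W t * ?\<phi> t) has_integral poly p c) {a..c}"
    proof (rule has_integral_eq)
      show "((\<lambda>t. poly p t * ?\<phi>' t + poly (pderiv p) t * ?\<phi> t) has_integral poly p c) {a..c}"
        using 1[OF ac(1), of p] ends by simp
      show "poly p t * ?\<phi>' t + poly (pderiv p) t * ?\<phi> t = u t * ?\<phi>' t + W t * ?\<phi> t"
        if "t \<in> {a..c}" for t
      proof (cases "t \<le> c - h")
        case True
        then have "\<bar>t - c\<bar> \<ge> d n" using d[of n] by auto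
        then show ?thesis using bump_support[OF d(1)] by simp
      qed (use that p in \<open>auto simp: W_def\<close>)
    qed
    \<comment> \<open>The value of \<open>u\<close> at \<open>c\<close> belongs to the left piece,
      so the right half disregards this one point.\<close>
    moreover have "((\<lambda>t. u t * ?\<phi>' t + W t * ?\<phi> t) has_integral - poly q c) {c..b}"
    proof (rule has_integral_spike_finite[of "{c}"])
      show "((\<lambda>t. poly q t * ?\<phi>' t + poly (pderiv q) t * ?\<phi> t) has_integral - poly q c) {c..b}"
        using 1[OF ac(2), of q] ends by simp
      show "u t * ?\<phi>' t + W t * ?\<phi> t = poly q t * ?\<phi>' t + poly (pderiv q) t * ?\<phi> t"
        if "t \<in> {c..b} - {c}" for t
      proof (cases "t \<ge> c + h")
        case True
        then have "\<bar>t - c\<bar> \<ge> d n" using d[of n] by auto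
        then show ?thesis using bump_support[OF d(1)] by simp
      qed (use that q in \<open>auto simp: W_def\<close>)
    qed simp
    ultimately have hi: "((\<lambda>t. u t * ?\<phi>' t + W t * ?\<phi> t) has_integral (poly p c - poly q c)) {a..b}"
      using has_integral_combine[OF ac] by fastforce
    have i1: "set_integrable lebesgue I (\<lambda>t. u t * ?\<phi>' t)"
      and i2: "set_integrable lebesgue I (\<lambda>t. W t * ?\<phi> t)"
      using u by (auto intro!: bounded_borel_integrable bounded_borel_mult bb W I simp: I_def[symmetric])
    have gi: "set_integrable lebesgue I (\<lambda>t. g t * ?\<phi> t)"
    proof -
      have "integrable (lebesgue_on I) (\<lambda>t. g t * ?\<phi> t)"
        by (rule Bochner_Integration.integrable_bound[OF g1])
          (use gm bounded_borel_measurable[OF bb(1) I(1)] bump_bounds in \<open>auto simp: abs_mult intro!: mult_left_le\<close>)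
      then show ?thesis
        using I(1) by (simp add: set_integrable_def integrable_restrict_space)
    qed
    have de: "deriv ?\<phi> = ?\<phi>'"
      using bump_deriv[OF d(1)] by (auto intro!: DERIV_imp_deriv)
    have "poly p c - poly q c = (LINT t:I|lebesgue. u t * ?\<phi>' t + W t * ?\<phi> t)"
      using lebesgue_set_integral_eq(1)[of a b "\<lambda>t. u t * ?\<phi>' t + W t * ?\<phi> t"] integral_unique[OF hi]
        set_integral_add(1)[OF i1 i2] by (simp add: I_def)
    also have "\<dots> = (LINT t:I|lebesgue. u t * ?\<phi>' t) + (LINT t:I|lebesgue. W t * ?\<phi> t)"
      by (rule set_integral_add(2)[OF i1 i2])
    also have "(LINT t:I|lebesgue. u t * ?\<phi>' t) = - (LINT t:I|lebesgue. g t * ?\<phi> t)"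
      using g(2)[OF bump_C1_test[OF d(1)[of n], of a c b]] h d[of n] by (simp add: de I_def)
    also have "- (LINT t:I|lebesgue. g t * ?\<phi> t) + (LINT t:I|lebesgue. W t * ?\<phi> t)
        = (LINT t:I|lebesgue. (W t - g t) * ?\<phi> t)"
      using set_integral_diff(2)[OF i2 gi] by (simp add: left_diff_distrib)
    also have "\<dots> = (LINT t|lebesgue_on I. (W t - g t) * ?\<phi> t)"
      using I(1) by (simp add: set_lebesgue_integral_def integral_restrict_space)
    finally show ?thesis by simp
  qed
  have Wi: "integrable (lebesgue_on I) (\<lambda>t. W t - g t)"
    using bounded_borel_integrable[OF W I(1,2)] I(1) g1
    by (intro Bochner_Integration.integrable_diff) (auto simp: set_integrable_def integrable_restrict_space)
  have "(\<lambda>n. LINT t|lebesgue_on I. (W t - g t) * bump c (d n) t) \<longlonglongrightarrow> (LINT t|lebesgue_on I. 0)"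
  proof (rule integral_dominated_convergence[where w="\<lambda>t. norm (W t - g t)"])
    have "AE t in lebesgue. t \<noteq> c"
      by (auto simp: completion.AE_iff_null_sets intro!: AE_I[where N="{c}"])
    then have "AE t in lebesgue_on I. t \<noteq> c"
      using I(1) by (auto simp: AE_restrict_space_iff)
    then show "AE t in lebesgue_on I. (\<lambda>n. (W t - g t) * bump c (d n) t) \<longlonglongrightarrow> 0"
    proof (rule AE_mp, intro AE_I2 impI)
      fix t assume "t \<noteq> c"
      have "d \<longlonglongrightarrow> 0"
        unfolding d_def by real_asymp
      then have "\<forall>\<^sub>F n in sequentially. d n < \<bar>t - c\<bar>"
        using \<open>t \<noteq> c\<close> by (intro order_tendstoD(2)) auto
      then have "\<forall>\<^sub>F n in sequentially. (W t - g t) * bump c (d n) t = 0"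
        by eventually_elim (use bump_support(1)[OF d(1)] in auto)
      then show "(\<lambda>n. (W t - g t) * bump c (d n) t) \<longlonglongrightarrow> 0"
        by (rule tendsto_eventually)
    qed
  qed (use Wi bounded_borel_measurable[OF bb(1) I(1)] bump_bounds borel_measurable_integrable[OF Wi] in
      \<open>auto simp: abs_mult intro!: AE_I2 mult_left_le\<close>)
  then have "(\<lambda>n. poly p c - poly q c) \<longlonglongrightarrow> 0"
    unfolding key by simp
  then show ?thesis
    by (simp add: LIMSEQ_const_iff)
qed

section \<open>Piecewise polynomials in time\<close>

lemma bounded_borel_indicator: "A \<in> sets borel \<Longrightarrow> B \<in> sets borel \<Longrightarrow> bounded_borel A (indicator B :: _ \<Rightarrow> real)"
  unfolding bounded_borel_def by (auto intro!: exI[of _ 1] simp: indicator_def)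

lemma Ioc_partition:
  fixes tp :: "nat \<Rightarrow> real"
  assumes "\<And>k. k < N \<Longrightarrow> tp k < tp (Suc k)"
  shows "(\<Union>k<N. {tp k<..tp (Suc k)}) = {tp 0<..tp N}" "tp 0 \<le> tp N"
  using assms
proof (induction N)
  case (Suc N)
  {
    case 1
    with Suc have "(\<Union>k<N. {tp k<..tp (Suc k)}) = {tp 0<..tp N}" "tp 0 \<le> tp N" "tp N < tp (Suc N)"
      by auto
    then show ?case
      by (auto simp: lessThan_Suc)
  next
    case 2
    with Suc have "tp 0 \<le> tp N" "tp N < tp (Suc N)"
      by auto
    then show ?case by simp
  }
qed auto

lemma Ioc_partition_disjoint:
  fixes tp :: "nat \<Rightarrow> real"
  assumes "\<And>k. k < N \<Longrightarrow> tp k < tp (Suc k)"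
  shows "disjoint_family_on (\<lambda>k. {tp k<..tp (Suc k)}) {..<N}"
proof -
  have "tp (Suc i) \<le> tp j" if "i < j" "j < N" for i j
    using that
  proof (induction j)
    case (Suc j)
    then show ?case
      using assms[of j] by (cases "i = j") auto
  qed simp
  then have "{tp i<..tp (Suc i)} \<inter> {tp j<..tp (Suc j)} = {}" if "i < j" "j < N" for i j
    using that by fastforce
  then show ?thesis
    unfolding disjoint_family_on_def by (metis Int_commute lessThan_iff linorder_neqE_nat)
qed

section \<open>Orthogonal projection of polynomials on one interval\<close>

lemma poly_integral_square_pos:
  fixes p :: "real poly"
  assumes "c < d" "p \<noteq> 0"
  shows "0 < integral {c..d} (\<lambda>t. poly p t * poly p t)"
proof -
  have "integral {c..d} (\<lambda>t. poly p t * poly p t) \<noteq> 0"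
  proof
    assume "integral {c..d} (\<lambda>t. poly p t * poly p t) = 0"
    then have "\<forall>t\<in>{c..d}. poly p t * poly p t = 0"
      using assms by (subst (asm) integral_eq_0_iff) (auto intro!: continuous_intros)
    then have "{c..d} \<subseteq> {t. poly p t = 0}"
      by auto
    then show False
      using poly_roots_finite[OF assms(2)] infinite_Icc[OF assms(1)] finite_subset by blast
  qed
  moreover have "0 \<le> integral {c..d} (\<lambda>t. poly p t * poly p t)"
    by (intro integral_nonneg integrable_continuous_real continuous_intros) simp
  ultimately show ?thesis by simp
qed

text \<open>Gram-Schmidt by induction on the dimension \<open>n\<close>: the monomial of degree
  \<open>n\<close> is made orthogonal to the lower degrees, and the component of the residual of
  \<open>q\<close> along the resulting \<open>L\<close> is added to the previous projection. Degree
  bounds are stated through vanishing coefficients so that \<open>n = 0\<close> gives the zero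
  space.\<close>

lemma poly_projection_aux:
  fixes q :: "real poly"
  assumes "c < d"
  shows "\<exists>r. (\<forall>i\<ge>n. coeff r i = 0) \<and>
    (\<forall>\<tau>. (\<forall>i\<ge>n. coeff \<tau> i = 0) \<longrightarrow> integral {c..d} (\<lambda>t. poly (q - r) t * poly \<tau> t) = 0)"
proof (induction n arbitrary: q)
  case 0
  have "integral {c..d} (\<lambda>t. poly (q - 0) t * poly \<tau> t) = 0" if "\<forall>i\<ge>0. coeff \<tau> i = 0" for \<tau>
  proof -
    have "\<tau> = 0"
      using that by (simp add: poly_eq_iff)
    then show ?thesis by simp
  qed
  then show ?case
    by (intro exI[of _ 0]) auto
next
  case (Suc n)
  have int: "(\<lambda>t. poly p t * poly p' t) integrable_on {c..d}" for p p' :: "real poly"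
    by (intro integrable_continuous_real continuous_intros)
  define ip where "ip p p' = integral {c..d} (\<lambda>t. poly p t * poly p' t)" for p p' :: "real poly"
  have ip_add: "ip (p + p'') p' = ip p p' + ip p'' p'" "ip p' (p + p'') = ip p' p + ip p' p''" for p p' p''
    unfolding ip_def using integral_add[OF int int] by (simp_all add: algebra_simps)
  have ip_smult: "ip (smult x p) p' = x * ip p p'" "ip p' (smult x p) = x * ip p' p" for p p' x
    unfolding ip_def by (simp_all add: algebra_simps flip: integral_mult_right)
  obtain r1 where r1: "\<forall>i\<ge>n. coeff r1 i = 0"
    "\<And>\<tau>. (\<forall>i\<ge>n. coeff \<tau> i = 0) \<Longrightarrow> ip (monom 1 n - r1) \<tau> = 0"
    using Suc.IH[of "monom 1 n"] unfolding ip_def by blast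
  obtain r0 where r0: "\<forall>i\<ge>n. coeff r0 i = 0"
    "\<And>\<tau>. (\<forall>i\<ge>n. coeff \<tau> i = 0) \<Longrightarrow> ip (q - r0) \<tau> = 0"
    using Suc.IH[of q] unfolding ip_def by blast
  define L where "L = monom 1 n - r1"
  have Ln: "coeff L n = 1" "\<forall>i\<ge>Suc n. coeff L i = 0"
    using r1(1) by (auto simp: L_def)
  then have "ip L L > 0"
    unfolding ip_def by (intro poly_integral_square_pos assms) auto
  define r where "r = r0 + smult (ip (q - r0) L / ip L L) L"
  have qr: "q - r = (q - r0) + smult (- (ip (q - r0) L / ip L L)) L"
    by (simp add: r_def)
  have "ip (q - r) \<tau> = 0" if \<tau>: "\<forall>i\<ge>Suc n. coeff \<tau> i = 0" for \<tau>
  proof -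
    \<comment> \<open>Since \<open>L\<close> is monic of degree \<open>n\<close>, subtracting a
      multiple of it lowers the degree of the test polynomial, to which the induction hypothesis
      applies.\<close>
    define \<tau>' where "\<tau>' = \<tau> - smult (coeff \<tau> n) L"
    have \<tau>': "\<forall>i\<ge>n. coeff \<tau>' i = 0"
    proof (intro allI impI)
      fix i assume "i \<ge> n"
      then show "coeff \<tau>' i = 0"
        using \<tau> Ln by (cases "i = n") (auto simp: \<tau>'_def)
    qed
    have "\<tau> = \<tau>' + smult (coeff \<tau> n) L"
      by (simp add: \<tau>'_def)
    then have "ip (q - r) \<tau> = ip (q - r) \<tau>' + coeff \<tau> n * ip (q - r) L"
      by (metis ip_add(2) ip_smult(2))
    moreover have "ip (q - r) \<tau>' = 0"
      using r0(2)[OF \<tau>'] r1(2)[OF \<tau>'] unfolding qr ip_add ip_smult by (simp add: L_def)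
    moreover have "ip (q - r) L = 0"
      using \<open>ip L L > 0\<close> unfolding qr ip_add ip_smult by simp
    ultimately show ?thesis by simp
  qed
  moreover have "\<forall>i\<ge>Suc n. coeff r i = 0"
    using r0(1) Ln(2) by (auto simp: r_def)
  ultimately show ?case
    unfolding ip_def by blast
qed

lemma poly_projection:
  fixes q :: "real poly"
  assumes "c < d"
  obtains r where "degree r \<le> n"
    "\<And>\<tau>. degree \<tau> \<le> n \<Longrightarrow> integral {c..d} (\<lambda>t. poly q t * poly \<tau> t) = integral {c..d} (\<lambda>t. poly r t * poly \<tau> t)"
proof -
  obtain r where r: "\<forall>i\<ge>Suc n. coeff r i = 0"
    "\<And>\<tau>. (\<forall>i\<ge>Suc n. coeff \<tau> i = 0) \<Longrightarrow> integral {c..d} (\<lambda>t. poly (q - r) t * poly \<tau> t) = 0"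
    using poly_projection_aux[OF assms, of "Suc n" q] by blast
  have int: "(\<lambda>t. poly p t * poly p' t) integrable_on {c..d}" for p p' :: "real poly"
    by (intro integrable_continuous_real continuous_intros)
  show thesis
  proof
    show "degree r \<le> n"
      using r(1) by (intro degree_le) auto
    fix \<tau> :: "real poly" assume "degree \<tau> \<le> n"
    then have "integral {c..d} (\<lambda>t. poly (q - r) t * poly \<tau> t) = 0"
      by (intro r(2)) (auto intro: coeff_eq_0)
    then show "integral {c..d} (\<lambda>t. poly q t * poly \<tau> t) = integral {c..d} (\<lambda>t. poly r t * poly \<tau> t)"
      using integral_diff[OF int int, of q \<tau> r \<tau>] by (simp add: left_diff_distrib)
  qed
qed

section \<open>Piecewise polynomials on the time partition of an element\<close>

locale slab_mesh =
  fixes M :: slab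
  assumes hex: "hex_slab M"
begin

abbreviation "I \<equiv> slab_int M"

lemma I_props: "I \<in> sets borel" "bounded I" "I = {tstart M<..tend M}"
  by (auto simp: slab_int_def)

lemma t_less: "tstart M < tend M"
  using hex by (simp add: hex_slab_def)

lemma tpt:
  assumes "K < nelem M"
  shows "tpt M K 0 = tstart M" "tpt M K (nsub M K) = tend M"
    "k < nsub M K \<Longrightarrow> tpt M K k < tpt M K (Suc k)" "k < nsub M K \<Longrightarrow> 1 \<le> ptdeg M K k"
  using hex assms by (auto simp: hex_slab_def)

lemma sub_int_partition:
  assumes "K < nelem M"
  shows "(\<Union>k<nsub M K. sub_int M K k) = I" "disjoint_family_on (sub_int M K) {..<nsub M K}"
  using Ioc_partition(1)[of "nsub M K" "tpt M K"] Ioc_partition_disjoint[of "nsub M K" "tpt M K"]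
    tpt[OF assms] unfolding sub_int_def I_props by auto

text \<open>The half-open subintervals are disjoint, so at most one summand is alive, and a
  breakpoint takes the value of the piece on its left. Writing it with indicators makes the Borel
  property immediate.\<close>

definition glue :: "nat \<Rightarrow> (nat \<Rightarrow> real poly) \<Rightarrow> real \<Rightarrow> real" where
  "glue K \<rho> t = (\<Sum>k<nsub M K. indicator (sub_int M K k) t * poly (\<rho> k) t)"

lemma glue_eq:
  assumes "K < nelem M" "k < nsub M K" "t \<in> sub_int M K k"
  shows "glue K \<rho> t = poly (\<rho> k) t"
proof -
  have "indicator (sub_int M K i) t * poly (\<rho> i) t = (if i = k then poly (\<rho> k) t else 0)"
    if "i < nsub M K" for i
    using sub_int_partition(2)[OF assms(1)] that assms(2,3)
    by (auto simp: disjoint_family_on_def indicator_def)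
  then have "glue K \<rho> t = (\<Sum>i<nsub M K. if i = k then poly (\<rho> k) t else 0)"
    unfolding glue_def by (intro sum.cong) auto
  then show ?thesis
    using assms(2) by simp
qed

lemma glue_bounded_borel: "bounded_borel I (glue K \<rho>)"
  unfolding glue_def[abs_def]
  by (intro bounded_borel_sum bounded_borel_mult bounded_borel_indicator I_props bounded_borel_continuous[of "{tstart M..tend M}"])
    (auto intro!: continuous_intros simp: sub_int_def slab_int_def)

lemma piecewise_bounded_borel:
  assumes "K < nelem M" "\<And>k. k < nsub M K \<Longrightarrow> u \<in> P_space (d k) (sub_int M K k)"
  shows "bounded_borel I u"
proof -
  obtain \<rho> where \<rho>: "\<And>k t. k < nsub M K \<Longrightarrow> t \<in> sub_int M K k \<Longrightarrow> u t = poly (\<rho> k) t"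
    using assms(2) unfolding P_space_def by simp metis
  have "u t = glue K \<rho> t" if "t \<in> I" for t
    using that \<rho> glue_eq[OF assms(1)] unfolding sub_int_partition(1)[OF assms(1), symmetric] by auto
  then show ?thesis
    using bounded_borel_cong[of I u "glue K \<rho>"] glue_bounded_borel by blast
qed

lemma S_bounded_borel: "K < nelem M \<Longrightarrow> u \<in> S_space M K \<Longrightarrow> bounded_borel I u"
  by (rule piecewise_bounded_borel[of K]) (auto simp: S_space_def)

lemma T_bounded_borel: "K < nelem M \<Longrightarrow> u \<in> T_space M K \<Longrightarrow> bounded_borel I u"
  by (rule piecewise_bounded_borel[of K]) (auto simp: T_space_def)

lemma glue_T:
  assumes "K < nelem M" "\<And>k. k < nsub M K \<Longrightarrow> degree (\<rho> k) \<le> ptdeg M K k - 1"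
  shows "glue K \<rho> \<in> T_space M K"
  using assms bounded_borel_L2_on[OF glue_bounded_borel I_props(1,2)] glue_eq[OF assms(1)]
  unfolding T_space_def P_space_def by blast

lemma piecewise_poly_integral:
  assumes K: "K < nelem M"
    and u: "\<And>k t. k < nsub M K \<Longrightarrow> t \<in> sub_int M K k \<Longrightarrow> u t = poly (p k) t"
    and v: "\<And>k t. k < nsub M K \<Longrightarrow> t \<in> sub_int M K k \<Longrightarrow> v t = poly (q k) t"
  shows "(LINT t:I|lebesgue. u t * v t) =
    (\<Sum>k<nsub M K. integral {tpt M K k..tpt M K (Suc k)} (\<lambda>t. poly (p k) t * poly (q k) t))"
proof -
  have b: "bounded_borel I (\<lambda>t. u t * v t)"
    by (intro bounded_borel_mult piecewise_bounded_borel[OF K, of _ "\<lambda>k. degree (p k)"]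
        piecewise_bounded_borel[OF K, of _ "\<lambda>k. degree (q k)"]) (use u v in \<open>auto simp: P_space_def\<close>)
  have i: "set_integrable lebesgue (sub_int M K k) (\<lambda>t. u t * v t)" if "k < nsub M K" for k
    by (rule set_integrable_subset[OF bounded_borel_integrable[OF b I_props(1,2)]])
      (use that sub_int_partition(1)[OF K] in \<open>auto simp: sub_int_def\<close>)
  have sets: "sub_int M K k \<in> sets lebesgue" for k
    by (simp add: sub_int_def)
  have "(LINT t:I|lebesgue. u t * v t) = (\<Sum>k<nsub M K. LINT t:sub_int M K k|lebesgue. u t * v t)"
    unfolding sub_int_partition(1)[OF K, symmetric]
    by (rule set_integral_finite_Union) (use i sub_int_partition(2)[OF K] sets in auto)
  also have "\<dots> = (\<Sum>k<nsub M K. integral {tpt M K k..tpt M K (Suc k)} (\<lambda>t. poly (p k) t * poly (q k) t))"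
  proof (rule sum.cong[OF refl])
    fix k assume "k \<in> {..<nsub M K}"
    then have k: "k < nsub M K" by simp
    have "(LINT t:sub_int M K k|lebesgue. u t * v t) =
        integral {tpt M K k..tpt M K (Suc k)} (\<lambda>t. u t * v t)"
      using i[OF k] unfolding sub_int_def by (rule lebesgue_set_integral_eq)
    also have "\<dots> = integral {tpt M K k..tpt M K (Suc k)} (\<lambda>t. poly (p k) t * poly (q k) t)"
      by (rule integral_spike[of "{tpt M K k}"]) (use u[OF k] v[OF k] in \<open>auto simp: sub_int_def\<close>)
    finally show "(LINT t:sub_int M K k|lebesgue. u t * v t) =
        integral {tpt M K k..tpt M K (Suc k)} (\<lambda>t. poly (p k) t * poly (q k) t)" .
  qed
  finally show ?thesis .
qed

text \<open>The test space imposes no matching at breakpoints, so the projection decouples into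
  polynomial projections on the subintervals.\<close>

lemma time_projection:
  assumes K: "K < nelem M" and s: "s \<in> S_space M K"
  shows "\<exists>r\<in>T_space M K. \<forall>\<tau>\<in>T_space M K.
    (LINT t:I|lebesgue. s t * \<tau> t) = (LINT t:I|lebesgue. r t * \<tau> t)"
proof -
  obtain q where q: "\<And>k t. k < nsub M K \<Longrightarrow> t \<in> sub_int M K k \<Longrightarrow> s t = poly (q k) t"
    using s unfolding S_space_def P_space_def by simp metis
  have "\<forall>k. \<exists>r. k < nsub M K \<longrightarrow> degree r \<le> ptdeg M K k - 1 \<and>
    (\<forall>\<tau>. degree \<tau> \<le> ptdeg M K k - 1 \<longrightarrow>
      integral {tpt M K k..tpt M K (Suc k)} (\<lambda>t. poly (q k) t * poly \<tau> t) =
      integral {tpt M K k..tpt M K (Suc k)} (\<lambda>t. poly r t * poly \<tau> t))"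
  proof
    fix k
    show "\<exists>r. k < nsub M K \<longrightarrow> degree r \<le> ptdeg M K k - 1 \<and>
      (\<forall>\<tau>. degree \<tau> \<le> ptdeg M K k - 1 \<longrightarrow>
        integral {tpt M K k..tpt M K (Suc k)} (\<lambda>t. poly (q k) t * poly \<tau> t) =
        integral {tpt M K k..tpt M K (Suc k)} (\<lambda>t. poly r t * poly \<tau> t))"
    proof (cases "k < nsub M K")
      case True
      from tpt(3)[OF K True] show ?thesis
        by (rule poly_projection[of _ _ "ptdeg M K k - 1" "q k"]) blast
    qed blast
  qed
  from choice[OF this] obtain r where r: "\<And>k. k < nsub M K \<Longrightarrow> degree (r k) \<le> ptdeg M K k - 1"
    "\<And>k \<tau>. k < nsub M K \<Longrightarrow> degree \<tau> \<le> ptdeg M K k - 1 \<Longrightarrow>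
      integral {tpt M K k..tpt M K (Suc k)} (\<lambda>t. poly (q k) t * poly \<tau> t) =
      integral {tpt M K k..tpt M K (Suc k)} (\<lambda>t. poly (r k) t * poly \<tau> t)"
    by blast
  show ?thesis
  proof (intro bexI ballI)
    show "glue K r \<in> T_space M K"
      by (rule glue_T[OF K r(1)])
    fix \<tau> assume "\<tau> \<in> T_space M K"
    then obtain p where p: "\<And>k. k < nsub M K \<Longrightarrow> degree (p k) \<le> ptdeg M K k - 1"
      "\<And>k t. k < nsub M K \<Longrightarrow> t \<in> sub_int M K k \<Longrightarrow> \<tau> t = poly (p k) t"
      unfolding T_space_def P_space_def by simp metis
    have "(LINT t:I|lebesgue. s t * \<tau> t) =
      (\<Sum>k<nsub M K. integral {tpt M K k..tpt M K (Suc k)} (\<lambda>t. poly (q k) t * poly (p k) t))"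
      by (rule piecewise_poly_integral[OF K]) (use q p in auto)
    also have "\<dots> = (\<Sum>k<nsub M K. integral {tpt M K k..tpt M K (Suc k)} (\<lambda>t. poly (r k) t * poly (p k) t))"
      using r(2) p(1) by (intro sum.cong) auto
    also have "\<dots> = (LINT t:I|lebesgue. glue K r t * \<tau> t)"
      by (rule piecewise_poly_integral[OF K, symmetric]) (use glue_eq[OF K] p in auto)
    finally show "(LINT t:I|lebesgue. s t * \<tau> t) = (LINT t:I|lebesgue. glue K r t * \<tau> t)" .
  qed
qed

text \<open>Absence of jumps glues the pieces continuously at the breakpoints, and only the value at
  \<open>tstart M\<close>, which lies outside the half-open slab, has to be redefined.
  Differentiating each piece lowers its degree by one, which is exactly the test degree.\<close>

lemma S_continuous_extension:
  assumes K: "K < nelem M" and s: "s \<in> S_space M K"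
  shows "\<exists>\<sigma> s' N. continuous_on {tstart M..tend M} \<sigma> \<and> (\<forall>t\<in>I. \<sigma> t = s t) \<and> s' \<in> T_space M K \<and>
    finite N \<and> (\<forall>t\<in>I - N. (s has_vector_derivative s' t) (at t))"
proof -
  let ?n = "nsub M K" and ?tp = "tpt M K"
  obtain q where q: "\<And>k. k < ?n \<Longrightarrow> degree (q k) \<le> ptdeg M K k"
      "\<And>k t. k < ?n \<Longrightarrow> t \<in> sub_int M K k \<Longrightarrow> s t = poly (q k) t"
    using s unfolding S_space_def P_space_def by simp metis
  have H1: "H1_on (tstart M) (tend M) s"
    using s by (simp add: S_space_def)
  have le: "tstart M \<le> ?tp j" if "j \<le> ?n" for j
    using Ioc_partition(2)[of j ?tp] tpt[OF K] that by auto
  have ge: "?tp j \<le> tend M" if "j \<le> ?n" for j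
    using Ioc_partition(2)[of "?n - j" "\<lambda>i. ?tp (i + j)"] tpt[OF K] that by auto
  have n0: "0 < ?n"
    using tpt(1,2)[OF K] t_less by (cases ?n) auto
  have jump: "poly (q k) (?tp (Suc k)) = poly (q (Suc k)) (?tp (Suc k))" if k: "Suc k < ?n" for k
  proof -
    \<comment> \<open>On a symmetric window of this radius around the breakpoint only the two
      adjacent pieces are seen.\<close>
    define h where "h = min (?tp (Suc k) - ?tp k) (?tp (Suc (Suc k)) - ?tp (Suc k))"
    show ?thesis
    proof (rule H1_no_jump[OF H1, where h=h])
      show "bounded_borel {tstart M<..tend M} s"
        using S_bounded_borel[OF K s] by (simp add: I_props)
      show "h > 0"
        using tpt(3)[OF K] k by (simp add: h_def)
      show "tstart M \<le> ?tp (Suc k) - h"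
        using le[of k] k by (simp add: h_def)
      show "?tp (Suc k) + h \<le> tend M"
        using ge[of "Suc (Suc k)"] k by (simp add: h_def)
    qed (use k q(2)[of k] q(2)[of "Suc k"] in \<open>auto simp: h_def sub_int_def\<close>)
  qed
  define \<sigma> where "\<sigma> t = (if t = tstart M then poly (q 0) t else s t)" for t
  \<comment> \<open>At the left end of a later piece the value of \<open>s\<close> is that of the
    preceding polynomial, so this is where \<open>jump\<close> enters; at the left end of the first
    piece the redefined value does.\<close>
  have \<sigma>: "\<sigma> t = poly (q k) t" if k: "k < ?n" and t: "t \<in> {?tp k..?tp (Suc k)}" for k t
  proof (cases "t = ?tp k")
    case True
    show ?thesis
    proof (cases k)
      case 0
      then show ?thesis using True tpt(1)[OF K] by (simp add: \<sigma>_def)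
    next
      case (Suc j)
      have j: "j < ?n" "?tp j < ?tp (Suc j)" "tstart M \<le> ?tp j"
        using k Suc tpt(3)[OF K, of j] le[of j] by auto
      then have "s t = poly (q j) t"
        using True Suc by (intro q(2)) (auto simp: sub_int_def)
      then show ?thesis
        using jump[of j] k True Suc j by (auto simp: \<sigma>_def)
    qed
  next
    case False
    then show ?thesis
      using q(2)[OF k, of t] t le[of k] k by (auto simp: \<sigma>_def sub_int_def)
  qed
  have cover: "{tstart M..tend M} = (\<Union>k<?n. {?tp k..?tp (Suc k)})"
  proof
    have "tstart M \<in> {?tp 0..?tp (Suc 0)}"
      using tpt(1)[OF K] tpt(3)[OF K n0] by simp
    moreover have "{tstart M<..tend M} \<subseteq> (\<Union>k<?n. {?tp k..?tp (Suc k)})"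
    proof -
      have "(\<Union>k<?n. sub_int M K k) \<subseteq> (\<Union>k<?n. {?tp k..?tp (Suc k)})"
        by (intro UN_mono) (auto simp: sub_int_def)
      then show ?thesis
        by (simp only: sub_int_partition(1)[OF K] I_props)
    qed
    moreover have "{tstart M..tend M} = insert (tstart M) {tstart M<..tend M}"
      using t_less by auto
    ultimately show "{tstart M..tend M} \<subseteq> (\<Union>k<?n. {?tp k..?tp (Suc k)})"
      using n0 by blast
    show "(\<Union>k<?n. {?tp k..?tp (Suc k)}) \<subseteq> {tstart M..tend M}"
    proof (intro UN_least)
      fix k assume "k \<in> {..<?n}"
      then have "tstart M \<le> ?tp k" "?tp (Suc k) \<le> tend M"
        by (auto intro!: le ge)
      then show "{?tp k..?tp (Suc k)} \<subseteq> {tstart M..tend M}"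
        by auto
    qed
  qed
  have "continuous_on (\<Union>k<?n. {?tp k..?tp (Suc k)}) \<sigma>"
  proof (rule continuous_on_closed_Union)
    fix k assume "k \<in> {..<?n}"
    then have "continuous_on {?tp k..?tp (Suc k)} \<sigma> \<longleftrightarrow> continuous_on {?tp k..?tp (Suc k)} (poly (q k))"
      by (intro continuous_on_cong) (auto simp: \<sigma>)
    then show "continuous_on {?tp k..?tp (Suc k)} \<sigma>"
      by (simp add: continuous_intros)
  qed auto
  then have "continuous_on {tstart M..tend M} \<sigma>"
    by (simp only: cover)
  moreover have "\<forall>t\<in>I. \<sigma> t = s t"
    by (auto simp: \<sigma>_def I_props)
  moreover have "glue K (\<lambda>k. pderiv (q k)) \<in> T_space M K"
    by (rule glue_T[OF K]) (simp add: degree_pderiv q(1) diff_le_mono)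
  moreover have "(s has_vector_derivative glue K (\<lambda>k. pderiv (q k)) t) (at t)"
    if t: "t \<in> I - ?tp ` {..?n}" for t
  proof -
    obtain k where k: "k < ?n" "t \<in> sub_int M K k"
      using t sub_int_partition(1)[OF K] by blast
    moreover have "t \<noteq> ?tp (Suc k)"
      using t k(1) by auto
    ultimately have t': "t \<in> {?tp k<..<?tp (Suc k)}"
      by (simp add: sub_int_def)
    have "(poly (q k) has_vector_derivative poly (pderiv (q k)) t) (at t)"
      unfolding has_real_derivative_iff_has_vector_derivative[symmetric] by (rule poly_DERIV)
    then have "(s has_vector_derivative poly (pderiv (q k)) t) (at t)"
      by (rule has_vector_derivative_transform_within_open[OF _ open_greaterThanLessThan t'])
        (simp add: q(2)[OF k(1)] sub_int_def)
    then show ?thesis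
      by (simp add: glue_eq[OF K k])
  qed
  ultimately show ?thesis
    by (intro exI[of _ \<sigma>] exI[of _ "glue K (\<lambda>k. pderiv (q k))"] exI[of _ "?tp ` {..?n}"]) auto
qed

end

section \<open>Broken vector fields\<close>

lemma set_integral_spike:
  fixes f g :: "'a::euclidean_space \<Rightarrow> 'b::euclidean_space"
  assumes "negligible N" "\<And>x. x \<in> S - N \<Longrightarrow> g x = f x" "set_integrable lebesgue S f"
  shows "(LINT x:S|lebesgue. g x) = (LINT x:S|lebesgue. f x)"
proof -
  have "set_integrable lebesgue S g"
    by (rule absolutely_integrable_spike[OF assms(3,1,2)])
  then show ?thesis
    using assms integral_spike[of N S g f] by (metis set_lebesgue_integral_eq_integral(2))
qed

lemma set_integral_double_sum:
  fixes f :: "nat \<Rightarrow> nat \<Rightarrow> 'a \<Rightarrow> real"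
  assumes "\<And>i j. i < n \<Longrightarrow> j < m \<Longrightarrow> set_integrable L S (f i j)"
  shows "set_integrable L S (\<lambda>x. \<Sum>i<n. \<Sum>j<m. f i j x * c i j)"
    and "(LINT x:S|L. (\<Sum>i<n. \<Sum>j<m. f i j x * c i j)) = (\<Sum>i<n. \<Sum>j<m. (LINT x:S|L. f i j x) * c i j)"
proof -
  have *: "integrable L (\<lambda>x. indicator S x *\<^sub>R (f i j x * c i j))"
    "(LINT x|L. indicator S x *\<^sub>R (f i j x * c i j)) = (LINT x:S|L. f i j x) * c i j"
    if "i < n" "j < m" for i j
  proof -
    show "integrable L (\<lambda>x. indicator S x *\<^sub>R (f i j x * c i j))"
      using set_integrable_mult_left[OF assms[OF that], of "c i j"] unfolding set_integrable_def .
    show "(LINT x|L. indicator S x *\<^sub>R (f i j x * c i j)) = (LINT x:S|L. f i j x) * c i j"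
      unfolding set_lebesgue_integral_def by (simp flip: mult.assoc)
  qed
  have eq: "indicator S x *\<^sub>R (\<Sum>i<n. \<Sum>j<m. f i j x * c i j) =
      (\<Sum>i<n. \<Sum>j<m. indicator S x *\<^sub>R (f i j x * c i j))" for x
    by (simp add: sum_distrib_left)
  show "set_integrable L S (\<lambda>x. \<Sum>i<n. \<Sum>j<m. f i j x * c i j)"
    unfolding set_integrable_def eq by (intro Bochner_Integration.integrable_sum *) auto
  show "(LINT x:S|L. (\<Sum>i<n. \<Sum>j<m. f i j x * c i j)) = (\<Sum>i<n. \<Sum>j<m. (LINT x:S|L. f i j x) * c i j)"
  proof -
    have "(LINT x:S|L. (\<Sum>i<n. \<Sum>j<m. f i j x * c i j)) =
        (\<Sum>i<n. LINT x|L. (\<Sum>j<m. indicator S x *\<^sub>R (f i j x * c i j)))"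
      unfolding set_lebesgue_integral_def eq
      by (intro Bochner_Integration.integral_sum Bochner_Integration.integrable_sum *) auto
    also have "\<dots> = (\<Sum>i<n. \<Sum>j<m. LINT x|L. indicator S x *\<^sub>R (f i j x * c i j))"
      by (intro sum.cong refl Bochner_Integration.integral_sum *) auto
    finally show ?thesis
      using *(2) by simp
  qed
qed

lemma inner_double_sum:
  "(\<Sum>i<n. s i *\<^sub>R a i) \<bullet> (\<Sum>j<m. r j *\<^sub>R b j) = (\<Sum>i<n::nat. \<Sum>j<m::nat. (a i \<bullet> b j) * (s i * r j))"
  for a b :: "nat \<Rightarrow> 'a::real_inner"
  unfolding inner_sum_left unfolding inner_sum_right by (simp add: mult_ac)

lemma bounded_borel_disjoint_UN:
  fixes f :: "'a::euclidean_space \<Rightarrow> 'b::euclidean_space"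
  assumes "finite J" "\<And>K. K \<in> J \<Longrightarrow> bounded_borel (A K) f" "disjoint_family_on A J"
  shows "bounded_borel (\<Union>K\<in>J. A K) f"
proof -
  have "indicator (\<Union>K\<in>J. A K) x *\<^sub>R f x = (\<Sum>K\<in>J. indicator (A K) x *\<^sub>R f x)" for x
    using assms(1,3) by (simp add: indicator_UN_disjoint scaleR_sum_left)
  moreover have "(\<lambda>x. \<Sum>K\<in>J. indicator (A K) x *\<^sub>R f x) \<in> borel_measurable borel"
    using assms(2) by (intro borel_measurable_sum) (auto simp: bounded_borel_def)
  moreover obtain C where C: "\<And>K x. K \<in> J \<Longrightarrow> x \<in> A K \<Longrightarrow> norm (f x) \<le> C K"
    using assms(2) unfolding bounded_borel_def by metis
  have "norm (f x) \<le> Max (C ` J)" if "x \<in> (\<Union>K\<in>J. A K)" for x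
    using that C assms(1) by (auto intro: order_trans[OF C Max_ge])
  ultimately show ?thesis
    unfolding bounded_borel_def by auto
qed

lemma curl_cong_open:
  assumes "open S" "x \<in> S" "\<And>y. y \<in> S \<Longrightarrow> f y = g y" "g differentiable (at x)"
  shows "curl f x = curl g x"
proof -
  have "(g has_derivative frechet_derivative g (at x)) (at x)"
    using assms(4) by (simp add: frechet_derivative_works)
  then have "(f has_derivative frechet_derivative g (at x)) (at x)"
    by (rule has_derivative_transform_within_open[OF _ assms(1,2)]) (simp add: assms(3))
  then have "frechet_derivative f (at x) = frechet_derivative g (at x)"
    by (metis frechet_derivative_at)
  then show ?thesis
    unfolding curl_def pderiv_dir_def by simp
qed

lemma curl_sum:
  assumes "\<And>i. i < n \<Longrightarrow> a i differentiable (at x)"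
  shows "curl (\<lambda>y. \<Sum>i<n. s i *\<^sub>R a i y) x = (\<Sum>i<n::nat. s i *\<^sub>R curl (a i) x)"
proof -
  have "((\<lambda>y. \<Sum>i<n. s i *\<^sub>R a i y) has_derivative
      (\<lambda>h. \<Sum>i<n. s i *\<^sub>R frechet_derivative (a i) (at x) h)) (at x)"
    using assms by (intro has_derivative_sum has_derivative_scaleR_right)
      (simp add: frechet_derivative_works)
  from frechet_derivative_at[OF this, symmetric]
  have "pderiv_dir l (\<lambda>y. \<Sum>i<n. s i *\<^sub>R a i y) x = (\<Sum>i<n. s i *\<^sub>R pderiv_dir l (a i) x)" for l
    by (simp add: pderiv_dir_def)
  then show ?thesis
    unfolding curl_def vec_eq_iff forall_3
    by (simp add: vector_3 sum_subtractf right_diff_distrib)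
qed

lemma C1_on_Q3:
  assumes "q \<in> Q3_space M K"
  shows "C1_on U (\<lambda>\<xi>. q \<xi> $ i)"
proof -
  obtain c :: "nat \<Rightarrow> nat \<Rightarrow> nat \<Rightarrow> real" where c: "\<And>\<xi>. q \<xi> $ i = (\<Sum>i\<le>pxdeg M K. \<Sum>j\<le>pydeg M K. \<Sum>l\<le>pzdeg M K.
      c i j l * (\<xi> $ 1) ^ i * (\<xi> $ 2) ^ j * (\<xi> $ 3) ^ l)"
    using assms unfolding Q3_space_def Q_space_def by blast
  show ?thesis
    unfolding c by (intro C1_on_sum C1_on_mult C1_on_const C1_on_power C1_on_coord)
qed

lemma Q_space_mult: "f \<in> Q_space p q r \<Longrightarrow> (\<lambda>\<xi>. x * f \<xi>) \<in> Q_space p q r"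
  unfolding Q_space_def
proof clarsimp
  fix c :: "nat \<Rightarrow> nat \<Rightarrow> nat \<Rightarrow> real"
  show "\<exists>e. \<forall>\<xi>::real^3. x * (\<Sum>i\<le>p. \<Sum>j\<le>q. \<Sum>l\<le>r. c i j l * \<xi> $ 1 ^ i * \<xi> $ 2 ^ j * \<xi> $ 3 ^ l) =
      (\<Sum>i\<le>p. \<Sum>j\<le>q. \<Sum>l\<le>r. e i j l * \<xi> $ 1 ^ i * \<xi> $ 2 ^ j * \<xi> $ 3 ^ l)"
    by (rule exI[of _ "\<lambda>i j l. x * c i j l"]) (simp add: sum_distrib_left mult.assoc)
qed

lemma Q3_space_scaleR: "q \<in> Q3_space M K \<Longrightarrow> (\<lambda>\<xi>. x *\<^sub>R q \<xi>) \<in> Q3_space M K"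
  by (simp add: Q3_space_def Q_space_mult)

lemma Q3_space_0: "(\<lambda>\<xi>. 0) \<in> Q3_space M K"
  unfolding Q3_space_def Q_space_def by (auto intro!: exI[of _ "\<lambda>_ _ _. 0"])

section \<open>Broken fields on the mesh and separation of time and space\<close>

context slab_mesh
begin

lemma chart: "K < nelem M \<Longrightarrow> chart (emap M K)"
  using hex unfolding hex_slab_def chart_def DF_def by blast

abbreviation "el K \<equiv> elem M K"
abbreviation "interiors \<equiv> (\<Union>K<nelem M. interior (el K))"

lemma el_props:
  assumes "K < nelem M"
  shows "compact (el K)" "el K \<subseteq> closure (interior (el K))" "negligible (el K - interior (el K))"
    "frontier (el K) = el K - interior (el K)"
proof -
  interpret chart "emap M K" by (rule chart[OF assms])
  show c: "compact (el K)" and "el K \<subseteq> closure (interior (el K))" "negligible (el K - interior (el K))"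
    unfolding elem_def by (fact compact_E E_subset_closure negligible_boundary)+
  show "frontier (el K) = el K - interior (el K)"
    using compact_imp_closed[OF c] by (simp add: frontier_def)
qed

lemma disjoint_interiors: "disjoint_family_on (\<lambda>K. interior (el K)) {..<nelem M}"
  using hex unfolding hex_slab_def disjoint_family_on_def by simp

lemma interior_unique:
  "K < nelem M \<Longrightarrow> K' < nelem M \<Longrightarrow> x \<in> interior (el K) \<Longrightarrow> x \<in> interior (el K') \<Longrightarrow> K = K'"
  using disjoint_interiors unfolding disjoint_family_on_def by blast

lemma Dom_props:
  "open (Dom M)" "bounded (Dom M)" "interiors \<subseteq> Dom M" "negligible (Dom M - interiors)"
proof -
  have sub: "Dom M \<subseteq> (\<Union>K<nelem M. el K)"
    using hex by (simp add: hex_slab_def)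
  show "open (Dom M)" "interiors \<subseteq> Dom M"
    using hex by (auto simp: hex_slab_def)
  have "bounded (\<Union>K<nelem M. el K)"
    using el_props(1) by (auto intro!: bounded_UN compact_imp_bounded)
  then show "bounded (Dom M)"
    using sub bounded_subset by blast
  have "negligible (\<Union>K<nelem M. el K - interior (el K))"
    using el_props(3) by (auto intro!: negligible_Union)
  then show "negligible (Dom M - interiors)"
    by (rule negligible_subset) (use sub in auto)
qed

text \<open>Continuity up to the boundary of each closed element, without matching between elements,
  yields boundedness and the existence of one-sided traces at once.\<close>

definition broken_continuous :: "(real^3 \<Rightarrow> real^3) \<Rightarrow> bool" where
  "broken_continuous a \<longleftrightarrow> (\<forall>K<nelem M. \<exists>\<alpha>. continuous_on (el K) \<alpha> \<and> (\<forall>x\<in>interior (el K). a x = \<alpha> x))"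

definition broken_discrete :: "(real^3 \<Rightarrow> real^3) \<Rightarrow> bool" where
  "broken_discrete a \<longleftrightarrow> (\<forall>K<nelem M. \<exists>q\<in>Q3_space M K. \<forall>x\<in>interior (el K). a x = chart.piola (emap M K) q x)"

text \<open>The curl of a single spatial field; the time 0 is a dummy because the field is constant
  in time. \<open>trace_of\<close>, \<open>avg_of\<close> and \<open>jump_of\<close> use the same
  device.\<close>

definition curl_of :: "(real^3 \<Rightarrow> real^3) \<Rightarrow> real^3 \<Rightarrow> real^3" where
  "curl_of a = curl_h M (\<lambda>_. a) 0"

lemma broken_discrete_imp_broken_continuous: "broken_discrete a \<Longrightarrow> broken_continuous a"
  unfolding broken_continuous_def
proof (intro allI impI)
  fix K assume "broken_discrete a" and K: "K < nelem M"
  then obtain q where q: "q \<in> Q3_space M K" "\<And>y. y \<in> interior (el K) \<Longrightarrow> a y = chart.piola (emap M K) q y"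
    unfolding broken_discrete_def by blast
  moreover have "continuous_on (el K) (chart.piola (emap M K) q)"
    using chart.piola_C1(1)[OF chart[OF K] C1_on_Q3[OF q(1)]] unfolding elem_def .
  ultimately show "\<exists>\<alpha>. continuous_on (el K) \<alpha> \<and> (\<forall>x\<in>interior (el K). a x = \<alpha> x)"
    by blast
qed

lemma broken_discrete_differentiable:
  assumes "broken_discrete a" "x \<in> interiors"
  shows "a differentiable (at x)"
proof -
  obtain K where K: "K < nelem M" "x \<in> interior (el K)"
    using assms by blast
  obtain q where q: "q \<in> Q3_space M K" "\<And>y. y \<in> interior (el K) \<Longrightarrow> a y = chart.piola (emap M K) q y"
    using assms(1) K(1) unfolding broken_discrete_def by blast
  have "chart.piola (emap M K) q differentiable (at x)"
    using chart.piola_C1(2)[OF chart[OF K(1)] C1_on_Q3[OF q(1)]] K(2) unfolding elem_def .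
  then obtain D where "(chart.piola (emap M K) q has_derivative D) (at x)"
    unfolding differentiable_def by blast
  then have "(a has_derivative D) (at x)"
    by (rule has_derivative_transform_within_open[OF _ open_interior K(2)]) (simp add: q(2))
  then show ?thesis
    unfolding differentiable_def by blast
qed

lemma curl_of_interior: "x \<in> interiors \<Longrightarrow> curl_of a x = curl a x"
  by (auto simp: curl_of_def curl_h_def)

lemma broken_discrete_curl_of_broken_continuous:
  assumes "broken_discrete a"
  shows "broken_continuous (curl_of a)"
  unfolding broken_continuous_def
proof (intro allI impI)
  fix K assume K: "K < nelem M"
  obtain q where q: "q \<in> Q3_space M K" "\<And>y. y \<in> interior (el K) \<Longrightarrow> a y = chart.piola (emap M K) q y"
    using assms(1) K(1) unfolding broken_discrete_def by blast
  obtain c where c: "continuous_on (el K) c"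
    "\<And>x. x \<in> interior (el K) \<Longrightarrow> curl (chart.piola (emap M K) q) x = c x"
    using chart.piola_curl[OF chart[OF K(1)] C1_on_Q3[OF q(1)]] unfolding elem_def by blast
  have "curl_of a x = c x" if x: "x \<in> interior (el K)" for x
  proof -
    have "chart.piola (emap M K) q differentiable (at x)"
      using chart.piola_C1(2)[OF chart[OF K(1)] C1_on_Q3[OF q(1)]] x unfolding elem_def .
    then have "curl a x = curl (chart.piola (emap M K) q) x"
      by (intro curl_cong_open[OF open_interior x]) (use q(2) in auto)
    then show ?thesis
      using c(2)[OF x] curl_of_interior[of x a] x K by auto
  qed
  then show "\<exists>\<alpha>. continuous_on (el K) \<alpha> \<and> (\<forall>x\<in>interior (el K). curl_of a x = \<alpha> x)"
    using c(1) by blast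
qed

lemma broken_continuous_bounded_borel:
  assumes "broken_continuous a"
  shows "bounded_borel interiors a"
proof (rule bounded_borel_disjoint_UN)
  fix K assume "K \<in> {..<nelem M}"
  then have K: "K < nelem M" by simp
  obtain \<alpha> where \<alpha>: "continuous_on (el K) \<alpha>" "\<And>x. x \<in> interior (el K) \<Longrightarrow> a x = \<alpha> x"
    using assms K unfolding broken_continuous_def by blast
  have "bounded_borel (interior (el K)) \<alpha>"
    by (rule bounded_borel_continuous[OF el_props(1)[OF K] \<alpha>(1) interior_subset]) simp
  then show "bounded_borel (interior (el K)) a"
    using bounded_borel_cong \<alpha>(2) by blast
qed (auto simp: disjoint_interiors)

lemma set_integrable_interiors:
  assumes "bounded_borel interiors (f :: _ \<Rightarrow> real)"
  shows "set_integrable lebesgue (Dom M) f"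
proof -
  have "set_integrable lebesgue interiors f"
    using bounded_borel_integrable[OF assms] Dom_props(2,3) bounded_subset by (metis open_UN open_interior borel_open)
  moreover have "negligible {x \<in> interiors - Dom M. f x \<noteq> 0}" "negligible {x \<in> Dom M - interiors. f x \<noteq> 0}"
    using Dom_props(3) by (auto intro: negligible_subset[OF Dom_props(4)] simp: Diff_eq_empty_iff[THEN iffD2])
  ultimately show ?thesis
    using absolutely_integrable_spike_set by blast
qed

lemma broken_continuous_integrable: "broken_continuous a \<Longrightarrow> broken_continuous b \<Longrightarrow> set_integrable lebesgue (Dom M) (\<lambda>x. a x \<bullet> b x)"
  by (intro set_integrable_interiors bounded_borel_inner broken_continuous_bounded_borel)

text \<open>The exceptional set consists of times, never of points: the projection is determined for
  almost every time only, while curls and traces at a fixed time need the identity at all interior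
  points.\<close>

definition has_expansion :: "vfield \<Rightarrow> nat \<Rightarrow> (nat \<Rightarrow> real \<Rightarrow> real) \<Rightarrow> (nat \<Rightarrow> real^3 \<Rightarrow> real^3) \<Rightarrow> bool" where
  "has_expansion v n s a \<longleftrightarrow> (\<exists>N. negligible N \<and>
     (\<forall>t\<in>I - N. \<forall>x\<in>interiors. v t x = (\<Sum>i<n. s i t *\<^sub>R a i x)))"

definition dom_inner :: "(real^3 \<Rightarrow> real^3) \<Rightarrow> (real^3 \<Rightarrow> real^3) \<Rightarrow> real" where
  "dom_inner a b = (LINT x:Dom M|lebesgue. a x \<bullet> b x)"

lemma space_integral:
  fixes n m :: nat
  assumes "\<And>x. x \<in> interiors \<Longrightarrow> v x = (\<Sum>i<n. s i *\<^sub>R a i x)" "\<And>x. x \<in> interiors \<Longrightarrow> w x = (\<Sum>j<m. r j *\<^sub>R b j x)"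
    and "\<And>i. i < n \<Longrightarrow> broken_continuous (a i)" "\<And>j. j < m \<Longrightarrow> broken_continuous (b j)"
  shows "(LINT x:Dom M|lebesgue. v x \<bullet> w x) = (\<Sum>i<n. \<Sum>j<m. s i * r j * dom_inner (a i) (b j))"
    and "set_integrable lebesgue (Dom M) (\<lambda>x. v x \<bullet> w x)"
proof -
  have eq: "v x \<bullet> w x = (\<Sum>i<n. \<Sum>j<m. (a i x \<bullet> b j x) * (s i * r j))" if "x \<in> Dom M - (Dom M - interiors)" for x
  proof -
    have "x \<in> interiors" using that by blast
    then have "v x = (\<Sum>i<n. s i *\<^sub>R a i x)" "w x = (\<Sum>j<m. r j *\<^sub>R b j x)"
      by (rule assms(1), rule assms(2))
    then show ?thesis by (simp only:) (rule inner_double_sum)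
  qed
  note i = set_integral_double_sum[OF broken_continuous_integrable[OF assms(3,4)], where c="\<lambda>i j. s i * r j"]
  show "(LINT x:Dom M|lebesgue. v x \<bullet> w x) = (\<Sum>i<n. \<Sum>j<m. s i * r j * dom_inner (a i) (b j))"
    using set_integral_spike[OF Dom_props(4) eq i(1)] i(2) by (simp add: dom_inner_def mult.commute)
  show "set_integrable lebesgue (Dom M) (\<lambda>x. v x \<bullet> w x)"
    by (rule absolutely_integrable_spike[OF i(1) Dom_props(4) eq])
qed

lemma time_integrable: "bounded_borel I s \<Longrightarrow> bounded_borel I r \<Longrightarrow> set_integrable lebesgue I (\<lambda>t. s t * r t :: real)"
  by (intro bounded_borel_integrable bounded_borel_mult I_props(1,2))

lemma time_integral:
  fixes s r :: "nat \<Rightarrow> real \<Rightarrow> real"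
  assumes "negligible N" "\<And>t. t \<in> I - N \<Longrightarrow> f t = (\<Sum>i<n. \<Sum>j<m. s i t * r j t * c i j)"
    and "\<And>i. i < n \<Longrightarrow> bounded_borel I (s i)" "\<And>j. j < m \<Longrightarrow> bounded_borel I (r j)"
  shows "(LINT t:I|lebesgue. f t) = (\<Sum>i<n. \<Sum>j<m. (LINT t:I|lebesgue. s i t * r j t) * c i j)"
  using set_integral_spike[OF assms(1,2) set_integral_double_sum(1)[OF time_integrable[OF assms(3,4)]]]
    set_integral_double_sum(2)[OF time_integrable[OF assms(3,4)]] by simp

text \<open>Separation of variables: time enters only through the scalar products of coefficients,
  so replacing a coefficient by its projection changes nothing but these numbers.
  \<open>face_rep\<close> is the counterpart for faces.\<close>

lemma iprod_rep:
  assumes "has_expansion v n s a" "has_expansion w m r b"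
    and "\<And>i. i < n \<Longrightarrow> broken_continuous (a i)" "\<And>j. j < m \<Longrightarrow> broken_continuous (b j)"
    and "\<And>i. i < n \<Longrightarrow> bounded_borel I (s i)" "\<And>j. j < m \<Longrightarrow> bounded_borel I (r j)"
  shows "iprod M v w = (\<Sum>i<n. \<Sum>j<m. (LINT t:I|lebesgue. s i t * r j t) * dom_inner (a i) (b j))"
proof -
  obtain N1 where N1: "negligible N1"
    "\<And>t x. t \<in> I - N1 \<Longrightarrow> x \<in> interiors \<Longrightarrow> v t x = (\<Sum>i<n. s i t *\<^sub>R a i x)"
    using assms(1) unfolding has_expansion_def by blast
  obtain N2 where N2: "negligible N2"
    "\<And>t x. t \<in> I - N2 \<Longrightarrow> x \<in> interiors \<Longrightarrow> w t x = (\<Sum>j<m. r j t *\<^sub>R b j x)"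
    using assms(2) unfolding has_expansion_def by blast
  show ?thesis
    unfolding iprod_def
  proof (rule time_integral)
    show "negligible (N1 \<union> N2)" using N1 N2 by simp
    show "(LINT x:Dom M|lebesgue. v t x \<bullet> w t x) = (\<Sum>i<n. \<Sum>j<m. s i t * r j t * dom_inner (a i) (b j))"
      if "t \<in> I - (N1 \<union> N2)" for t
    proof (rule space_integral(1))
      show "v t x = (\<Sum>i<n. s i t *\<^sub>R a i x)" "w t x = (\<Sum>j<m. r j t *\<^sub>R b j x)" if "x \<in> interiors" for x
        using \<open>t \<in> I - (N1 \<union> N2)\<close> by (auto intro!: N1(2) N2(2) that)
    qed (use assms in auto)
  qed (use assms in auto)
qed

text \<open>At an admissible time the expansion holds on an open set of points, so it may be
  differentiated in space.\<close>

lemma curl_rep: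
  assumes "has_expansion v n s a" "\<And>i. i < n \<Longrightarrow> broken_discrete (a i)"
  shows "has_expansion (curl_h M v) n s (\<lambda>i. curl_of (a i))"
proof -
  obtain N where N: "negligible N"
    "\<And>t x. t \<in> I - N \<Longrightarrow> x \<in> interiors \<Longrightarrow> v t x = (\<Sum>i<n. s i t *\<^sub>R a i x)"
    using assms(1) unfolding has_expansion_def by blast
  have "curl_h M v t x = (\<Sum>i<n. s i t *\<^sub>R curl_of (a i) x)" if t: "t \<in> I - N" and x: "x \<in> interiors" for t x
  proof -
    have d: "a i differentiable (at x)" if "i < n" for i
      by (rule broken_discrete_differentiable[OF assms(2)[OF that] x])
    have "curl_h M v t x = curl (v t) x"
      using x by (auto simp: curl_h_def)
    also have "\<dots> = curl (\<lambda>y. \<Sum>i<n. s i t *\<^sub>R a i y) x"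
      by (rule curl_cong_open[OF _ x N(2)[OF t]]) (use d in \<open>auto intro!: differentiable_sum differentiable_scaleR\<close>)
    also have "\<dots> = (\<Sum>i<n. s i t *\<^sub>R curl (a i) x)"
      by (rule curl_sum[OF d])
    finally show ?thesis
      using curl_of_interior[OF x] by simp
  qed
  then show ?thesis
    unfolding has_expansion_def using N(1) by blast
qed

end

section \<open>Traces and face integrals\<close>

lemma bounded_bilinear_cross3: "bounded_bilinear cross3"
  using bilinear_cross bilinear_conv_bounded_bilinear by blast

text \<open>The image of \<open>C\<close> may leave \<open>A\<close>, so the indicator is composed
  along with \<open>h\<close>. In the proof \<open>g\<close> is first cut off outside
  \<open>C\<close>, because its continuity is known only there.\<close>

lemma bounded_borel_compose:
  assumes h: "bounded_borel A h" and g: "continuous_on C g" and C: "C \<in> sets borel"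
  shows "bounded_borel C (\<lambda>x. indicator A (g x) *\<^sub>R h (g x))"
proof -
  have "(\<lambda>x. indicator C x *\<^sub>R g x) \<in> borel_measurable borel"
    by (rule borel_measurable_continuous_on_indicator[OF C g])
  then have "(\<lambda>x. indicator A (indicator C x *\<^sub>R g x) *\<^sub>R h (indicator C x *\<^sub>R g x)) \<in> borel_measurable borel"
    by (rule measurable_compose[where g="\<lambda>y. indicator A y *\<^sub>R h y"]) (use h in \<open>simp add: bounded_borel_def\<close>)
  then have "(\<lambda>x. indicator C x *\<^sub>R (indicator A (indicator C x *\<^sub>R g x) *\<^sub>R h (indicator C x *\<^sub>R g x)))
      \<in> borel_measurable borel"
    by (rule borel_measurable_scaleR[OF borel_measurable_indicator[OF C]])
  also have "(\<lambda>x. indicator C x *\<^sub>R (indicator A (indicator C x *\<^sub>R g x) *\<^sub>R h (indicator C x *\<^sub>R g x))) =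
      (\<lambda>x. indicator C x *\<^sub>R (indicator A (g x) *\<^sub>R h (g x)))"
    by (intro ext) (simp split: split_indicator)
  finally have "\<dots> \<in> borel_measurable borel" .
  moreover obtain D where "\<And>x. x \<in> A \<Longrightarrow> norm (h x) \<le> D"
    using h unfolding bounded_borel_def by blast
  then have "norm (indicator A (g x) *\<^sub>R h (g x)) \<le> max D 0" for x
    by (auto simp: le_max_iff_disj split: split_indicator)
  ultimately show ?thesis
    unfolding bounded_borel_def by blast
qed

text \<open>The choice in \<^const>\<open>out_normal\<close> depends on \<open>\<xi>\<close> only through the finite set of sides that
  contain it, which makes it a simple function.\<close>

lemma side_choice_measurable:
  "(\<lambda>\<xi>. case (SOME (i, s). s \<in> {0, 1} \<and> \<xi> $ i = s) of (i, s) \<Rightarrow> h i s) \<in> borel_measurable borel"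
  for h :: "3 \<Rightarrow> real \<Rightarrow> real^3"
proof -
  \<comment> \<open>For points on no side this set is empty and the choice returns an arbitrary but
    fixed pair, which does not disturb measurability.\<close>
  define Z where "Z \<xi> = {(i::3, s::real). s \<in> {0, 1} \<and> \<xi> $ i = s}" for \<xi> :: "real^3"
  define P where "P = (UNIV :: 3 set) \<times> {0, 1::real}"
  have mem: "p \<in> Z \<xi> \<longleftrightarrow> p \<in> P \<and> \<xi> $ fst p = snd p" for p \<xi>
    by (cases p) (auto simp: Z_def P_def)
  then have ZP: "Z \<xi> \<in> Pow P" for \<xi>
    by blast
  have "Z \<in> borel \<rightarrow>\<^sub>M count_space (Pow P)"
  proof (subst measurable_count_space_eq2)
    show "finite (Pow P)" by (simp add: P_def)
    have "Z -` {S} \<inter> space borel \<in> sets borel" if "S \<in> Pow P" for S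
    proof -
      have "Z -` {S} \<inter> space borel = (\<Inter>p\<in>P. {\<xi>. (\<xi> $ fst p = snd p) \<longleftrightarrow> p \<in> S})"
      proof (rule set_eqI)
        fix \<xi>
        have "Z \<xi> = S \<longleftrightarrow> (\<forall>p\<in>P. (\<xi> $ fst p = snd p) \<longleftrightarrow> p \<in> S)"
          using that mem by blast
        then show "\<xi> \<in> Z -` {S} \<inter> space borel \<longleftrightarrow> \<xi> \<in> (\<Inter>p\<in>P. {\<xi>. (\<xi> $ fst p = snd p) \<longleftrightarrow> p \<in> S})"
          by simp
      qed
      also have "\<dots> \<in> sets borel"
      proof (rule sets.finite_INT)
        fix p assume "p \<in> P"
        have "{\<xi>::real^3. \<xi> $ fst p = snd p} \<in> sets borel"
          by (intro borel_closed closed_Collect_eq continuous_intros)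
        moreover have "{\<xi>::real^3. (\<xi> $ fst p = snd p) \<longleftrightarrow> p \<in> S} =
            (if p \<in> S then {\<xi>. \<xi> $ fst p = snd p} else - {\<xi>. \<xi> $ fst p = snd p})"
          by auto
        ultimately show "{\<xi>::real^3. (\<xi> $ fst p = snd p) \<longleftrightarrow> p \<in> S} \<in> sets borel"
          by (simp add: borel_comp)
      qed (auto simp: P_def)
      finally show ?thesis .
    qed
    with ZP show "Z \<in> space borel \<rightarrow> Pow P \<and> (\<forall>S\<in>Pow P. Z -` {S} \<inter> space borel \<in> sets borel)"
      by (intro conjI Pi_I ballI)
  qed
  moreover have "(\<lambda>S. case (SOME p. p \<in> S) of (i, s) \<Rightarrow> h i s) \<in> borel_measurable (count_space (Pow P))"
    by simp
  ultimately have "(\<lambda>\<xi>. case (SOME p. p \<in> Z \<xi>) of (i, s) \<Rightarrow> h i s) \<in> borel_measurable borel"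
    by (rule measurable_compose)
  moreover have "(\<lambda>p. p \<in> Z \<xi>) = (\<lambda>(i, s). s \<in> {0, 1} \<and> \<xi> $ i = s)" for \<xi>
    by (simp add: Z_def fun_eq_iff)
  ultimately show ?thesis
    by (simp only:)
qed

context slab_mesh
begin

text \<open>Before normalization the normal is a combination of the columns of the inverse
  transposed Jacobian. These columns are continuous, being Piola images of constant fields, and the
  coefficients \<open>d\<close> are Borel in the reference point.\<close>

lemma bounded_borel_out_normal:
  assumes "K < nelem M"
  shows "bounded_borel (el K) (out_normal M K)"
proof -
  interpret chart "emap M K" by (rule chart[OF assms])
  have E: "E = el K" by (simp add: elem_def)
  have El: "el K \<in> sets borel"
    using el_props(1)[OF assms] by (simp add: borel_compact)
  define d :: "real^3 \<Rightarrow> real^3" where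
    "d \<xi> = (case (SOME (i, s). s \<in> {0, 1} \<and> \<xi> $ i = s) of (i, s) \<Rightarrow> axis i (2 * s - 1))" for \<xi>
  \<comment> \<open>Cutting off outside the element allows Borel maps to be composed on the whole
    space.\<close>
  define \<gamma> where "\<gamma> x = indicator (el K) x *\<^sub>R G x" for x
  define m where "m l x = indicator (el K) x *\<^sub>R piola (\<lambda>_. axis l 1) x" for l x
  have dm: "d \<in> borel_measurable borel"
    unfolding d_def by (rule side_choice_measurable)
  have \<gamma>: "\<gamma> \<in> borel_measurable borel"
    unfolding \<gamma>_def using El cont_G unfolding E by (intro borel_measurable_continuous_on_indicator)
  have d: "(\<lambda>x. d (\<gamma> x) $ l) \<in> borel_measurable borel" for l
    by (rule measurable_compose[OF measurable_compose[OF \<gamma> dm] borel_measurable_continuous_onI])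
      (intro continuous_intros)
  have m: "m l \<in> borel_measurable borel" for l
    unfolding m_def using El piola_C1(1)[of "\<lambda>_. axis l 1"] unfolding E
    by (intro borel_measurable_continuous_on_indicator) (auto intro: C1_on_const)
  define w where "w x = (\<Sum>l\<in>UNIV. d (\<gamma> x) $ l *\<^sub>R m l x)" for x
  have w: "w \<in> borel_measurable borel"
    unfolding w_def by (intro borel_measurable_sum borel_measurable_scaleR d m)
  have eq: "out_normal M K x = inverse (norm (w x)) *\<^sub>R w x" if "x \<in> el K" for x
  proof -
    have "out_normal M K x = sgn (matrix_inv (transpose (J (G x))) *v d (G x))"
      unfolding out_normal_def d_def DF_def Let_def by (simp add: case_prod_unfold)
    also have "d (G x) = (\<Sum>l\<in>UNIV. d (G x) $ l *\<^sub>R axis l 1)"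
      using basis_expansion[of "d (G x)"] by (simp add: scalar_mult_eq_scaleR)
    also have "matrix_inv (transpose (J (G x))) *v (\<Sum>l\<in>UNIV. d (G x) $ l *\<^sub>R axis l 1) = w x"
      using that unfolding linear_sum[OF matrix_vector_mul_linear] matrix_vector_mult_scaleR
      by (simp add: w_def m_def \<gamma>_def piola_def)
    finally show ?thesis
      by (simp add: sgn_div_norm)
  qed
  have "(\<lambda>x. indicator (el K) x *\<^sub>R out_normal M K x) =
      (\<lambda>x. indicator (el K) x *\<^sub>R (inverse (norm (w x)) *\<^sub>R w x))"
    by (intro ext) (simp add: eq split: split_indicator)
  moreover have "\<dots> \<in> borel_measurable borel"
    using El w by (measurable; simp)
  moreover have "norm (out_normal M K x) \<le> 1" for x
    unfolding out_normal_def Let_def by (simp add: case_prod_unfold norm_sgn)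
  ultimately show ?thesis
    unfolding bounded_borel_def by auto
qed

lemma face_set_props:
  assumes "f \<in> F_0 M \<union> F_b M"
  shows "face_elem f < nelem M" "compact (face_set M f)" "face_set M f \<subseteq> el (face_elem f)"
proof -
  show K: "face_elem f < nelem M"
    using assms by (auto simp: F_0_def F_b_def)
  have "face_set M f \<subseteq> frontier (el (face_elem f))" "closed (face_set M f)"
    using assms by (auto simp: F_0_def F_b_def)
  then show sub: "face_set M f \<subseteq> el (face_elem f)"
    using el_props(4)[OF K] by blast
  then show "compact (face_set M f)"
    using compact_Int_closed[OF el_props(1)[OF K] \<open>closed (face_set M f)\<close>] by (simp only: inf.absorb2)
qed

text \<open>A boundary point of the element is an accumulation point of its interior, so the limit
  is unique and \<open>Lim\<close> returns the value of the continuous extension.\<close>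

lemma trace_eq:
  assumes K: "K < nelem M" and x: "x \<in> frontier (el K)" and \<alpha>: "continuous_on (el K) \<alpha>"
    and v: "\<And>y. y \<in> interior (el K) \<Longrightarrow> v t y = \<alpha> y"
  shows "trace_from M K v t x = \<alpha> x"
proof -
  have x': "x \<in> el K" "x \<notin> interior (el K)" "x \<in> closure (interior (el K))"
    using x el_props(2,4)[OF K] by auto
  have "(\<alpha> \<longlongrightarrow> \<alpha> x) (at x within interior (el K))"
    by (rule tendsto_within_subset[OF _ interior_subset]) (use \<alpha> x'(1) in \<open>simp add: continuous_on_def\<close>)
  moreover have "\<forall>\<^sub>F y in at x within interior (el K). \<alpha> y = v t y"
    using v by (auto simp: eventually_at_filter)
  ultimately have "(v t \<longlongrightarrow> \<alpha> x) (at x within interior (el K))"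
    by (rule Lim_transform_eventually)
  moreover have "at x within interior (el K) \<noteq> bot"
    using x' by (metis closure_def UnE mem_Collect_eq trivial_limit_within)
  ultimately show ?thesis
    unfolding trace_from_def by (rule tendsto_Lim[rotated])
qed

definition trace_of :: "nat \<Rightarrow> (real^3 \<Rightarrow> real^3) \<Rightarrow> real^3 \<Rightarrow> real^3" where
  "trace_of K a = trace_from M K (\<lambda>_. a) 0"

lemma trace_continuous:
  assumes "K < nelem M" "broken_continuous a"
  shows "\<exists>\<alpha>. continuous_on (el K) \<alpha> \<and> (\<forall>x\<in>interior (el K). a x = \<alpha> x) \<and> (\<forall>x\<in>frontier (el K). trace_of K a x = \<alpha> x)"
proof -
  obtain \<alpha> where \<alpha>: "continuous_on (el K) \<alpha>" "\<And>x. x \<in> interior (el K) \<Longrightarrow> a x = \<alpha> x"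
    using assms unfolding broken_continuous_def by blast
  then have "trace_of K a x = \<alpha> x" if "x \<in> frontier (el K)" for x
    unfolding trace_of_def by (intro trace_eq assms that) auto
  with \<alpha> show ?thesis by blast
qed

text \<open>\<open>Lim\<close> is additive only where limits exist; the continuous extensions of the
  spatial parts guarantee this.\<close>

lemma trace_sum:
  fixes n :: nat
  assumes K: "K < nelem M" and x: "x \<in> frontier (el K)"
    and a: "\<And>i. i < n \<Longrightarrow> broken_continuous (a i)" and v: "\<And>y. y \<in> interiors \<Longrightarrow> v t y = (\<Sum>i<n. s i *\<^sub>R a i y)"
  shows "trace_from M K v t x = (\<Sum>i<n. s i *\<^sub>R trace_of K (a i) x)"
proof -
  have "\<forall>i. \<exists>\<alpha>. i < n \<longrightarrow> continuous_on (el K) \<alpha> \<and> (\<forall>x\<in>interior (el K). a i x = \<alpha> x) \<and>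
      (\<forall>x\<in>frontier (el K). trace_of K (a i) x = \<alpha> x)"
    using trace_continuous[OF K a] by blast
  from choice[OF this] obtain \<alpha> where \<alpha>: "\<And>i. i < n \<Longrightarrow> continuous_on (el K) (\<alpha> i)"
    "\<And>i y. i < n \<Longrightarrow> y \<in> interior (el K) \<Longrightarrow> a i y = \<alpha> i y"
    "\<And>i y. i < n \<Longrightarrow> y \<in> frontier (el K) \<Longrightarrow> trace_of K (a i) y = \<alpha> i y"
    by blast
  have "trace_from M K v t x = (\<Sum>i<n. s i *\<^sub>R \<alpha> i x)"
  proof (rule trace_eq[OF K x])
    show "continuous_on (el K) (\<lambda>x. \<Sum>i<n. s i *\<^sub>R \<alpha> i x)"
      using \<alpha>(1) by (intro continuous_intros) auto
    show "v t y = (\<Sum>i<n. s i *\<^sub>R \<alpha> i y)" if "y \<in> interior (el K)" for y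
      using v[of y] \<alpha>(2)[OF _ that] that K by auto
  qed
  then show ?thesis
    using \<alpha>(3)[OF _ x] by simp
qed

lemma trace_of_bounded_borel:
  assumes "K < nelem M" "broken_continuous a" "S \<subseteq> frontier (el K)" "S \<in> sets borel"
  shows "bounded_borel S (trace_of K a)"
proof -
  obtain \<alpha> where \<alpha>: "continuous_on (el K) \<alpha>" "\<And>x. x \<in> frontier (el K) \<Longrightarrow> trace_of K a x = \<alpha> x"
    using trace_continuous[OF assms(1,2)] by blast
  have "bounded_borel S \<alpha>"
    by (rule bounded_borel_continuous[OF el_props(1)[OF assms(1)] \<alpha>(1) _ assms(4)])
      (use assms(3) el_props(4)[OF assms(1)] in auto)
  then show ?thesis
    using bounded_borel_cong[of S "trace_of K a" \<alpha>] \<alpha>(2) assms(3) by blast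
qed

definition avg_of :: "(real^3 \<Rightarrow> real^3) \<Rightarrow> face \<Rightarrow> real^3 \<Rightarrow> real^3" where
  "avg_of a f = avg M (\<lambda>_. a) f 0"

definition jump_of :: "(real^3 \<Rightarrow> real^3) \<Rightarrow> face \<Rightarrow> real^3 \<Rightarrow> real^3" where
  "jump_of a f = jump_T M (\<lambda>_. a) f 0"

lemma bounded_borel_subset: "bounded_borel A f \<Longrightarrow> B \<subseteq> A \<Longrightarrow> B \<in> sets borel \<Longrightarrow> bounded_borel B f"
proof -
  assume *: "bounded_borel A f" "B \<subseteq> A" "B \<in> sets borel"
  then have "(\<lambda>x. indicator B x *\<^sub>R (indicator A x *\<^sub>R f x)) \<in> borel_measurable borel"
    unfolding bounded_borel_def by (intro borel_measurable_scaleR[OF borel_measurable_indicator[OF *(3)]]) blast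
  moreover have "(\<lambda>x. indicator B x *\<^sub>R (indicator A x *\<^sub>R f x)) = (\<lambda>x. indicator B x *\<^sub>R f x)"
    using *(2) by (intro ext) (auto split: split_indicator)
  ultimately show ?thesis
    using * unfolding bounded_borel_def by auto
qed

lemma face_linear:
  fixes n :: nat
  assumes f: "f \<in> F_0 M \<union> F_b M" and x: "x \<in> face_set M f"
    and a: "\<And>i. i < n \<Longrightarrow> broken_continuous (a i)" and v: "\<And>y. y \<in> interiors \<Longrightarrow> v t y = (\<Sum>i<n. s i *\<^sub>R a i y)"
  shows "avg M v f t x = (\<Sum>i<n. s i *\<^sub>R avg_of (a i) f x)"
    and "jump_T M v f t x = (\<Sum>i<n. s i *\<^sub>R jump_of (a i) f x)"
proof -
  have tr: "trace_from M K v t x = (\<Sum>i<n. s i *\<^sub>R trace_of K (a i) x)"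
    if "K < nelem M" "x \<in> frontier (el K)" for K
    by (rule trace_sum[OF that]) (auto intro: a v)
  interpret c: bounded_bilinear cross3 by (rule bounded_bilinear_cross3)
  consider K1 K2 where "f = IFace K1 K2" "K1 < nelem M" "K2 < nelem M" | K where "f = BFace K" "K < nelem M"
    using f by (auto simp: F_0_def F_b_def)
  then have "avg M v f t x = (\<Sum>i<n. s i *\<^sub>R avg_of (a i) f x) \<and>
    jump_T M v f t x = (\<Sum>i<n. s i *\<^sub>R jump_of (a i) f x)"
  proof cases
    case 1
    then show ?thesis
      using x by (simp add: avg_of_def jump_of_def tr c.sum_right c.scaleR_right sum.distrib
          scaleR_right_distrib scaleR_sum_right scaleR_left_commute flip: trace_of_def)
  next
    case 2
    then show ?thesis
      using x by (simp add: avg_of_def jump_of_def tr c.sum_right c.scaleR_right flip: trace_of_def)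
  qed
  then show "avg M v f t x = (\<Sum>i<n. s i *\<^sub>R avg_of (a i) f x)"
    "jump_T M v f t x = (\<Sum>i<n. s i *\<^sub>R jump_of (a i) f x)" by blast+
qed

lemma face_bounded_borel:
  assumes f: "f \<in> F_0 M \<union> F_b M" and a: "broken_continuous a"
  shows "bounded_borel (face_set M f) (avg_of a f)" "bounded_borel (face_set M f) (jump_of a f)"
proof -
  have S: "face_set M f \<in> sets borel"
    using face_set_props(2)[OF f] by (simp add: borel_compact)
  note cr = bounded_borel_bilinear[OF bounded_bilinear_cross3]
  note nt = trace_of_bounded_borel[OF _ a _ S] bounded_borel_subset[OF bounded_borel_out_normal _ S]
  consider K1 K2 where "f = IFace K1 K2" "K1 < nelem M" "K2 < nelem M" | K where "f = BFace K" "K < nelem M"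
    using f by (auto simp: F_0_def F_b_def)
  then have "bounded_borel (face_set M f) (avg_of a f) \<and> bounded_borel (face_set M f) (jump_of a f)"
  proof cases
    case 1
    have sub: "face_set M f \<subseteq> frontier (el K1)" "face_set M f \<subseteq> frontier (el K2)"
      "face_set M f \<subseteq> el K1" "face_set M f \<subseteq> el K2"
      using 1 el_props(4) by auto
    have "avg_of a f = (\<lambda>x. (1/2) *\<^sub>R (trace_of K1 a x + trace_of K2 a x))"
      "jump_of a f = (\<lambda>x. cross3 (out_normal M K1 x) (trace_of K1 a x) + cross3 (out_normal M K2 x) (trace_of K2 a x))"
      using 1 by (auto simp: avg_of_def jump_of_def trace_of_def)
    then show ?thesis
      by (auto intro!: bounded_borel_scaleR bounded_borel_const bounded_borel_add cr nt S sub 1)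
  next
    case 2
    have sub: "face_set M f \<subseteq> frontier (el K)" "face_set M f \<subseteq> el K"
      using 2 el_props(4) by auto
    have "avg_of a f = trace_of K a" "jump_of a f = (\<lambda>x. cross3 (out_normal M K x) (trace_of K a x))"
      using 2 by (auto simp: avg_of_def jump_of_def trace_of_def)
    then show ?thesis
      by (auto intro!: cr nt S sub 2)
  qed
  then show "bounded_borel (face_set M f) (avg_of a f)" "bounded_borel (face_set M f) (jump_of a f)" by blast+
qed

text \<open>In the parameter of a side the integrand is a bounded Borel function on the face,
  composed with a continuous parametrization, times a continuous area factor.\<close>

lemma surf_integrable:
  assumes f: "f \<in> F_0 M \<union> F_b M" and \<phi>: "bounded_borel (face_set M f) \<phi>" and s: "s \<in> {0, 1}"
  shows "set_integrable lebesgue (cbox 0 1) (surf_integrand M (face_elem f) (face_set M f) \<phi> i s)"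
proof -
  have K: "face_elem f < nelem M" by (rule face_set_props(1)[OF f])
  interpret chart "emap M (face_elem f)" by (rule chart[OF K])
  have side: "ref_side i s ` cbox 0 1 \<subseteq> ref_cube"
    using s by (auto simp: ref_side_def mem_box_cart)
  have cside: "continuous_on (cbox 0 1) (ref_side i s)"
    unfolding ref_side_def
  proof (intro continuous_on_vec_lambda)
    show "continuous_on (cbox 0 1) (\<lambda>\<eta>::real^2. if l = i then s else if l = i + 1 then \<eta> $ 1 else \<eta> $ 2)" for l
      by (cases "l = i"; cases "l = i + 1") (auto intro!: continuous_intros)
  qed
  have D: "continuous_on ref_cube (pderiv_dir l (emap M (face_elem f)))" for l
  proof -
    have "continuous_on ref_cube (\<lambda>\<xi>. pderiv_dir l (emap M (face_elem f)) \<xi> $ k)" for k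
      unfolding jac_entry[symmetric] by (rule nbhd) (rule continuous_on_subset[OF C1_on_continuous])
    then have "continuous_on ref_cube (\<lambda>\<xi>. \<chi> k. pderiv_dir l (emap M (face_elem f)) \<xi> $ k)"
      by (intro continuous_on_vec_lambda)
    then show ?thesis by simp
  qed
  have 1: "bounded_borel (cbox 0 1) (\<lambda>\<eta>. indicator (face_set M f) (emap M (face_elem f) (ref_side i s \<eta>)) *\<^sub>R
      \<phi> (emap M (face_elem f) (ref_side i s \<eta>)))"
    by (intro bounded_borel_compose[OF \<phi>] continuous_on_compose2[OF cont_F cside side]) simp
  have 2: "bounded_borel (cbox 0 1) (\<lambda>\<eta>. norm (cross3 (pderiv_dir (i + 1) (emap M (face_elem f)) (ref_side i s \<eta>))
      (pderiv_dir (i + 2) (emap M (face_elem f)) (ref_side i s \<eta>))))"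
    by (intro bounded_borel_continuous[OF compact_cbox _ order_refl] continuous_intros continuous_on_cross
        continuous_on_compose2[OF D cside side]) simp
  have "bounded_borel (cbox 0 1) (surf_integrand M (face_elem f) (face_set M f) \<phi> i s)"
    using bounded_borel_mult[OF 1 2] by (simp add: surf_integrand_def[abs_def] Let_def mult.assoc)
  then show ?thesis
    by (rule bounded_borel_integrable) auto
qed

text \<open>Only the pairing of an average with a jump is expanded; the reversed pairing in the
  scheme is reduced to it by symmetry of the inner product.\<close>

lemma surf_rep:
  fixes n m :: nat
  assumes f: "f \<in> F_0 M \<union> F_b M"
    and a: "\<And>i. i < n \<Longrightarrow> broken_continuous (a i)" and b: "\<And>j. j < m \<Longrightarrow> broken_continuous (b j)"
    and v: "\<And>y. y \<in> interiors \<Longrightarrow> v t y = (\<Sum>i<n. s i *\<^sub>R a i y)"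
    and w: "\<And>y. y \<in> interiors \<Longrightarrow> w t y = (\<Sum>j<m. r j *\<^sub>R b j y)"
  shows "surf_integral M (face_elem f) (face_set M f) (\<lambda>x. avg M v f t x \<bullet> jump_T M w f t x) =
    (\<Sum>i<n. \<Sum>j<m. s i * r j *
      surf_integral M (face_elem f) (face_set M f) (\<lambda>x. avg_of (a i) f x \<bullet> jump_of (b j) f x))"
proof -
  let ?si = "\<lambda>\<phi> k \<sigma>. surf_integrand M (face_elem f) (face_set M f) \<phi> k \<sigma>"
  have eq: "?si (\<lambda>x. avg M v f t x \<bullet> jump_T M w f t x) k \<sigma> \<eta> =
     (\<Sum>i<n. \<Sum>j<m. ?si (\<lambda>x. avg_of (a i) f x \<bullet> jump_of (b j) f x) k \<sigma> \<eta> * (s i * r j))" for k \<sigma> \<eta>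
  proof (cases "emap M (face_elem f) (ref_side k \<sigma> \<eta>) \<in> face_set M f")
    case True
    let ?x = "emap M (face_elem f) (ref_side k \<sigma> \<eta>)"
    have "avg M v f t ?x = (\<Sum>i<n. s i *\<^sub>R avg_of (a i) f ?x)"
      by (rule face_linear(1)[OF f True]) (auto intro: a v)
    moreover have "jump_T M w f t ?x = (\<Sum>j<m. r j *\<^sub>R jump_of (b j) f ?x)"
      by (rule face_linear(2)[OF f True]) (auto intro: b w)
    ultimately show ?thesis
      by (simp add: surf_integrand_def Let_def inner_double_sum sum_distrib_left sum_distrib_right mult_ac)
  qed (simp add: surf_integrand_def)
  have "(LINT \<eta>:cbox 0 1|lebesgue. ?si (\<lambda>x. avg M v f t x \<bullet> jump_T M w f t x) k \<sigma> \<eta>) =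
      (\<Sum>i<n. \<Sum>j<m. (LINT \<eta>:cbox 0 1|lebesgue. ?si (\<lambda>x. avg_of (a i) f x \<bullet> jump_of (b j) f x) k \<sigma> \<eta>) * (s i * r j))"
    if "\<sigma> \<in> {0, 1}" for k \<sigma>
    unfolding eq
    by (intro set_integral_double_sum(2) surf_integrable[OF f _ that] bounded_borel_inner face_bounded_borel[OF f] a b)
  then have "surf_integral M (face_elem f) (face_set M f) (\<lambda>x. avg M v f t x \<bullet> jump_T M w f t x) =
    (\<Sum>k\<in>UNIV. \<Sum>\<sigma>\<in>{0, 1}. \<Sum>i<n. \<Sum>j<m.
      (LINT \<eta>:cbox 0 1|lebesgue. ?si (\<lambda>x. avg_of (a i) f x \<bullet> jump_of (b j) f x) k \<sigma> \<eta>) * (s i * r j))"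
    unfolding surf_integral_def by (intro sum.cong refl)
  also have "\<dots> = (\<Sum>i<n. \<Sum>j<m. \<Sum>k\<in>UNIV. \<Sum>\<sigma>\<in>{0, 1}.
      (LINT \<eta>:cbox 0 1|lebesgue. ?si (\<lambda>x. avg_of (a i) f x \<bullet> jump_of (b j) f x) k \<sigma> \<eta>) * (s i * r j))"
    by (simp only: sum.swap[of _ "{..<n}" "{0, 1}"] sum.swap[of _ "{..<n}" "UNIV"]
        sum.swap[of _ "{..<m}" "{0, 1}"] sum.swap[of _ "{..<m}" "UNIV"])
  finally show ?thesis
    by (simp add: surf_integral_def sum_distrib_left distrib_left mult_ac)
qed

definition face_form :: "face set \<Rightarrow> (real^3 \<Rightarrow> real^3) \<Rightarrow> (real^3 \<Rightarrow> real^3) \<Rightarrow> real" where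
  "face_form \<G> a b = (\<Sum>f\<in>\<G>. surf_integral M (face_elem f) (face_set M f) (\<lambda>x. avg_of a f x \<bullet> jump_of b f x))"

lemma face_rep:
  assumes G: "\<G> \<subseteq> F_0 M \<union> F_b M" and v: "has_expansion v n s a" and w: "has_expansion w m r b"
    and a: "\<And>i. i < n \<Longrightarrow> broken_continuous (a i)" and b: "\<And>j. j < m \<Longrightarrow> broken_continuous (b j)"
    and s: "\<And>i. i < n \<Longrightarrow> bounded_borel I (s i)" and r: "\<And>j. j < m \<Longrightarrow> bounded_borel I (r j)"
  shows "face_iprod M \<G> (avg M v) (jump_T M w) =
    (\<Sum>i<n. \<Sum>j<m. (LINT t:I|lebesgue. s i t * r j t) * face_form \<G> (a i) (b j))"
proof -
  obtain N1 where N1: "negligible N1"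
    "\<And>t x. t \<in> I - N1 \<Longrightarrow> x \<in> interiors \<Longrightarrow> v t x = (\<Sum>i<n. s i t *\<^sub>R a i x)"
    using v unfolding has_expansion_def by blast
  obtain N2 where N2: "negligible N2"
    "\<And>t x. t \<in> I - N2 \<Longrightarrow> x \<in> interiors \<Longrightarrow> w t x = (\<Sum>j<m. r j t *\<^sub>R b j x)"
    using w unfolding has_expansion_def by blast
  show ?thesis
    unfolding face_iprod_def
  proof (rule time_integral[OF _ _ s r])
    show "negligible (N1 \<union> N2)" using N1 N2 by simp
    fix t assume t: "t \<in> I - (N1 \<union> N2)"
    have "(\<Sum>f\<in>\<G>. surf_integral M (face_elem f) (face_set M f) (\<lambda>x. avg M v f t x \<bullet> jump_T M w f t x)) =
      (\<Sum>f\<in>\<G>. \<Sum>i<n. \<Sum>j<m. s i t * r j t *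
        surf_integral M (face_elem f) (face_set M f) (\<lambda>x. avg_of (a i) f x \<bullet> jump_of (b j) f x))"
    proof (rule sum.cong[OF refl])
      fix f assume "f \<in> \<G>"
      then have f: "f \<in> F_0 M \<union> F_b M" using G by blast
      show "surf_integral M (face_elem f) (face_set M f) (\<lambda>x. avg M v f t x \<bullet> jump_T M w f t x) =
        (\<Sum>i<n. \<Sum>j<m. s i t * r j t *
        surf_integral M (face_elem f) (face_set M f) (\<lambda>x. avg_of (a i) f x \<bullet> jump_of (b j) f x))"
        by (rule surf_rep[OF f a b]) (use t N1(2) N2(2) in auto)
    qed
    also have "\<dots> = (\<Sum>i<n. \<Sum>j<m. s i t * r j t * face_form \<G> (a i) (b j))"
      unfolding face_form_def sum_distrib_left
      by (simp only: sum.swap[of _ "{..<n}" \<G>] sum.swap[of _ "{..<m}" \<G>])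
    finally show "(\<Sum>f\<in>\<G>. surf_integral M (face_elem f) (face_set M f) (\<lambda>x. avg M v f t x \<bullet> jump_T M w f t x)) =
      (\<Sum>i<n. \<Sum>j<m. s i t * r j t * face_form \<G> (a i) (b j))" .
  qed
qed

end

section \<open>Separable expansions of discrete functions\<close>

text \<open>Concatenation of two finite families, by which sums and differences of expansions become
  a single expansion.\<close>

definition join_fam :: "nat \<Rightarrow> (nat \<Rightarrow> 'a) \<Rightarrow> (nat \<Rightarrow> 'a) \<Rightarrow> nat \<Rightarrow> 'a" where
  "join_fam n f g i = (if i < n then f i else g (i - n))"

lemma sum_join_fam:
  "(\<Sum>i<n + m. h (join_fam n s s' i) (join_fam n a a' i)) = (\<Sum>i<n. h (s i) (a i)) + (\<Sum>j<m. h (s' j) (a' j) :: 'c::comm_monoid_add)"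
proof -
  have "(\<Sum>i<n. h (join_fam n s s' i) (join_fam n a a' i)) = (\<Sum>i<n. h (s i) (a i))"
    by (intro sum.cong) (auto simp: join_fam_def)
  then show ?thesis
    by (induction m) (auto simp: join_fam_def add.assoc)
qed

lemma join_fam_all: "(\<And>i. i < n \<Longrightarrow> P (f i)) \<Longrightarrow> (\<And>j. j < m \<Longrightarrow> P (g j)) \<Longrightarrow> i < n + m \<Longrightarrow> P (join_fam n f g i)"
  by (auto simp: join_fam_def)

context slab_mesh
begin

lemma pullback_rep:
  assumes K: "K < nelem M" and "pulls_back_to M K v (tensor_space S (Q3_space M K))"
  shows "\<exists>(m::nat) s q. (\<forall>j<m. s j \<in> S \<and> q j \<in> Q3_space M K) \<and>
    (\<forall>t\<in>I. \<forall>x\<in>interior (el K). v t x = (\<Sum>j<m. s j t *\<^sub>R chart.piola (emap M K) (q j) x))"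
proof -
  interpret chart "emap M K" by (rule chart[OF K])
  obtain m :: nat and s q where sq: "\<forall>j<m. s j \<in> S \<and> q j \<in> Q3_space M K"
    and u: "\<And>t \<xi>. t \<in> I \<Longrightarrow> \<xi> \<in> interior ref_cube \<Longrightarrow>
        transpose (DF M K \<xi>) *v v t (emap M K \<xi>) = (\<Sum>j<m. s j t *\<^sub>R q j \<xi>)"
    using assms(2) unfolding pulls_back_to_def tensor_space_def by auto
  have "v t x = (\<Sum>j<m. s j t *\<^sub>R piola (q j) x)" if t: "t \<in> I" and x: "x \<in> interior (el K)" for t x
  proof -
    obtain \<xi> where \<xi>: "\<xi> \<in> interior ref_cube" "x = emap M K \<xi>"
      using x interior_E by (auto simp: elem_def)
    then have "\<xi> \<in> ref_cube"
      using interior_subset by blast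
    then show ?thesis
      using pullback_piola[of \<xi> "v t x" "\<lambda>\<xi>. \<Sum>j<m. s j t *\<^sub>R q j \<xi>"] u[OF t \<xi>(1)] \<xi>(2)
      by (simp only: DF_def piola_sum)
  qed
  then show ?thesis
    using sq by blast
qed

lemma piola_zero: "K < nelem M \<Longrightarrow> chart.piola (emap M K) (\<lambda>\<xi>. 0) x = 0"
  by (simp add: chart.piola_def[OF chart])

lemma broken_discrete_scaleR: "broken_discrete a \<Longrightarrow> broken_discrete (\<lambda>x. c *\<^sub>R a x)"
  unfolding broken_discrete_def
proof (intro allI impI)
  fix K assume a: "\<forall>K<nelem M. \<exists>q\<in>Q3_space M K. \<forall>x\<in>interior (el K). a x = chart.piola (emap M K) q x"
    and K: "K < nelem M"
  then obtain q where q: "q \<in> Q3_space M K" "\<forall>x\<in>interior (el K). a x = chart.piola (emap M K) q x"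
    by blast
  show "\<exists>q\<in>Q3_space M K. \<forall>x\<in>interior (el K). c *\<^sub>R a x = chart.piola (emap M K) q x"
    by (rule bexI[of _ "\<lambda>\<xi>. c *\<^sub>R q \<xi>"])
      (use q in \<open>auto simp: chart.piola_def[OF chart[OF K]] matrix_vector_mult_scaleR Q3_space_scaleR\<close>)
qed

lemma broken_continuous_weight:
  assumes "elementwise_constant M c" "broken_continuous a"
  shows "broken_continuous (\<lambda>x. c x *\<^sub>R a x)"
  unfolding broken_continuous_def
proof (intro allI impI)
  fix K assume K: "K < nelem M"
  obtain c0 where c0: "\<And>x. x \<in> interior (el K) \<Longrightarrow> c x = c0"
    using assms(1) K unfolding elementwise_constant_def by blast
  obtain \<alpha> where "continuous_on (el K) \<alpha>" "\<And>x. x \<in> interior (el K) \<Longrightarrow> a x = \<alpha> x"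
    using assms(2) K unfolding broken_continuous_def by blast
  then show "\<exists>\<alpha>. continuous_on (el K) \<alpha> \<and> (\<forall>x\<in>interior (el K). c x *\<^sub>R a x = \<alpha> x)"
    using c0 by (intro exI[of _ "\<lambda>x. c0 *\<^sub>R \<alpha> x"]) (auto intro!: continuous_intros)
qed

text \<open>Local expansions are extended by zero to the other elements and added one element at a
  time, \<open>L\<close> counting the elements already treated. Extension by zero is harmless
  because no continuity between elements is required. Each coefficient is then known to belong to
  the space of some single element.\<close>

lemma global_rep:
  assumes "\<And>K. K < nelem M \<Longrightarrow> pulls_back_to M K v (tensor_space (S K) (Q3_space M K))"
  shows "\<exists>(n::nat) s a. (\<forall>i<n. (\<exists>K<nelem M. s i \<in> S K) \<and> broken_discrete (a i)) \<and>
    (\<forall>t\<in>I. \<forall>x\<in>interiors. v t x = (\<Sum>i<n. s i t *\<^sub>R a i x))"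
proof -
  have "\<exists>n s a. (\<forall>i<n. (\<exists>K<nelem M. s i \<in> S K) \<and> broken_discrete (a i)) \<and>
    (\<forall>t\<in>I. \<forall>K<nelem M. \<forall>x\<in>interior (el K). (\<Sum>i<n::nat. s i t *\<^sub>R a i x) = (if K < L then v t x else 0))"
    if "L \<le> nelem M" for L
    using that
  proof (induction L)
    case 0
    show ?case by (rule exI[of _ 0]) auto
  next
    case (Suc L)
    then have "L \<le> nelem M" by simp
    from Suc.IH[OF this] obtain n :: nat and s a where
      n: "\<And>i. i < n \<Longrightarrow> (\<exists>K<nelem M. s i \<in> S K) \<and> broken_discrete (a i)"
      "\<And>t K x. t \<in> I \<Longrightarrow> K < nelem M \<Longrightarrow> x \<in> interior (el K) \<Longrightarrow>
         (\<Sum>i<n. s i t *\<^sub>R a i x) = (if K < L then v t x else 0)"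
      by blast
    have L: "L < nelem M" using Suc.prems by simp
    obtain m :: nat and s' q where m: "\<And>j. j < m \<Longrightarrow> s' j \<in> S L" "\<And>j. j < m \<Longrightarrow> q j \<in> Q3_space M L"
      "\<And>t x. t \<in> I \<Longrightarrow> x \<in> interior (el L) \<Longrightarrow> v t x = (\<Sum>j<m. s' j t *\<^sub>R chart.piola (emap M L) (q j) x)"
      using pullback_rep[OF L assms[OF L]] by blast
    define a' where "a' j x = (if x \<in> interior (el L) then chart.piola (emap M L) (q j) x else 0)" for j x
    have a': "a' j x = (if K = L then chart.piola (emap M L) (q j) x else 0)"
      if "K < nelem M" "x \<in> interior (el K)" for j x K
      using that interior_unique[OF _ L, of K x] by (auto simp: a'_def)
    have XF': "broken_discrete (a' j)" if "j < m" for j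
      unfolding broken_discrete_def
    proof (intro allI impI)
      fix K assume K: "K < nelem M"
      show "\<exists>q\<in>Q3_space M K. \<forall>x\<in>interior (el K). a' j x = chart.piola (emap M K) q x"
      proof (cases "K = L")
        case True
        then show ?thesis using m(2)[OF that] a'[OF K] by auto
      next
        case False
        then show ?thesis
          by (intro bexI[of _ "\<lambda>\<xi>. 0"] ballI Q3_space_0) (simp add: a'[OF K] piola_zero[OF K])
      qed
    qed
    have "(\<exists>K<nelem M. join_fam n s s' i \<in> S K) \<and> broken_discrete (join_fam n a a' i)" if i: "i < n + m" for i
      by (intro conjI join_fam_all[OF _ _ i, where P="\<lambda>s. \<exists>K<nelem M. s \<in> S K"] join_fam_all[OF _ _ i, where P=broken_discrete])
        (use n m L XF' in auto)
    moreover have "(\<Sum>i<n + m. join_fam n s s' i t *\<^sub>R join_fam n a a' i x) = (if K < Suc L then v t x else 0)"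
      if t: "t \<in> I" and K: "K < nelem M" and x: "x \<in> interior (el K)" for t K x
    proof -
      have "(\<Sum>j<m. s' j t *\<^sub>R a' j x) = (if K = L then v t x else 0)"
        using m(3)[OF t, of x] x by (auto simp: a'[OF K x])
      then show ?thesis
        using sum_join_fam[of "\<lambda>s a. s t *\<^sub>R a x" n s s' a a' m] n(2)[OF t K x] by auto
    qed
    ultimately show ?case
      by blast
  qed
  from this[OF order_refl] obtain n :: nat and s a where
    n: "\<forall>i<n. (\<exists>K<nelem M. s i \<in> S K) \<and> broken_discrete (a i)"
      "\<And>t K x. t \<in> I \<Longrightarrow> K < nelem M \<Longrightarrow> x \<in> interior (el K) \<Longrightarrow>
         (\<Sum>i<n. s i t *\<^sub>R a i x) = (if K < nelem M then v t x else 0)"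
    by blast
  then have "\<forall>t\<in>I. \<forall>x\<in>interiors. v t x = (\<Sum>i<n. s i t *\<^sub>R a i x)"
    by auto
  with n(1) show ?thesis
    by blast
qed

text \<open>Membership in \<open>W_h\<close> includes square integrability on the product of slab
  and domain, hence measurability jointly in time and space.\<close>

lemma rep_bounded_borel:
  assumes s: "\<And>i. i < n \<Longrightarrow> bounded_borel I (s i)" and a: "\<And>i. i < n \<Longrightarrow> broken_continuous (a i)"
  shows "bounded_borel (I \<times> Dom M) (\<lambda>(t, x). if x \<in> interiors then (\<Sum>i<n::nat. s i t *\<^sub>R a i x) else 0)"
proof -
  \<comment> \<open>Each factor is cut off in its own variable and thus becomes a Borel function
    composed with a coordinate projection.\<close>
  have eq: "(\<lambda>p. indicator (I \<times> Dom M) p *\<^sub>R (case p of (t, x) \<Rightarrow> if x \<in> interiors then (\<Sum>i<n. s i t *\<^sub>R a i x) else 0)) =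
      (\<lambda>p. \<Sum>i<n. (indicator I (fst p) *\<^sub>R s i (fst p)) *\<^sub>R (indicator interiors (snd p) *\<^sub>R a i (snd p)))"
  proof (rule ext)
    fix p :: "real \<times> (real^3)"
    show "indicator (I \<times> Dom M) p *\<^sub>R (case p of (t, x) \<Rightarrow> if x \<in> interiors then (\<Sum>i<n. s i t *\<^sub>R a i x) else 0) =
      (\<Sum>i<n. (indicator I (fst p) *\<^sub>R s i (fst p)) *\<^sub>R (indicator interiors (snd p) *\<^sub>R a i (snd p)))"
    proof (cases "snd p \<in> interiors")
      case True
      then have "snd p \<in> Dom M" using Dom_props(3) by blast
      with True show ?thesis
        by (cases p) (auto simp: indicator_def)
    next
      case False
      then show ?thesis by (cases p) auto
    qed
  qed
  have "(\<lambda>p::real \<times> (real^3). (indicator I (fst p) *\<^sub>R s i (fst p)) *\<^sub>R (indicator interiors (snd p) *\<^sub>R a i (snd p)))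
      \<in> borel_measurable borel" if "i < n" for i
  proof (rule borel_measurable_scaleR)
    show "(\<lambda>p::real \<times> (real^3). indicator I (fst p) *\<^sub>R s i (fst p)) \<in> borel_measurable borel"
      by (rule measurable_compose[where g="\<lambda>t. indicator I t *\<^sub>R s i t", OF borel_measurable_continuous_onI])
        (use s[OF that] in \<open>auto simp: bounded_borel_def intro!: continuous_intros\<close>)
    show "(\<lambda>p::real \<times> (real^3). indicator interiors (snd p) *\<^sub>R a i (snd p)) \<in> borel_measurable borel"
      by (rule measurable_compose[where g="\<lambda>x. indicator interiors x *\<^sub>R a i x", OF borel_measurable_continuous_onI])
        (use broken_continuous_bounded_borel[OF a[OF that]] in \<open>auto simp: bounded_borel_def intro!: continuous_intros\<close>)
  qed
  then have 1: "(\<lambda>p. indicator (I \<times> Dom M) p *\<^sub>R (case p of (t, x) \<Rightarrow> if x \<in> interiors then (\<Sum>i<n. s i t *\<^sub>R a i x) else 0))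
      \<in> borel_measurable borel"
    unfolding eq by (intro borel_measurable_sum) auto
  have "\<forall>i. \<exists>C. i < n \<longrightarrow> (\<forall>t\<in>I. norm (s i t) \<le> C)"
    using s unfolding bounded_borel_def by blast
  from choice[OF this] obtain C where C: "\<And>i t. i < n \<Longrightarrow> t \<in> I \<Longrightarrow> norm (s i t) \<le> C i"
    by blast
  have "\<forall>i. \<exists>D. i < n \<longrightarrow> (\<forall>x\<in>interiors. norm (a i x) \<le> D)"
    using broken_continuous_bounded_borel[OF a] unfolding bounded_borel_def by blast
  from choice[OF this] obtain D where D: "\<And>i x. i < n \<Longrightarrow> x \<in> interiors \<Longrightarrow> norm (a i x) \<le> D i"
    by blast
  have "norm (case p of (t, x) \<Rightarrow> if x \<in> interiors then (\<Sum>i<n. s i t *\<^sub>R a i x) else 0) \<le> (\<Sum>i<n. \<bar>C i\<bar> * \<bar>D i\<bar>)"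
    if "p \<in> I \<times> Dom M" for p
  proof (cases "snd p \<in> interiors")
    case True
    have "norm (\<Sum>i<n. s i (fst p) *\<^sub>R a i (snd p)) \<le> (\<Sum>i<n. \<bar>C i\<bar> * \<bar>D i\<bar>)"
    proof (rule sum_norm_le)
      fix i assume "i \<in> {..<n}"
      then have "norm (s i (fst p)) \<le> \<bar>C i\<bar>" "norm (a i (snd p)) \<le> \<bar>D i\<bar>"
        using C[of i "fst p"] D[OF _ True, of i] that by (auto intro: order_trans[OF _ abs_ge_self])
      then show "norm (s i (fst p) *\<^sub>R a i (snd p)) \<le> \<bar>C i\<bar> * \<bar>D i\<bar>"
        by (auto intro: mult_mono)
    qed
    then show ?thesis
      using True by (simp add: case_prod_unfold)
  next
    case False
    then show ?thesis by (simp add: case_prod_unfold sum_nonneg)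
  qed
  with 1 show ?thesis
    unfolding bounded_borel_def by blast
qed

text \<open>A coefficient multiplies a field that may live on all elements, so it has to be a test
  coefficient on every one of them. A test space common to all elements is what makes this condition
  easy to meet.\<close>

lemma W_of_rep:
  assumes s: "\<And>i. i < n \<Longrightarrow> bounded_borel I (s i)" "\<And>i K. i < n \<Longrightarrow> K < nelem M \<Longrightarrow> s i \<in> T_space M K"
    and a: "\<And>i. i < n \<Longrightarrow> broken_discrete (a i)"
  shows "\<exists>w\<in>W_h M. \<forall>t\<in>I. \<forall>x\<in>interiors. w t x = (\<Sum>i<n::nat. s i t *\<^sub>R a i x)"
proof -
  define w where "w t x = (if x \<in> interiors then (\<Sum>i<n. s i t *\<^sub>R a i x) else 0)" for t x
  have "L2_on (I \<times> Dom M) (\<lambda>(t, x). w t x)"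
    unfolding w_def
  proof (rule bounded_borel_L2_on)
    show "bounded_borel (I \<times> Dom M) (\<lambda>(t, x). if x \<in> interiors then \<Sum>i<n. s i t *\<^sub>R a i x else 0)"
      by (intro rep_bounded_borel s(1) broken_discrete_imp_broken_continuous a)
    show "bounded (I \<times> Dom M)"
      by (intro bounded_Times I_props Dom_props)
    show "I \<times> Dom M \<in> sets borel"
      using I_props(1) Dom_props(1) by (simp add: borel_prod[symmetric] pair_measureI)
  qed
  then have "L2L2 (tstart M) (tend M) (Dom M) w"
    by (simp add: L2L2_def slab_int_def)
  moreover have "pulls_back_to M K w (tensor_space (T_space M K) (Q3_space M K))" if K: "K < nelem M" for K
  proof -
    interpret chart "emap M K" by (rule chart[OF K])
    have "\<forall>i. \<exists>q. i < n \<longrightarrow> q \<in> Q3_space M K \<and> (\<forall>x\<in>interior (el K). a i x = piola q x)"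
      using a K unfolding broken_discrete_def by blast
    from choice[OF this] obtain q where q: "\<And>i. i < n \<Longrightarrow> q i \<in> Q3_space M K"
      "\<And>i x. i < n \<Longrightarrow> x \<in> interior (el K) \<Longrightarrow> a i x = piola (q i) x"
      by blast
    show ?thesis
      unfolding pulls_back_to_def
    proof (intro bexI ballI)
      show "(\<lambda>t \<xi>. \<Sum>j<n. s j t *\<^sub>R q j \<xi>) \<in> tensor_space (T_space M K) (Q3_space M K)"
        unfolding tensor_space_def using s(2) q(1) K by blast
      fix t \<xi> assume "t \<in> I" and \<xi>: "\<xi> \<in> interior ref_cube"
      have x: "emap M K \<xi> \<in> interior (el K)"
        using \<xi> interior_E by (auto simp: elem_def)
      then have "w t (emap M K \<xi>) = (\<Sum>i<n. s i t *\<^sub>R piola (q i) (emap M K \<xi>))"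
        using K q(2)[OF _ x] by (auto simp: w_def)
      also have "\<dots> = piola (\<lambda>\<xi>. \<Sum>i<n. s i t *\<^sub>R q i \<xi>) (emap M K \<xi>)"
        by (rule piola_sum[symmetric])
      finally show "transpose (DF M K \<xi>) *v w t (emap M K \<xi>) = (\<Sum>j<n. s j t *\<^sub>R q j \<xi>)"
        using piola_pullback[of \<xi>] \<xi> interior_subset by (auto simp only: DF_def)
    qed
  qed
  ultimately have "w \<in> W_h M"
    by (simp add: W_h_def)
  then show ?thesis
    by (rule bexI[rotated]) (auto simp: w_def)
qed

lemma has_expansionI: "(\<And>t x. t \<in> I \<Longrightarrow> x \<in> interiors \<Longrightarrow> v t x = (\<Sum>i<n. s i t *\<^sub>R a i x)) \<Longrightarrow> has_expansion v n s a"
  unfolding has_expansion_def by (intro exI[of _ "{}"]) auto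

text \<open>The difference is treated as one expansion with concatenated families, so that linearity
  is read off from the separated form of the inner product.\<close>

lemma iprod_diff:
  assumes "has_expansion A n s a" "has_expansion B m r b" "has_expansion z k \<tau> c"
    and "\<And>i. i < n \<Longrightarrow> broken_continuous (a i)" "\<And>j. j < m \<Longrightarrow> broken_continuous (b j)" "\<And>l. l < k \<Longrightarrow> broken_continuous (c l)"
    and "\<And>i. i < n \<Longrightarrow> bounded_borel I (s i)" "\<And>j. j < m \<Longrightarrow> bounded_borel I (r j)" "\<And>l. l < k \<Longrightarrow> bounded_borel I (\<tau> l)"
    and D: "\<And>t x. t \<in> I \<Longrightarrow> x \<in> interiors \<Longrightarrow> D t x = A t x - B t x"
  shows "iprod M D z = iprod M A z - iprod M B z"
proof -
  obtain N1 where N1: "negligible N1"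
    "\<And>t x. t \<in> I - N1 \<Longrightarrow> x \<in> interiors \<Longrightarrow> A t x = (\<Sum>i<n. s i t *\<^sub>R a i x)"
    using assms(1) unfolding has_expansion_def by blast
  obtain N2 where N2: "negligible N2"
    "\<And>t x. t \<in> I - N2 \<Longrightarrow> x \<in> interiors \<Longrightarrow> B t x = (\<Sum>j<m. r j t *\<^sub>R b j x)"
    using assms(2) unfolding has_expansion_def by blast
  define s' where "s' = join_fam n s r"
  define a' where "a' = join_fam n a (\<lambda>j x. - b j x)"
  have "has_expansion D (n + m) s' a'"
    unfolding has_expansion_def
  proof (intro exI[of _ "N1 \<union> N2"] conjI ballI)
    show "negligible (N1 \<union> N2)" using N1 N2 by simp
    fix t x assume "t \<in> I - (N1 \<union> N2)" "x \<in> interiors"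
    then have "D t x = (\<Sum>i<n. s i t *\<^sub>R a i x) - (\<Sum>j<m. r j t *\<^sub>R b j x)"
      using D N1(2) N2(2) by auto
    then show "D t x = (\<Sum>i<n + m. s' i t *\<^sub>R a' i x)"
      using sum_join_fam[of "\<lambda>s a. s t *\<^sub>R a x" n s r a "\<lambda>j x. - b j x" m] by (simp add: s'_def a'_def sum_negf)
  qed
  moreover have "broken_continuous (\<lambda>x. - b j x)" if "j < m" for j
    using broken_continuous_weight[OF _ assms(5)[OF that], of "\<lambda>_. -1"] by (simp add: elementwise_constant_def)
  then have "broken_continuous (a' i)" if "i < n + m" for i
    unfolding a'_def by (intro join_fam_all[OF _ _ that, where P=broken_continuous] assms)
  moreover have "bounded_borel I (s' i)" if "i < n + m" for i
    unfolding s'_def by (intro join_fam_all[OF _ _ that, where P="bounded_borel I"] assms)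
  ultimately have "iprod M D z = (\<Sum>i<n + m. \<Sum>l<k. (LINT t:I|lebesgue. s' i t * \<tau> l t) * dom_inner (a' i) (c l))"
    by (intro iprod_rep assms)
  also have "\<dots> = (\<Sum>i<n. \<Sum>l<k. (LINT t:I|lebesgue. s i t * \<tau> l t) * dom_inner (a i) (c l)) +
      (\<Sum>j<m. \<Sum>l<k. (LINT t:I|lebesgue. r j t * \<tau> l t) * dom_inner (\<lambda>x. - b j x) (c l))"
    unfolding s'_def a'_def
    by (rule sum_join_fam[of "\<lambda>s a. \<Sum>l<k. (LINT t:I|lebesgue. s t * \<tau> l t) * dom_inner a (c l)"])
  finally have eq: "iprod M D z = (\<Sum>i<n. \<Sum>l<k. (LINT t:I|lebesgue. s i t * \<tau> l t) * dom_inner (a i) (c l)) +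
      (\<Sum>j<m. \<Sum>l<k. (LINT t:I|lebesgue. r j t * \<tau> l t) * dom_inner (\<lambda>x. - b j x) (c l))" .
  have neg: "dom_inner (\<lambda>x. - b j x) (c l) = - dom_inner (b j) (c l)" for j l
    by (simp add: dom_inner_def set_lebesgue_integral_def)
  show ?thesis
    unfolding eq neg using iprod_rep[OF assms(1,3)] iprod_rep[OF assms(2,3)] assms by (simp add: sum_negf)
qed

text \<open>Vanishing is upgraded in two stages. The squared spatial norm vanishes for almost every
  time; at such a time the field, continuous on the open elements, is zero almost everywhere and
  hence everywhere there, since an open null set is empty.\<close>

lemma iprod_definite:
  assumes z: "\<And>t x. t \<in> I \<Longrightarrow> x \<in> interiors \<Longrightarrow> z t x = (\<Sum>i<n::nat. s i t *\<^sub>R a i x)"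
    and a: "\<And>i. i < n \<Longrightarrow> broken_continuous (a i)" and s: "\<And>i. i < n \<Longrightarrow> bounded_borel I (s i)"
    and 0: "iprod M z z = 0"
  shows "\<exists>N. negligible N \<and> (\<forall>t\<in>I - N. \<forall>x\<in>interiors. z t x = 0)"
proof -
  define g where "g t = (LINT x:Dom M|lebesgue. z t x \<bullet> z t x)" for t
  have g: "g t = (\<Sum>i<n. \<Sum>j<n. (s i t * s j t) * dom_inner (a i) (a j))" if "t \<in> I" for t
    unfolding g_def by (rule space_integral(1)) (use z a that in auto)
  have "set_integrable lebesgue I (\<lambda>t. \<Sum>i<n. \<Sum>j<n. (s i t * s j t) * dom_inner (a i) (a j))"
    by (intro set_integral_double_sum(1) time_integrable s)
  then have gi: "set_integrable lebesgue I g"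
    by (subst set_integrable_cong[OF refl refl g]) auto
  have nn: "0 \<le> g t" for t
    unfolding g_def set_lebesgue_integral_def by (intro Bochner_Integration.integral_nonneg) simp
  have "AE t in lebesgue. indicator I t *\<^sub>R g t = 0"
    using integral_nonneg_eq_0_iff_AE[of lebesgue "\<lambda>t. indicator I t *\<^sub>R g t"] gi nn 0
    by (simp add: set_integrable_def iprod_def set_lebesgue_integral_def[of lebesgue I] g_def)
  then obtain N where N: "{t. indicator I t *\<^sub>R g t \<noteq> 0} \<subseteq> N" "N \<in> null_sets lebesgue"
    by (auto elim!: AE_E simp: null_sets_def)
  have "z t x = 0" if t: "t \<in> I - N" and x: "x \<in> interiors" for t x
  proof -
    have "g t = 0"
      using N(1) t by (auto simp: indicator_def)
    moreover have "set_integrable lebesgue (Dom M) (\<lambda>x. z t x \<bullet> z t x)"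
      by (rule space_integral(2)) (use z a t in auto)
    ultimately have "AE x in lebesgue. indicator (Dom M) x *\<^sub>R (z t x \<bullet> z t x) = 0"
      using integral_nonneg_eq_0_iff_AE[of lebesgue "\<lambda>x. indicator (Dom M) x *\<^sub>R (z t x \<bullet> z t x)"]
      by (simp add: set_integrable_def g_def set_lebesgue_integral_def)
    then obtain N' where N': "{x. indicator (Dom M) x *\<^sub>R (z t x \<bullet> z t x) \<noteq> 0} \<subseteq> N'" "N' \<in> null_sets lebesgue"
      by (auto elim!: AE_E simp: null_sets_def)
    let ?h = "\<lambda>x. \<Sum>i<n. s i t *\<^sub>R a i x"
    have "continuous_on (interior (el K)) (a i)" if "i < n" "K < nelem M" for i K
      using a[OF that(1)] that(2) continuous_on_subset[OF _ interior_subset] unfolding broken_continuous_def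
      by (metis continuous_on_cong)
    then have "continuous_on interiors (a i)" if "i < n" for i
      using that by (intro continuous_on_open_UN) auto
    then have "continuous_on interiors ?h"
      by (intro continuous_intros) auto
    then have "open (interiors \<inter> ?h -` (- {0}))"
      by (intro continuous_open_preimage) auto
    moreover have "interiors \<inter> ?h -` (- {0}) \<subseteq> N'"
    proof
      fix y assume y: "y \<in> interiors \<inter> ?h -` (- {0})"
      then have "y \<in> Dom M" "z t y \<noteq> 0"
        using Dom_props(3) z[of t y] t by auto
      then show "y \<in> N'"
        using N'(1) by auto
    qed
    then have "negligible (interiors \<inter> ?h -` (- {0}))"
      using N'(2) negligible_iff_null_sets negligible_subset by blast
    ultimately have "interiors \<inter> ?h -` (- {0}) = {}"
      using open_not_negligible by blast
    then show ?thesis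
      using z[of t x] t x by auto
  qed
  then show ?thesis
    using N(2) negligible_iff_null_sets by blast
qed

end

section \<open>The time projection and the energy balance\<close>

lemma face_iprod_commute: "face_iprod M \<G> a b = face_iprod M \<G> b a"
  by (simp add: face_iprod_def inner_commute)

lemma (in slab_mesh) dom_inner_commute: "dom_inner a b = dom_inner b a"
  by (simp add: dom_inner_def inner_commute)

locale uniform_mesh = slab_mesh +
  assumes same_test: "\<And>K K'. K < nelem M \<Longrightarrow> K' < nelem M \<Longrightarrow> T_space M K = T_space M K'"
begin

definition test_coeffs :: "(real \<Rightarrow> real) set" where
  "test_coeffs = {r. \<exists>K<nelem M. r \<in> T_space M K}"

lemma test_coeffs_eq: "K < nelem M \<Longrightarrow> T_space M K = test_coeffs"
  using same_test unfolding test_coeffs_def by blast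

lemma test_coeffs_bounded_borel: "r \<in> test_coeffs \<Longrightarrow> bounded_borel I r"
  unfolding test_coeffs_def using T_bounded_borel by blast

text \<open>The trial spaces of different elements are collected in one union; projection and
  differentiation both lead from it into the common test space.\<close>

definition trial_coeffs :: "(real \<Rightarrow> real) set" where
  "trial_coeffs = {s. \<exists>K<nelem M. s \<in> S_space M K}"

lemma trial_coeffs_bounded_borel: "s \<in> trial_coeffs \<Longrightarrow> bounded_borel I s"
  unfolding trial_coeffs_def using S_bounded_borel by blast

lemma trial_coeffs_projection:
  assumes "s \<in> trial_coeffs"
  shows "\<exists>r\<in>test_coeffs. \<forall>\<tau>\<in>test_coeffs. (LINT t:I|lebesgue. s t * \<tau> t) = (LINT t:I|lebesgue. r t * \<tau> t)"
proof -
  obtain K where K: "K < nelem M" "s \<in> S_space M K"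
    using assms unfolding trial_coeffs_def by blast
  show ?thesis
    using time_projection[OF K] unfolding test_coeffs_eq[OF K(1)] .
qed

lemma trial_coeffs_extension:
  assumes "s \<in> trial_coeffs"
  shows "\<exists>\<sigma> s' N. continuous_on {tstart M..tend M} \<sigma> \<and> (\<forall>t\<in>I. \<sigma> t = s t) \<and> s' \<in> test_coeffs \<and>
    finite N \<and> (\<forall>t\<in>I - N. (s has_vector_derivative s' t) (at t))"
proof -
  obtain K where K: "K < nelem M" "s \<in> S_space M K"
    using assms unfolding trial_coeffs_def by blast
  show ?thesis
    using S_continuous_extension[OF K] unfolding test_coeffs_eq[OF K(1)] .
qed

lemma V_rep:
  assumes "v \<in> V_h M"
  shows "\<exists>(n::nat) s a. (\<forall>i<n. s i \<in> trial_coeffs \<and> broken_discrete (a i)) \<and> (\<forall>t\<in>I. \<forall>x\<in>interiors. v t x = (\<Sum>i<n. s i t *\<^sub>R a i x))"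
  using global_rep[of v "S_space M"] assms unfolding V_h_def trial_coeffs_def by simp

lemma W_rep:
  assumes "v \<in> W_h M"
  shows "\<exists>(n::nat) s a. (\<forall>i<n. s i \<in> test_coeffs \<and> broken_discrete (a i)) \<and> (\<forall>t\<in>I. \<forall>x\<in>interiors. v t x = (\<Sum>i<n. s i t *\<^sub>R a i x))"
  using global_rep[of v "T_space M"] assms unfolding W_h_def test_coeffs_def by simp

lemma W_of_rep':
  assumes "\<And>i. i < n \<Longrightarrow> s i \<in> test_coeffs" "\<And>i. i < n \<Longrightarrow> broken_discrete (a i)"
  shows "\<exists>w\<in>W_h M. \<forall>t\<in>I. \<forall>x\<in>interiors. w t x = (\<Sum>i<n::nat. s i t *\<^sub>R a i x)"
  using W_of_rep[of n s a] assms test_coeffs_bounded_borel test_coeffs_eq by blast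

text \<open>The chosen projection has no formula of its own. The candidate \<open>w0\<close> with
  projected coefficients shows that the choice is not vacuous, and the chosen \<open>w\<close>
  differs from it by a test function orthogonal to itself.\<close>

lemma projection_rep:
  fixes n :: nat
  assumes v: "\<And>t x. t \<in> I \<Longrightarrow> x \<in> interiors \<Longrightarrow> v t x = (\<Sum>i<n. s i t *\<^sub>R a i x)"
    and s: "\<And>i. i < n \<Longrightarrow> s i \<in> trial_coeffs" and a: "\<And>i. i < n \<Longrightarrow> broken_discrete (a i)"
    and r: "\<And>i. i < n \<Longrightarrow> r i \<in> test_coeffs"
    and sr: "\<And>i \<tau>. i < n \<Longrightarrow> \<tau> \<in> test_coeffs \<Longrightarrow> (LINT t:I|lebesgue. s i t * \<tau> t) = (LINT t:I|lebesgue. r i t * \<tau> t)"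
  shows "L2_proj_onto_W M v \<in> W_h M" "has_expansion (L2_proj_onto_W M v) n r a"
proof -
  have Ya: "broken_continuous (a i)" if "i < n" for i
    by (rule broken_discrete_imp_broken_continuous[OF a[OF that]])
  have sv: "has_expansion v n s a"
    by (rule has_expansionI[OF v])
  obtain w0 where w0: "w0 \<in> W_h M" "\<And>t x. t \<in> I \<Longrightarrow> x \<in> interiors \<Longrightarrow> w0 t x = (\<Sum>i<n. r i t *\<^sub>R a i x)"
    using W_of_rep'[of n r a] r a by blast
  have sw0: "has_expansion w0 n r a"
    by (rule has_expansionI[OF w0(2)])
  have orth: "iprod M (\<lambda>t x. v t x - w0 t x) z = 0" if "z \<in> W_h M" for z
  proof -
    obtain m :: nat and \<tau> b where z: "\<And>j. j < m \<Longrightarrow> \<tau> j \<in> test_coeffs" "\<And>j. j < m \<Longrightarrow> broken_discrete (b j)"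
      "\<And>t x. t \<in> I \<Longrightarrow> x \<in> interiors \<Longrightarrow> z t x = (\<Sum>i<m. \<tau> i t *\<^sub>R b i x)"
      using W_rep[OF \<open>z \<in> W_h M\<close>] by blast
    have sz: "has_expansion z m \<tau> b"
      by (rule has_expansionI[OF z(3)])
    have "iprod M v z = (\<Sum>i<n. \<Sum>j<m. (LINT t:I|lebesgue. s i t * \<tau> j t) * dom_inner (a i) (b j))"
      by (rule iprod_rep[OF sv sz]) (auto intro: Ya broken_discrete_imp_broken_continuous z trial_coeffs_bounded_borel s test_coeffs_bounded_borel)
    also have "\<dots> = (\<Sum>i<n. \<Sum>j<m. (LINT t:I|lebesgue. r i t * \<tau> j t) * dom_inner (a i) (b j))"
      by (intro sum.cong refl) (simp add: sr z)
    also have "\<dots> = iprod M w0 z"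
      by (rule iprod_rep[OF sw0 sz, symmetric]) (auto intro: Ya broken_discrete_imp_broken_continuous z r test_coeffs_bounded_borel)
    finally have "iprod M v z - iprod M w0 z = 0" by simp
    moreover have "iprod M (\<lambda>t x. v t x - w0 t x) z = iprod M v z - iprod M w0 z"
      by (rule iprod_diff[OF sv sw0 sz]) (auto intro: Ya broken_discrete_imp_broken_continuous z trial_coeffs_bounded_borel s r test_coeffs_bounded_borel)
    ultimately show ?thesis by simp
  qed
  define w where "w = L2_proj_onto_W M v"
  have "w \<in> W_h M \<and> (\<forall>z\<in>W_h M. iprod M (\<lambda>t x. v t x - w t x) z = 0)"
    unfolding w_def L2_proj_onto_W_def by (rule someI[of _ w0]) (use w0(1) orth in blast)
  then have w: "w \<in> W_h M" "\<And>z. z \<in> W_h M \<Longrightarrow> iprod M (\<lambda>t x. v t x - w t x) z = 0"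
    by blast+
  then show "L2_proj_onto_W M v \<in> W_h M"
    by (simp add: w_def)
  from W_rep[OF w(1)] obtain m :: nat and \<rho> b where
    wr0: "(\<forall>i<m. \<rho> i \<in> test_coeffs \<and> broken_discrete (b i)) \<and> (\<forall>t\<in>I. \<forall>x\<in>interiors. w t x = (\<Sum>i<m. \<rho> i t *\<^sub>R b i x))"
    by (elim exE)
  then have wr: "\<And>j. j < m \<Longrightarrow> \<rho> j \<in> test_coeffs" "\<And>j. j < m \<Longrightarrow> broken_discrete (b j)"
    "\<And>t x. t \<in> I \<Longrightarrow> x \<in> interiors \<Longrightarrow> w t x = (\<Sum>i<m. \<rho> i t *\<^sub>R b i x)"
    by blast+
  have sw: "has_expansion w m \<rho> b"
    by (rule has_expansionI[OF wr(3)])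
  define s' where "s' = join_fam m \<rho> r"
  define a' where "a' = join_fam m b (\<lambda>i x. (-1) *\<^sub>R a i x)"
  have s': "s' i \<in> test_coeffs" if "i < m + n" for i
    unfolding s'_def by (rule join_fam_all[OF _ _ that, where P="\<lambda>s. s \<in> test_coeffs"]) (auto intro: wr r)
  have a': "broken_discrete (a' i)" if "i < m + n" for i
    unfolding a'_def by (rule join_fam_all[OF _ _ that, where P=broken_discrete]) (use wr(2) broken_discrete_scaleR[OF a, of _ "-1"] in auto)
  \<comment> \<open>The difference of \<open>w\<close> and \<open>w0\<close> is realized as an
    explicit member of the test space, equal to it at interior points, so that it can be tested
    against itself.\<close>
  obtain z where z: "z \<in> W_h M" "\<And>t x. t \<in> I \<Longrightarrow> x \<in> interiors \<Longrightarrow> z t x = (\<Sum>i<m + n. s' i t *\<^sub>R a' i x)"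
    using W_of_rep'[of "m + n" s' a'] s' a' by blast
  have zd: "z t x = w t x - w0 t x" if "t \<in> I" "x \<in> interiors" for t x
    using z(2)[OF that] wr(3)[OF that] w0(2)[OF that]
      sum_join_fam[of "\<lambda>s a. s t *\<^sub>R a x" m \<rho> r b "\<lambda>i x. (-1) *\<^sub>R a i x" n]
    by (simp add: s'_def a'_def sum_negf)
  have sz: "has_expansion z (m + n) s' a'"
    by (rule has_expansionI[OF z(2)])
  have "iprod M z z = iprod M w z - iprod M w0 z"
    by (rule iprod_diff[OF sw sw0 sz]) (auto intro: Ya broken_discrete_imp_broken_continuous wr r s' a' test_coeffs_bounded_borel zd)
  moreover have "iprod M v z - iprod M w z = 0"
    using w(2)[OF z(1)] iprod_diff[OF sv sw sz, of "\<lambda>t x. v t x - w t x"]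
    by (auto intro: Ya broken_discrete_imp_broken_continuous wr s s' a' trial_coeffs_bounded_borel test_coeffs_bounded_borel)
  moreover have "iprod M v z - iprod M w0 z = 0"
    using orth[OF z(1)] iprod_diff[OF sv sw0 sz, of "\<lambda>t x. v t x - w0 t x"]
    by (auto intro: Ya broken_discrete_imp_broken_continuous r s s' a' trial_coeffs_bounded_borel test_coeffs_bounded_borel)
  ultimately have zz: "iprod M z z = 0" by simp
  have "\<exists>N. negligible N \<and> (\<forall>t\<in>I - N. \<forall>x\<in>interiors. z t x = 0)"
    by (rule iprod_definite[where s=s' and a=a' and n="m + n", OF z(2) _ _ zz])
      (auto intro: broken_discrete_imp_broken_continuous a' test_coeffs_bounded_borel s')
  then obtain N where N: "negligible N" "\<And>t x. t \<in> I - N \<Longrightarrow> x \<in> interiors \<Longrightarrow> z t x = 0"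
    by blast
  show "has_expansion (L2_proj_onto_W M v) n r a"
    unfolding has_expansion_def w_def[symmetric]
  proof (intro exI[of _ N] conjI ballI N(1))
    fix t x assume t: "t \<in> I - N" and x: "x \<in> interiors"
    have "w t x = w0 t x"
      using N(2)[OF t x] zd[of t x] t x by simp
    then show "w t x = (\<Sum>i<n. r i t *\<^sub>R a i x)"
      using w0(2)[of t x] t x by simp
  qed
qed

section \<open>Time derivatives and the energy difference\<close>

lemma dt_rep:
  fixes n :: nat
  assumes v: "\<And>t x. t \<in> I \<Longrightarrow> x \<in> interiors \<Longrightarrow> v t x = (\<Sum>i<n. s i t *\<^sub>R a i x)"
    and N: "\<And>i. i < n \<Longrightarrow> finite (N i)"
    and s': "\<And>i t. i < n \<Longrightarrow> t \<in> I - N i \<Longrightarrow> (s i has_vector_derivative s' i t) (at t)"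
  shows "has_expansion (\<lambda>t x. c x *\<^sub>R dt v t x) n s' (\<lambda>i x. c x *\<^sub>R a i x)"
  unfolding has_expansion_def
\<comment> \<open>The derivative in \<open>dt\<close> is two-sided, so at the right end of the slab
  it would depend on values beyond it; this time is excluded together with the breakpoints.\<close>
proof (intro exI[of _ "insert (tend M) (\<Union>i<n. N i)"] conjI ballI)
  show "negligible (insert (tend M) (\<Union>i<n. N i))"
    using N by (intro negligible_finite) auto
  fix t x assume t: "t \<in> I - insert (tend M) (\<Union>i<n. N i)" and x: "x \<in> interiors"
  have to: "t \<in> {tstart M<..<tend M}"
    using t by (auto simp: slab_int_def)
  have "((\<lambda>t. \<Sum>i<n. s i t *\<^sub>R a i x) has_vector_derivative (\<Sum>i<n. s' i t *\<^sub>R a i x)) (at t)"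
  proof (rule has_vector_derivative_sum)
    fix i assume "i \<in> {..<n}"
    then have "(s i has_vector_derivative s' i t) (at t)"
      using t by (intro s') auto
    then show "((\<lambda>t. s i t *\<^sub>R a i x) has_vector_derivative s' i t *\<^sub>R a i x) (at t)"
      by (rule bounded_linear.has_vector_derivative[OF bounded_linear_scaleR_left])
  qed
  then have "((\<lambda>t. v t x) has_vector_derivative (\<Sum>i<n. s' i t *\<^sub>R a i x)) (at t)"
    by (rule has_vector_derivative_transform_within_open[OF _ open_greaterThanLessThan to])
      (use v x in \<open>auto simp: slab_int_def\<close>)
  then have "dt v t x = (\<Sum>i<n. s' i t *\<^sub>R a i x)"
    unfolding dt_def by (rule vector_derivative_at)
  then show "c x *\<^sub>R dt v t x = (\<Sum>i<n. s' i t *\<^sub>R (c x *\<^sub>R a i x))"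
    by (simp add: scaleR_sum_right mult.commute)
qed

text \<open>The fundamental theorem requires continuity on the closed slab, supplied by the
  extensions, and tolerates finitely many points without a derivative.\<close>

lemma time_product_rule:
  fixes \<sigma> \<rho> s r s' r' :: "real \<Rightarrow> real"
  assumes \<sigma>: "continuous_on {tstart M..tend M} \<sigma>" "continuous_on {tstart M..tend M} \<rho>"
    and eq: "\<And>t. t \<in> I \<Longrightarrow> \<sigma> t = s t" "\<And>t. t \<in> I \<Longrightarrow> \<rho> t = r t"
    and fin: "finite N" "finite N'"
    and d: "\<And>t. t \<in> I - N \<Longrightarrow> (s has_vector_derivative s' t) (at t)"
      "\<And>t. t \<in> I - N' \<Longrightarrow> (r has_vector_derivative r' t) (at t)"
    and bb: "bounded_borel I s" "bounded_borel I r" "bounded_borel I s'" "bounded_borel I r'"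
  shows "(LINT t:I|lebesgue. s' t * r t) + (LINT t:I|lebesgue. r' t * s t) =
    \<sigma> (tend M) * \<rho> (tend M) - \<sigma> (tstart M) * \<rho> (tstart M)"
proof -
  let ?f = "\<lambda>t. s' t * r t + r' t * s t"
  have i: "set_integrable lebesgue I (\<lambda>t. s' t * r t)" "set_integrable lebesgue I (\<lambda>t. r' t * s t)"
    by (rule time_integrable[OF bb(3,2)], rule time_integrable[OF bb(4,1)])
  have "(?f has_integral (\<sigma> (tend M) * \<rho> (tend M) - \<sigma> (tstart M) * \<rho> (tstart M))) {tstart M..tend M}"
  proof (rule fundamental_theorem_of_calculus_interior_strong[of "N \<union> N'"])
    show "finite (N \<union> N')" "tstart M \<le> tend M"
      using fin t_less by auto
    show "continuous_on {tstart M..tend M} (\<lambda>t. \<sigma> t * \<rho> t)"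
      by (intro continuous_intros \<sigma>)
    fix t assume t: "t \<in> {tstart M<..<tend M} - (N \<union> N')"
    then have tI: "t \<in> I - N" "t \<in> I - N'" and to: "t \<in> {tstart M<..<tend M}"
      by (auto simp: slab_int_def)
    have "((\<lambda>t. s t * r t) has_vector_derivative (s t * r' t + s' t * r t)) (at t)"
      by (rule has_vector_derivative_mult[OF d(1)[OF tI(1)] d(2)[OF tI(2)]])
    then have "((\<lambda>t. \<sigma> t * \<rho> t) has_vector_derivative (s t * r' t + s' t * r t)) (at t)"
      by (rule has_vector_derivative_transform_within_open[OF _ open_greaterThanLessThan to])
        (use eq in \<open>auto simp: slab_int_def\<close>)
    then show "((\<lambda>t. \<sigma> t * \<rho> t) has_vector_derivative ?f t) (at t)"
      by (simp add: algebra_simps)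
  qed
  then have "integral {tstart M..tend M} ?f = \<sigma> (tend M) * \<rho> (tend M) - \<sigma> (tstart M) * \<rho> (tstart M)"
    by (rule integral_unique)
  moreover have "(LINT t:I|lebesgue. ?f t) = integral {tstart M..tend M} ?f"
    using set_integral_add(1)[OF i] unfolding slab_int_def by (rule lebesgue_set_integral_eq)
  ultimately show ?thesis
    using set_integral_add(2)[OF i] by simp
qed

text \<open>Beside the expansion \<open>s\<close>, \<open>a\<close> of a trial function this records the projections \<open>r\<close> of the
  coefficients onto the time test space, their continuous extensions \<open>\<sigma>\<close> to the closed slab and
  their derivatives \<open>s'\<close> off the finite sets \<open>N\<close> of breakpoints.\<close>

definition trial_rep :: "vfield \<Rightarrow> nat \<Rightarrow> (nat \<Rightarrow> real \<Rightarrow> real) \<Rightarrow> (nat \<Rightarrow> real^3 \<Rightarrow> real^3) \<Rightarrow>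
    (nat \<Rightarrow> real \<Rightarrow> real) \<Rightarrow> (nat \<Rightarrow> real \<Rightarrow> real) \<Rightarrow> (nat \<Rightarrow> real \<Rightarrow> real) \<Rightarrow> (nat \<Rightarrow> real set) \<Rightarrow> bool" where
  "trial_rep v n s a r \<sigma> s' N \<longleftrightarrow>
    (\<forall>t\<in>I. \<forall>x\<in>interiors. v t x = (\<Sum>i<n. s i t *\<^sub>R a i x)) \<and>
    (\<forall>i<n. s i \<in> trial_coeffs \<and> broken_discrete (a i) \<and> r i \<in> test_coeffs \<and>
      (\<forall>\<tau>\<in>test_coeffs. (LINT t:I|lebesgue. s i t * \<tau> t) = (LINT t:I|lebesgue. r i t * \<tau> t)) \<and>
      continuous_on {tstart M..tend M} (\<sigma> i) \<and> (\<forall>t\<in>I. \<sigma> i t = s i t) \<and> s' i \<in> test_coeffs \<and>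
      finite (N i) \<and> (\<forall>t\<in>I - N i. (s i has_vector_derivative s' i t) (at t)))"

lemma trial_rep_exists:
  assumes "v \<in> V_h M"
  shows "\<exists>n s a r \<sigma> s' N. trial_rep v n s a r \<sigma> s' N"
proof -
  obtain n :: nat and s a where n: "\<And>i. i < n \<Longrightarrow> s i \<in> trial_coeffs" "\<And>i. i < n \<Longrightarrow> broken_discrete (a i)"
    "\<forall>t\<in>I. \<forall>x\<in>interiors. v t x = (\<Sum>i<n. s i t *\<^sub>R a i x)"
    using V_rep[OF assms] by blast
  have "\<forall>i. \<exists>r. i < n \<longrightarrow> r \<in> test_coeffs \<and>
      (\<forall>\<tau>\<in>test_coeffs. (LINT t:I|lebesgue. s i t * \<tau> t) = (LINT t:I|lebesgue. r t * \<tau> t))"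
    using trial_coeffs_projection[OF n(1)] by blast
  from choice[OF this] obtain r where r: "\<forall>i<n. r i \<in> test_coeffs \<and>
      (\<forall>\<tau>\<in>test_coeffs. (LINT t:I|lebesgue. s i t * \<tau> t) = (LINT t:I|lebesgue. r i t * \<tau> t))"
    by blast
  have "\<forall>i. \<exists>p. i < n \<longrightarrow> continuous_on {tstart M..tend M} (fst p) \<and> (\<forall>t\<in>I. fst p t = s i t) \<and>
      fst (snd p) \<in> test_coeffs \<and> finite (snd (snd p)) \<and>
      (\<forall>t\<in>I - snd (snd p). (s i has_vector_derivative fst (snd p) t) (at t))"
    using trial_coeffs_extension[OF n(1)] by simp
  from choice[OF this] obtain p where p: "\<forall>i<n. continuous_on {tstart M..tend M} (fst (p i)) \<and>
      (\<forall>t\<in>I. fst (p i) t = s i t) \<and> fst (snd (p i)) \<in> test_coeffs \<and> finite (snd (snd (p i))) \<and>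
      (\<forall>t\<in>I - snd (snd (p i)). (s i has_vector_derivative fst (snd (p i)) t) (at t))"
    by blast
  have "trial_rep v n s a r (\<lambda>i. fst (p i)) (\<lambda>i. fst (snd (p i))) (\<lambda>i. snd (snd (p i)))"
    unfolding trial_rep_def using n r p by simp
  then show ?thesis by blast
qed

lemma trial_repD:
  assumes "trial_rep v n s a r \<sigma> s' N" "i < n"
  shows "broken_discrete (a i)" "broken_continuous (a i)" "bounded_borel I (s i)" "bounded_borel I (r i)" "bounded_borel I (s' i)"
proof -
  have *: "s i \<in> trial_coeffs" "broken_discrete (a i)" "r i \<in> test_coeffs" "s' i \<in> test_coeffs"
    using assms unfolding trial_rep_def by blast+
  then show "broken_discrete (a i)" "broken_continuous (a i)" "bounded_borel I (s i)" "bounded_borel I (r i)" "bounded_borel I (s' i)"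
    by (simp_all add: broken_discrete_imp_broken_continuous trial_coeffs_bounded_borel test_coeffs_bounded_borel)
qed

text \<open>The weighted Gram matrix \<open>C\<close> is symmetric, so only the symmetric part of
  the matrix \<open>D\<close> counts, and the product rule evaluates exactly that part. This is the
  origin of the factor 1/2 in the energy.\<close>

lemma time_derivative_term:
  assumes rep: "trial_rep v n s a r \<sigma> s' N" and c: "elementwise_constant M c"
  shows "iprod M (\<lambda>t x. c x *\<^sub>R dt v t x) (L2_proj_onto_W M v) =
     (\<Sum>i<n. \<Sum>j<n. \<sigma> i (tend M) * \<sigma> j (tend M) * dom_inner (\<lambda>x. c x *\<^sub>R a i x) (a j)) / 2 -
     (\<Sum>i<n. \<Sum>j<n. \<sigma> i (tstart M) * \<sigma> j (tstart M) * dom_inner (\<lambda>x. c x *\<^sub>R a i x) (a j)) / 2"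
proof -
  note R = rep[unfolded trial_rep_def]
  define C where "C i j = dom_inner (\<lambda>x. c x *\<^sub>R a i x) (a j)" for i j
  have sym: "C i j = C j i" for i j
    by (simp add: C_def dom_inner_def inner_commute)
  define D where "D i j = (LINT t:I|lebesgue. s' i t * s j t)" for i j
  have srd: "has_expansion (\<lambda>t x. c x *\<^sub>R dt v t x) n s' (\<lambda>i x. c x *\<^sub>R a i x)"
    by (rule dt_rep[where N=N and s=s]) (use R in auto)
  have srp: "has_expansion (L2_proj_onto_W M v) n r a"
    by (rule projection_rep(2)[where s=s]) (use R in auto)
  have "iprod M (\<lambda>t x. c x *\<^sub>R dt v t x) (L2_proj_onto_W M v) =
      (\<Sum>i<n. \<Sum>j<n. (LINT t:I|lebesgue. s' i t * r j t) * C i j)"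
    unfolding C_def by (rule iprod_rep[OF srd srp]) (auto intro: broken_continuous_weight[OF c] trial_repD[OF rep])
  also have "\<dots> = (\<Sum>i<n. \<Sum>j<n. D i j * C i j)"
  proof (intro sum.cong refl)
    fix i j assume "i \<in> {..<n}" "j \<in> {..<n}"
    then have "(LINT t:I|lebesgue. s j t * s' i t) = (LINT t:I|lebesgue. r j t * s' i t)"
      using R by simp
    then show "(LINT t:I|lebesgue. s' i t * r j t) * C i j = D i j * C i j"
      by (simp add: D_def mult.commute)
  qed
  finally have 1: "iprod M (\<lambda>t x. c x *\<^sub>R dt v t x) (L2_proj_onto_W M v) = (\<Sum>i<n. \<Sum>j<n. D i j * C i j)" .
  have "(\<Sum>i<n. \<Sum>j<n. D i j * C i j) = (\<Sum>i<n. \<Sum>j<n. D j i * C i j)"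
    by (subst sum.swap) (simp add: sym)
  then have "2 * (\<Sum>i<n. \<Sum>j<n. D i j * C i j) = (\<Sum>i<n. \<Sum>j<n. (D i j + D j i) * C i j)"
    by (simp add: distrib_right sum.distrib)
  also have "\<dots> = (\<Sum>i<n. \<Sum>j<n. (\<sigma> i (tend M) * \<sigma> j (tend M) - \<sigma> i (tstart M) * \<sigma> j (tstart M)) * C i j)"
  proof (intro sum.cong refl)
    fix i j assume ij: "i \<in> {..<n}" "j \<in> {..<n}"
    have "D i j + D j i = \<sigma> i (tend M) * \<sigma> j (tend M) - \<sigma> i (tstart M) * \<sigma> j (tstart M)"
      unfolding D_def
      by (rule time_product_rule[where N="N i" and N'="N j"]) (use R ij in \<open>auto intro: trial_coeffs_bounded_borel test_coeffs_bounded_borel\<close>)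
    then show "(D i j + D j i) * C i j =
        (\<sigma> i (tend M) * \<sigma> j (tend M) - \<sigma> i (tstart M) * \<sigma> j (tstart M)) * C i j"
      by simp
  qed
  finally show ?thesis
    unfolding 1 C_def[symmetric] by (simp add: left_diff_distrib sum_subtractf)
qed

text \<open>The extensions \<open>\<sigma>\<close> replace the coefficients \<open>s\<close> so that
  the right-hand side remains meaningful and continuous at the left end of the slab.\<close>

lemma energy_term:
  assumes rep: "trial_rep v n s a r \<sigma> s' N" and c: "elementwise_constant M c" and t: "t \<in> I"
  shows "(LINT x:Dom M|lebesgue. c x * (v t x \<bullet> v t x)) =
     (\<Sum>i<n. \<Sum>j<n. \<sigma> i t * \<sigma> j t * dom_inner (\<lambda>x. c x *\<^sub>R a i x) (a j))"
    and "set_integrable lebesgue (Dom M) (\<lambda>x. c x * (v t x \<bullet> v t x))"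
proof -
  note R = rep[unfolded trial_rep_def]
  have 1: "c x *\<^sub>R v t x = (\<Sum>i<n. \<sigma> i t *\<^sub>R (c x *\<^sub>R a i x))" "v t x = (\<Sum>i<n. \<sigma> i t *\<^sub>R a i x)"
    if "x \<in> interiors" for x
  proof -
    have "v t x = (\<Sum>i<n. s i t *\<^sub>R a i x)"
      using R t that by blast
    then show v: "v t x = (\<Sum>i<n. \<sigma> i t *\<^sub>R a i x)"
      using R t by simp
    show "c x *\<^sub>R v t x = (\<Sum>i<n. \<sigma> i t *\<^sub>R (c x *\<^sub>R a i x))"
      unfolding v by (simp add: scaleR_sum_right mult.commute)
  qed
  have Y: "broken_continuous (a i)" "broken_continuous (\<lambda>x. c x *\<^sub>R a i x)" if "i < n" for i
    by (auto intro: broken_continuous_weight[OF c] trial_repD[OF rep that])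
  show "(LINT x:Dom M|lebesgue. c x * (v t x \<bullet> v t x)) =
     (\<Sum>i<n. \<Sum>j<n. \<sigma> i t * \<sigma> j t * dom_inner (\<lambda>x. c x *\<^sub>R a i x) (a j))"
    using space_integral(1)[where v="\<lambda>x. c x *\<^sub>R v t x" and w="v t", OF 1 Y(2,1)] by simp
  show "set_integrable lebesgue (Dom M) (\<lambda>x. c x * (v t x \<bullet> v t x))"
    using space_integral(2)[where v="\<lambda>x. c x *\<^sub>R v t x" and w="v t", OF 1 Y(2,1)] by simp
qed

lemma energy_balance:
  assumes E: "E \<in> V_h M" and H: "H \<in> V_h M"
    and e: "elementwise_constant M \<epsilon>" and mu: "elementwise_constant M \<mu>"
  shows "energy M \<epsilon> \<mu> E H (tend M) - energy M \<epsilon> \<mu> E H (tstart M) =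
    iprod M (\<lambda>t x. \<epsilon> x *\<^sub>R dt E t x) (L2_proj_onto_W M E) +
    iprod M (\<lambda>t x. \<mu> x *\<^sub>R dt H t x) (L2_proj_onto_W M H)"
proof -
  obtain n s a r \<sigma> s' N where rE: "trial_rep E n s a r \<sigma> s' N"
    using trial_rep_exists[OF E] by blast
  obtain m u b q \<upsilon> u' N' where rH: "trial_rep H m u b q \<upsilon> u' N'"
    using trial_rep_exists[OF H] by blast
  define \<Phi> where "\<Phi> t = (\<Sum>i<n. \<Sum>j<n. \<sigma> i t * \<sigma> j t * dom_inner (\<lambda>x. \<epsilon> x *\<^sub>R a i x) (a j)) / 2 +
    (\<Sum>i<m. \<Sum>j<m. \<upsilon> i t * \<upsilon> j t * dom_inner (\<lambda>x. \<mu> x *\<^sub>R b i x) (b j)) / 2" for t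
  have inst: "inst_energy M \<epsilon> \<mu> E H t = \<Phi> t" if "t \<in> I" for t
    unfolding inst_energy_def
    using energy_term(1)[OF rE e that] energy_term(1)[OF rH mu that]
      set_integral_add(2)[OF energy_term(2)[OF rE e that] energy_term(2)[OF rH mu that]]
    by (simp add: \<Phi>_def)
  have "continuous_on {tstart M..tend M} \<Phi>"
    unfolding \<Phi>_def using rE rH unfolding trial_rep_def by (intro continuous_intros) auto
  \<comment> \<open>The initial energy is a limit from within the slab and is evaluated by
    continuity of \<open>\<Phi>\<close>; the final time belongs to the slab, so there the
    instantaneous formula applies directly.\<close>
  then have "(\<Phi> \<longlongrightarrow> \<Phi> (tstart M)) (at_right (tstart M))"
    using t_less by (auto simp: continuous_on_Icc_at_rightD)
  moreover have "\<forall>\<^sub>F t in at_right (tstart M). \<Phi> t = inst_energy M \<epsilon> \<mu> E H t"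
    unfolding eventually_at_right[OF t_less] using t_less inst by (auto simp: slab_int_def)
  ultimately have "(inst_energy M \<epsilon> \<mu> E H \<longlongrightarrow> \<Phi> (tstart M)) (at_right (tstart M))"
    by (rule Lim_transform_eventually)
  then have "energy M \<epsilon> \<mu> E H (tstart M) = \<Phi> (tstart M)"
    unfolding energy_def by (simp add: tendsto_Lim)
  moreover have "energy M \<epsilon> \<mu> E H (tend M) = \<Phi> (tend M)"
    using t_less inst[of "tend M"] by (simp add: energy_def slab_int_def)
  ultimately show ?thesis
    using time_derivative_term[OF rE e] time_derivative_term[OF rH mu] by (simp add: \<Phi>_def)
qed

lemma spatial_terms_cancel:
  assumes E: "E \<in> V_h M" and H: "H \<in> V_h M" and G: "\<G> \<subseteq> F_0 M \<union> F_b M"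
  defines "PE \<equiv> L2_proj_onto_W M E" and "PH \<equiv> L2_proj_onto_W M H"
  shows "iprod M (curl_h M E) PH = iprod M H (curl_h M PE)"
    and "face_iprod M \<G> (avg M H) (jump_T M PE) = face_iprod M \<G> (jump_T M E) (avg M PH)"
proof -
  obtain n s a r \<sigma> s' N where "trial_rep E n s a r \<sigma> s' N"
    using trial_rep_exists[OF E] by blast
  note R = this[unfolded trial_rep_def]
  obtain m u b q \<upsilon> u' N' where "trial_rep H m u b q \<upsilon> u' N'"
    using trial_rep_exists[OF H] by blast
  note Q = this[unfolded trial_rep_def]
  have sE: "has_expansion E n s a" and sH: "has_expansion H m u b"
    using R Q by (auto intro: has_expansionI)
  have sPE: "has_expansion PE n r a"
    unfolding PE_def by (rule projection_rep(2)[where s=s]) (use R in auto)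
  have sPH: "has_expansion PH m q b"
    unfolding PH_def by (rule projection_rep(2)[where s=u]) (use Q in auto)
  have bb: "bounded_borel I (s i)" "bounded_borel I (r i)" "broken_discrete (a i)" "broken_continuous (a i)" "broken_continuous (curl_of (a i))" if "i < n" for i
    using R that by (auto intro: trial_coeffs_bounded_borel test_coeffs_bounded_borel broken_discrete_imp_broken_continuous broken_discrete_curl_of_broken_continuous)
  have bb': "bounded_borel I (u i)" "bounded_borel I (q i)" "broken_discrete (b i)" "broken_continuous (b i)" if "i < m" for i
    using Q that by (auto intro: trial_coeffs_bounded_borel test_coeffs_bounded_borel broken_discrete_imp_broken_continuous)
  \<comment> \<open>Both numbers equal the product of the two projections \<open>r i\<close> and
    \<open>q j\<close>, since each of these is an admissible test coefficient for the other
    factor.\<close>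
  have key: "(LINT t:I|lebesgue. s i t * q j t) = (LINT t:I|lebesgue. u j t * r i t)" if "i < n" "j < m" for i j
  proof -
    have "(LINT t:I|lebesgue. s i t * q j t) = (LINT t:I|lebesgue. r i t * q j t)"
      "(LINT t:I|lebesgue. u j t * r i t) = (LINT t:I|lebesgue. q j t * r i t)"
      using R Q that by auto
    then show ?thesis by (simp add: mult.commute)
  qed
  have "iprod M (curl_h M E) PH = (\<Sum>i<n. \<Sum>j<m. (LINT t:I|lebesgue. s i t * q j t) * dom_inner (curl_of (a i)) (b j))"
    by (rule iprod_rep[OF curl_rep[OF sE] sPH]) (use bb bb' in auto)
  also have "\<dots> = (\<Sum>i<n. \<Sum>j<m. (LINT t:I|lebesgue. u j t * r i t) * dom_inner (b j) (curl_of (a i)))"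
    by (intro sum.cong refl) (simp add: key dom_inner_commute)
  also have "\<dots> = (\<Sum>j<m. \<Sum>i<n. (LINT t:I|lebesgue. u j t * r i t) * dom_inner (b j) (curl_of (a i)))"
    by (rule sum.swap)
  also have "\<dots> = iprod M H (curl_h M PE)"
    by (rule iprod_rep[OF sH curl_rep[OF sPE], symmetric]) (use bb bb' in auto)
  finally show "iprod M (curl_h M E) PH = iprod M H (curl_h M PE)" .
  have "face_iprod M \<G> (avg M H) (jump_T M PE) =
      (\<Sum>j<m. \<Sum>i<n. (LINT t:I|lebesgue. u j t * r i t) * face_form \<G> (b j) (a i))"
    by (rule face_rep[OF G sH sPE]) (use bb bb' in auto)
  also have "\<dots> = (\<Sum>j<m. \<Sum>i<n. (LINT t:I|lebesgue. q j t * s i t) * face_form \<G> (b j) (a i))"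
    by (intro sum.cong refl) (simp add: key[symmetric], simp add: mult.commute)
  also have "\<dots> = face_iprod M \<G> (avg M PH) (jump_T M E)"
    by (rule face_rep[OF G sPH sE, symmetric]) (use bb bb' in auto)
  also have "\<dots> = face_iprod M \<G> (jump_T M E) (avg M PH)"
    by (rule face_iprod_commute)
  finally show "face_iprod M \<G> (avg M H) (jump_T M PE) = face_iprod M \<G> (jump_T M E) (avg M PH)" .
qed

lemma L2_proj_in_W: "v \<in> V_h M \<Longrightarrow> L2_proj_onto_W M v \<in> W_h M"
proof -
  assume "v \<in> V_h M"
  then obtain n s a r \<sigma> s' N where "trial_rep v n s a r \<sigma> s' N"
    using trial_rep_exists by blast
  note R = this[unfolded trial_rep_def]
  show ?thesis
    by (rule projection_rep(1)[where s=s and r=r]) (use R in auto)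
qed

end

theorem theorem3p1:
  fixes M :: slab and \<epsilon> \<mu> :: "real^3 \<Rightarrow> real" and J g E_h H_h :: vfield
  assumes mesh: "hex_slab M"
    and eps_pos: "\<forall>x\<in>Dom M. 0 < \<epsilon> x"
    and mu_pos: "\<forall>x\<in>Dom M. 0 < \<mu> x"
    and data: "admissible_data M J g"
    and same_degree: "\<exists>p. \<forall>K<nelem M. \<forall>k<nsub M K. ptdeg M K k = p"
    and same_test: "\<forall>K<nelem M. \<forall>K'<nelem M. T_space M K = T_space M K'"
    and eps_const: "elementwise_constant M \<epsilon>"
    and mu_const: "elementwise_constant M \<mu>"
    and E_in: "E_h \<in> V_h M"
    and H_in: "H_h \<in> V_h M"
    and scheme: "\<forall>v\<in>W_h M. \<forall>w\<in>W_h M. C_h M \<epsilon> \<mu> (E_h, H_h) (v, w) = L_h M J g (v, w)"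
  shows "energy M \<epsilon> \<mu> E_h H_h (tend M) - energy M \<epsilon> \<mu> E_h H_h (tstart M)
       = iprod M J (L2_proj_onto_W M E_h)
         - face_iprod M (F_b M) (n_cross M g) (avg M (L2_proj_onto_W M H_h))"
proof -
  interpret uniform_mesh M
    by (unfold_locales, rule mesh) (use same_test in blast)
  let ?PE = "L2_proj_onto_W M E_h" and ?PH = "L2_proj_onto_W M H_h"
  have "energy M \<epsilon> \<mu> E_h H_h (tend M) - energy M \<epsilon> \<mu> E_h H_h (tstart M) =
      C_h M \<epsilon> \<mu> (E_h, H_h) (?PE, ?PH)"
    using energy_balance[OF E_in H_in eps_const mu_const]
      spatial_terms_cancel[OF E_in H_in order_refl]
    by (simp add: C_h_def)
  also have "\<dots> = L_h M J g (?PE, ?PH)"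
    using scheme L2_proj_in_W E_in H_in by blast
  finally show ?thesis
    by (simp add: L_h_def)
qed

end
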